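(* Let $P\to M$ and $P_S\to S$ be right principal $\mathcal O$-bundles, where $S\subset M$ is a submanifold endowed with a volume form ${\rm d}^ks$, and let $\mathcal A$ and $\mathcal A_S$ be principal connections on $P$ and $P_S$, respectively. Let $\mathbf J_R:T^*Q_{KK}\to\mathfrak{aut}(P_S)^*$ be the momentum map associated to the cotangent lift of the right action of $\mathcal{A}ut(P_S)$ on $Q_{KK}$ by composition $\mathcal Q\mapsto\mathcal Q\circ\psi$. For $\mathcal P_{\mathcal Q}\in T^*_{\mathcal Q}Q_{KK}$ put $\mathbf P^{\mathcal A}_{\mathbf Q}=(\operatorname{Hor}^{\mathcal A}_{\mathcal Q})^*\mathcal P_{\mathcal Q}$ and $\zeta=\mathbb J\circ\mathcal P_{\mathcal Q}$. Then, under the identification $\mathfrak{aut}(P_S)^*\simeq\mathfrak X(S)^*\times\mathcal F_{\mathcal O}(P_S,\mathfrak o)^*$ given by $\mathcal A_S$, $$\mathbf J_R(\mathcal Q,\mathbf P^{\mathcal A}_{\mathbf Q},\zeta)=\left(\mathbf P^{\mathcal A}_{\mathbf Q}\cdot\mathbf d\mathbf Q+\zeta\cdot(\mathcal Q^*\mathcal A-\mathcal A_S),\ \zeta\right)\in\mathfrak X(S)^*\times\mathcal F_{\mathcal O}(P_S,\mathfrak o)^*.$$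
   Context: $\mathcal O$ is a Lie group with Lie algebra $\mathfrak o$; $\Phi_g$ denotes the right $\mathcal O$-action on $P$ or $P_S$, $\xi_P$ the infinitesimal generator of $\xi\in\mathfrak o$, and $\pi$ the bundle projections. $\mathcal{A}ut(P_S)$ is the group of $\mathcal O$-equivariant diffeomorphisms of $P_S$, with Lie algebra $\mathfrak{aut}(P_S)$ of equivariant vector fields $U$; $[U]\in\mathfrak X(S)$ satisfies $T\pi\circ U=[U]\circ\pi$. A principal connection on $P$ is $\mathcal A\in\Omega^1(P,\mathfrak o)$ with $\Phi_g^*\mathcal A=\operatorname{Ad}_{g^{-1}}\mathcal A$, $\mathcal A(\xi_P)=\xi$; $\operatorname{Hor}^{\mathcal A}$ is the horizontal lift. Same for $\mathcal A_S$ on $P_S$. The connection $\mathcal A_S$ gives $\mathfrak{aut}(P_S)\simeq\mathfrak X(S)\times\mathcal F_{\mathcal O}(P_S,\mathfrak o)$, $U\mapsto([U],\mathcal A_S(U))$, where $\mathcal F_{\mathcal O}(P_S,\mathfrak o)$ is the space of $f:P_S\to\mathfrak o$ with $f\circ\Phi_g=\operatorname{Ad}_{g^{-1}}f$. Using ${\rm d}^ks$, the duals are $\mathfrak X(S)^*=\Omega^1(S)$ and $\mathcal F_{\mathcal O}(P_S,\mathfrak o)^*=\mathcal F_{\mathcal O}(P_S,\mathfrak o^* )$ (functions with $\lambda\circ\Phi_g=\operatorname{Ad}^*_g\lambda$, $\langle\operatorname{Ad}_g^*\mu,\xi\rangle=\langle\mu,\operatorname{Ad}_g\xi\rangle$),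 with the $L^2$ pairings $\int_S(\cdot)\,{\rm d}^ks$ of contractions (assumed to converge). $Q_{KK}$ is the set of equivariant (smooth) maps $\mathcal Q:P_S\to P$ whose induced map $\mathbf Q:S\to M$, $\pi\circ\mathcal Q=\mathbf Q\circ\pi$, is an embedding. $T_{\mathcal Q}Q_{KK}$ consists of equivariant vector fields $P_S\to TP$ along $\mathcal Q$; $T^*_{\mathcal Q}Q_{KK}$ is identified with equivariant one-forms $\mathcal P_{\mathcal Q}:P_S\to T^*P$ along $\mathcal Q$, with pairing $\langle\mathcal P_{\mathcal Q},\mathcal V_{\mathcal Q}\rangle=\int_S(\mathcal P_{\mathcal Q}\cdot\mathcal V_{\mathcal Q})\,{\rm d}^ks$. Here $\mathbb J:T^*P\to\mathfrak o^*$ is $\langle\mathbb J(\alpha_p),\xi\rangle=\langle\alpha_p,\xi_P(p)\rangle$, and $\mathbf P^{\mathcal A}_{\mathbf Q}(s)\cdot v=\mathcal P_{\mathcal Q}(p_s)\cdot\operatorname{Hor}^{\mathcal A}_{\mathcal Q(p_s)}(v)$ for $v\in T_{\mathbf Q(s)}M$, $\pi(p_s)=s$. The data $(\mathcal Q,\mathbf P^{\mathcal A}_{\mathbf Q},\zeta)$ determine $\mathcal P_{\mathcal Q}$. The form $\zeta\cdot(\mathcal Q^*\mathcal A-\mathcal A_S)$ (contraction of $\mathfrak o^*$ with $\mathfrak o$) is an $\mathcal O$-invariant horizontal one-form on $P_S$ and is identified with the one-form on $S$ of which it is the pullback. The momentum map of a cotangent-lifted action of a group with Lie algebra $\mathfrak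 g$ on a manifold $Q$ is $\langle\mathbf J(\alpha_q),\xi\rangle=\langle\alpha_q,\xi_Q(q)\rangle$; here the infinitesimal generator of $U\in\mathfrak{aut}(P_S)$ at $\mathcal Q$ is $\mathbf d\mathcal Q\circ U$. *)

theory Defs
  imports "HOL-Analysis.Analysis" "HOL-Algebra.Group"
begin

section \<open>Smooth manifolds\<close>

text \<open>
  On open subsets of finite-dimensional normed spaces, \<open>Ck_on k\<close> is the usual class of
  \<open>k\<close> times continuously differentiable maps: a map is of class \<open>k + 1\<close> iff it is
  differentiable and all its directional derivatives are of class \<open>k\<close>.
\<close>

primrec Ck_on ::
    "nat \<Rightarrow> 'a::real_normed_vector set \<Rightarrow> ('a \<Rightarrow> 'b::real_normed_vector) \<Rightarrow> bool" where
  "Ck_on 0 X f \<longleftrightarrow> continuous_on X f"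
| "Ck_on (Suc k) X f \<longleftrightarrow>
     (\<forall>x\<in>X. f differentiable (at x)) \<and>
     (\<forall>v. Ck_on k X (\<lambda>x. frechet_derivative f (at x) v))"

definition smooth_on ::
    "'a::real_normed_vector set \<Rightarrow> ('a \<Rightarrow> 'b::real_normed_vector) \<Rightarrow> bool" where
  "smooth_on X f \<longleftrightarrow> (\<forall>k. Ck_on k X f)"

text \<open>
  A chart is a domain together with its coordinate map; only the values of the coordinate map on
  the domain matter. The model space is any finite-dimensional normed space. It is not required to
  be of class \<^class>\<open>euclidean_space\<close>, since that would exclude dimension zero (for
  instance discrete structure groups).
\<close>

type_synonym ('a, 'e) chart = "'a set \<times> ('a \<Rightarrow> 'e)"
type_synonym ('a, 'e) atlas = "('a, 'e) chart set"

definition points :: "('a, 'e) atlas \<Rightarrow> 'a set" where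
  "points A = (\<Union>c\<in>A. fst c)"

abbreviation param :: "('a, 'e) chart \<Rightarrow> 'e \<Rightarrow> 'a" where
  "param c \<equiv> inv_into (fst c) (snd c)"

definition local_rep ::
    "('a, 'e) chart \<Rightarrow> ('b, 'f) chart \<Rightarrow> ('a \<Rightarrow> 'b) \<Rightarrow> 'e \<Rightarrow> 'f" where
  "local_rep c d F = snd d \<circ> F \<circ> param c"

definition manifold_topology :: "('a, 'e::real_normed_vector) atlas \<Rightarrow> 'a topology" where
  "manifold_topology A =
     topology (\<lambda>W. W \<subseteq> points A \<and> (\<forall>c\<in>A. open (snd c ` (W \<inter> fst c))))"

definition smooth_manifold :: "('a, 'e::real_normed_vector) atlas \<Rightarrow> bool" where
  "smooth_manifold A \<longleftrightarrow>
     (\<exists>B::'e set. finite B \<and> span B = UNIV) \<and>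
     (\<forall>c\<in>A. inj_on (snd c) (fst c) \<and> open (snd c ` fst c)) \<and>
     (\<forall>c\<in>A. \<forall>d\<in>A. open (snd c ` (fst c \<inter> fst d)) \<and>
        smooth_on (snd c ` (fst c \<inter> fst d)) (local_rep c d id)) \<and>
     Hausdorff_space (manifold_topology A) \<and> second_countable (manifold_topology A)"

lemma openin_manifold_topology:
  assumes "smooth_manifold A"
  shows "openin (manifold_topology A) W \<longleftrightarrow>
    W \<subseteq> points A \<and> (\<forall>c\<in>A. open (snd c ` (W \<inter> fst c)))"
proof -
  have inj: "inj_on (snd c) (fst c)" if "c \<in> A" for c
    using assms that by (auto simp: smooth_manifold_def)
  have "istopology (\<lambda>W. W \<subseteq> points A \<and> (\<forall>c\<in>A. open (snd c ` (W \<inter> fst c))))"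
    unfolding istopology_def
  proof (intro conjI allI impI ballI)
    fix S T c
    assume S: "S \<subseteq> points A \<and> (\<forall>c\<in>A. open (snd c ` (S \<inter> fst c)))"
      and T: "T \<subseteq> points A \<and> (\<forall>c\<in>A. open (snd c ` (T \<inter> fst c)))"
      and c: "c \<in> A"
    have "snd c ` (S \<inter> T \<inter> fst c) = snd c ` (S \<inter> fst c) \<inter> snd c ` (T \<inter> fst c)"
      using inj[OF c] by (auto simp: inj_on_def image_iff)
    then show "open (snd c ` (S \<inter> T \<inter> fst c))"
      using S T c by (simp add: open_Int)
  next
    fix \<K> c
    assume K: "\<forall>K\<in>\<K>. K \<subseteq> points A \<and> (\<forall>c\<in>A. open (snd c ` (K \<inter> fst c)))"
      and c: "c \<in> A"
    have "snd c ` (\<Union>\<K> \<inter> fst c) = (\<Union>K\<in>\<K>. snd c ` (K \<inter> fst c))"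
      by auto
    then show "open (snd c ` (\<Union>\<K> \<inter> fst c))"
      using K c by (simp add: open_UN)
  qed auto
  then show ?thesis
    by (simp add: manifold_topology_def topology_inverse')
qed

definition smooth_map ::
    "('a, 'e::real_normed_vector) atlas \<Rightarrow> ('b, 'f::real_normed_vector) atlas \<Rightarrow> ('a \<Rightarrow> 'b) \<Rightarrow> bool"
  where
  "smooth_map A B F \<longleftrightarrow> F ` points A \<subseteq> points B \<and>
     (\<forall>c\<in>A. \<forall>d\<in>B. open (snd c ` (fst c \<inter> F -` fst d)) \<and>
        smooth_on (snd c ` (fst c \<inter> F -` fst d)) (local_rep c d F))"

definition diffeomorphism ::
    "('a, 'e::real_normed_vector) atlas \<Rightarrow> ('b, 'f::real_normed_vector) atlas \<Rightarrow> ('a \<Rightarrow> 'b) \<Rightarrow> bool"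
  where
  "diffeomorphism A B F \<longleftrightarrow> smooth_map A B F \<and>
     (\<exists>H. smooth_map B A H \<and> (\<forall>x\<in>points A. H (F x) = x) \<and> (\<forall>y\<in>points B. F (H y) = y))"

definition prod_atlas ::
    "('a, 'e) atlas \<Rightarrow> ('b, 'f) atlas \<Rightarrow> ('a \<times> 'b, 'e \<times> 'f) atlas" where
  "prod_atlas A B = {(fst c \<times> fst d, map_prod (snd c) (snd d)) | c d. c \<in> A \<and> d \<in> B}"

definition restrict_atlas :: "('a, 'e) atlas \<Rightarrow> 'a set \<Rightarrow> ('a, 'e) atlas" where
  "restrict_atlas A W = (\<lambda>c. (fst c \<inter> W, snd c)) ` A"


section \<open>Tangent vectors\<close>

text \<open>
  A tangent vector at a point is the family of its coordinate representations in all charts of the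
  atlas around that point, related to each other by the derivatives of the coordinate changes. The
  entries at all other charts are zero, so that equality of tangent vectors at a point is equality
  of functions. Sums and multiples of tangent vectors are taken chart by chart.
\<close>

type_synonym ('a, 'e) tvec = "('a, 'e) chart \<Rightarrow> 'e"

definition tangent_space ::
    "('a, 'e::real_normed_vector) atlas \<Rightarrow> 'a \<Rightarrow> ('a, 'e) tvec set" where
  "tangent_space A p = {v.
     (\<forall>c\<in>A. \<forall>d\<in>A. p \<in> fst c \<and> p \<in> fst d \<longrightarrow>
        v d = frechet_derivative (local_rep c d id) (at (snd c p)) (v c)) \<and>
     (\<forall>c. \<not> (c \<in> A \<and> p \<in> fst c) \<longrightarrow> v c = 0)}"

text \<open>The tangent vector at \<open>p\<close> whose coordinates in the chart \<open>c\<close> are \<open>e\<close>:\<close>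

definition coord_vector ::
    "('a, 'e::real_normed_vector) atlas \<Rightarrow> ('a, 'e) chart \<Rightarrow> 'a \<Rightarrow> 'e \<Rightarrow> ('a, 'e) tvec" where
  "coord_vector A c p e = (\<lambda>d.
     if d \<in> A \<and> p \<in> fst d then frechet_derivative (local_rep c d id) (at (snd c p)) e else 0)"

text \<open>
  The derivative of \<open>F\<close> at \<open>p\<close>, computed in some chart \<open>c\<close> around \<open>p\<close>; the result does not depend
  on \<open>c\<close> when \<open>F\<close> is smooth near \<open>p\<close>.
\<close>

definition tangent_map ::
    "('a, 'e::real_normed_vector) atlas \<Rightarrow> ('b, 'f::real_normed_vector) atlas \<Rightarrow> ('a \<Rightarrow> 'b) \<Rightarrow> 'a \<Rightarrow>
     ('a, 'e) tvec \<Rightarrow> ('b, 'f) tvec" where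
  "tangent_map A B F p v = (\<lambda>d.
     if d \<in> B \<and> F p \<in> fst d
     then (let c = (SOME c. c \<in> A \<and> p \<in> fst c)
           in frechet_derivative (local_rep c d F) (at (snd c p)) (v c))
     else 0)"

definition tangent_linear ::
    "('a, 'e::real_normed_vector) atlas \<Rightarrow> 'a \<Rightarrow> (('a, 'e) tvec \<Rightarrow> 'w::real_vector) \<Rightarrow> bool" where
  "tangent_linear A p f \<longleftrightarrow>
     (\<forall>v\<in>tangent_space A p. \<forall>w\<in>tangent_space A p. \<forall>a b.
        f (\<lambda>c. a *\<^sub>R v c + b *\<^sub>R w c) = a *\<^sub>R f v + b *\<^sub>R f w)"

definition embedding ::
    "('a, 'e::real_normed_vector) atlas \<Rightarrow> ('b, 'f::real_normed_vector) atlas \<Rightarrow> ('a \<Rightarrow> 'b) \<Rightarrow> bool"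
  where
  "embedding A B F \<longleftrightarrow> smooth_map A B F \<and>
     (\<forall>p\<in>points A. inj_on (tangent_map A B F p) (tangent_space A p)) \<and>
     embedding_map (manifold_topology A) (manifold_topology B) F"

definition submanifold ::
    "('a, 'e::real_normed_vector) atlas \<Rightarrow> ('a, 'f::real_normed_vector) atlas \<Rightarrow> bool" where
  "submanifold S M \<longleftrightarrow> smooth_manifold S \<and> smooth_manifold M \<and> points S \<subseteq> points M \<and> embedding S M id"

text \<open>
  Vector fields and (\<open>'w\<close>-valued) one-forms along a map \<open>F\<close> from \<open>B\<close> to \<open>A\<close>: the value at \<open>x\<close> is a
  tangent vector, respectively a covector, of \<open>A\<close> at \<open>F x\<close>. Smoothness means smoothness of the
  components with respect to the charts of \<open>B\<close> and \<open>A\<close>.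
\<close>

definition vector_field_along ::
    "('b, 'f::real_normed_vector) atlas \<Rightarrow> ('a, 'e::real_normed_vector) atlas \<Rightarrow> ('b \<Rightarrow> 'a) \<Rightarrow>
     ('b \<Rightarrow> ('a, 'e) tvec) \<Rightarrow> bool" where
  "vector_field_along B A F V \<longleftrightarrow>
     (\<forall>x\<in>points B. V x \<in> tangent_space A (F x)) \<and>
     (\<forall>b\<in>B. \<forall>a\<in>A. smooth_on (snd b ` (fst b \<inter> F -` fst a)) (\<lambda>y. V (param b y) a))"

definition covector_field_along ::
    "('b, 'f::real_normed_vector) atlas \<Rightarrow> ('a, 'e::real_normed_vector) atlas \<Rightarrow> ('b \<Rightarrow> 'a) \<Rightarrow>
     ('b \<Rightarrow> ('a, 'e) tvec \<Rightarrow> 'w::real_normed_vector) \<Rightarrow> bool" where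
  "covector_field_along B A F \<alpha> \<longleftrightarrow>
     (\<forall>x\<in>points B. tangent_linear A (F x) (\<alpha> x)) \<and>
     (\<forall>b\<in>B. \<forall>a\<in>A. \<forall>e. smooth_on (snd b ` (fst b \<inter> F -` fst a))
        (\<lambda>y. \<alpha> (param b y) (coord_vector A a (F (param b y)) e)))"

definition vector_fields ::
    "('a, 'e::real_normed_vector) atlas \<Rightarrow> ('a \<Rightarrow> ('a, 'e) tvec) set" where
  "vector_fields A = {X. vector_field_along A A id X}"

definition one_forms ::
    "('a, 'e::real_normed_vector) atlas \<Rightarrow> ('a \<Rightarrow> ('a, 'e) tvec \<Rightarrow> real) set" where
  "one_forms A = {\<alpha>. covector_field_along A A id \<alpha>}"


section \<open>Volume forms and integration\<close>

text \<open>A form of degree \<open>k\<close> is evaluated on lists of \<open>k\<close> tangent vectors.\<close>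

definition volume_form ::
    "('a, 'e::real_normed_vector) atlas \<Rightarrow> ('a \<Rightarrow> ('a, 'e) tvec list \<Rightarrow> real) \<Rightarrow> bool" where
  "volume_form A \<omega> \<longleftrightarrow>
     (let k = dim (UNIV :: 'e set) in
       (\<forall>p\<in>points A. \<forall>vs. length vs = k \<and> set vs \<subseteq> tangent_space A p \<longrightarrow>
          (\<forall>i<k. tangent_linear A p (\<lambda>v. \<omega> p (vs[i := v]))) \<and>
          (\<forall>i j. i < j \<and> j < k \<and> vs ! i = vs ! j \<longrightarrow> \<omega> p vs = 0)) \<and>
       (\<forall>c\<in>A. \<forall>es. length es = k \<longrightarrow>
          smooth_on (snd c ` fst c) (\<lambda>x. \<omega> (param c x) (map (coord_vector A c (param c x)) es))) \<and>
       (\<forall>p\<in>points A. \<exists>vs. length vs = k \<and> set vs \<subseteq> tangent_space A p \<and> \<omega> p vs \<noteq> 0))"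

text \<open>
  The Borel measure of a volume form \<open>\<omega>\<close> (for the orientation defined by \<open>\<omega>\<close> itself): in a chart with
  coordinates \<open>x\<close> relative to a basis \<open>bs\<close> of the model space it has density
  \<open>\<bar>\<omega>(\<partial>/\<partial>x\<^sub>1, \<dots>, \<partial>/\<partial>x\<^sub>k)\<bar>\<close> with respect to Lebesgue measure \<open>dx\<^sub>1 \<dots> dx\<^sub>k\<close>. For
  \<open>k = 0\<close> the product measure is a unit point mass, and one obtains a weighted counting measure.
\<close>

definition is_volume_measure ::
    "('a, 'e::real_normed_vector) atlas \<Rightarrow> ('a \<Rightarrow> ('a, 'e) tvec list \<Rightarrow> real) \<Rightarrow> 'a measure \<Rightarrow> bool"
  where
  "is_volume_measure A \<omega> \<mu> \<longleftrightarrow>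
     space \<mu> = points A \<and>
     sets \<mu> = sigma_sets (points A) {W. openin (manifold_topology A) W} \<and>
     (\<forall>c\<in>A. \<forall>bs. distinct bs \<and> independent (set bs) \<and> span (set bs) = UNIV \<longrightarrow>
        (\<forall>X\<in>sets \<mu>. X \<subseteq> fst c \<longrightarrow>
           emeasure \<mu> X =
             (\<integral>\<^sup>+ x. (let y = (\<Sum>i<length bs. x i *\<^sub>R bs ! i) in
                 ennreal \<bar>\<omega> (param c y) (map (coord_vector A c (param c y)) bs)\<bar>
                   * indicator (snd c ` X) y)
              \<partial>(\<Pi>\<^sub>M i\<in>{..<length bs}. (lborel :: real measure)))))"

definition volume_measure ::
    "('a, 'e::real_normed_vector) atlas \<Rightarrow> ('a \<Rightarrow> ('a, 'e) tvec list \<Rightarrow> real) \<Rightarrow> 'a measure" where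
  "volume_measure A \<omega> = (THE \<mu>. is_volume_measure A \<omega> \<mu>)"


definition integrable_over ::
    "('a, 'e::real_normed_vector) atlas \<Rightarrow> ('a \<Rightarrow> ('a, 'e) tvec list \<Rightarrow> real) \<Rightarrow> ('a \<Rightarrow> real) \<Rightarrow> bool"
  where
  "integrable_over A \<omega> f \<longleftrightarrow> set_integrable (volume_measure A \<omega>) (points A) f"

definition integral_over ::
    "('a, 'e::real_normed_vector) atlas \<Rightarrow> ('a \<Rightarrow> ('a, 'e) tvec list \<Rightarrow> real) \<Rightarrow> ('a \<Rightarrow> real) \<Rightarrow> real"
  where
  "integral_over A \<omega> f = (LINT s:points A|volume_measure A \<omega>. f s)"


section \<open>Lie groups and principal bundles\<close>

record ('g, 'eg) lie_group_data = "'g monoid" +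
  group_atlas :: "('g, 'eg) atlas"

definition lie_group :: "('g, 'eg::real_normed_vector) lie_group_data \<Rightarrow> bool" where
  "lie_group G \<longleftrightarrow>
     group G \<and> smooth_manifold (group_atlas G) \<and> carrier G = points (group_atlas G) \<and>
     smooth_map (prod_atlas (group_atlas G) (group_atlas G)) (group_atlas G)
       (\<lambda>(g, h). g \<otimes>\<^bsub>G\<^esub> h) \<and>
     smooth_map (group_atlas G) (group_atlas G) (\<lambda>g. inv\<^bsub>G\<^esub> g)"

text \<open>The tangent space at the identity; only its vector space structure and \<open>Ad\<close> are needed.\<close>

definition lie_algebra :: "('g, 'eg::real_normed_vector) lie_group_data \<Rightarrow> ('g, 'eg) tvec set" where
  "lie_algebra G = tangent_space (group_atlas G) \<one>\<^bsub>G\<^esub>"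

definition Ad ::
    "('g, 'eg::real_normed_vector) lie_group_data \<Rightarrow> 'g \<Rightarrow> ('g, 'eg) tvec \<Rightarrow> ('g, 'eg) tvec" where
  "Ad G g = tangent_map (group_atlas G) (group_atlas G)
     (\<lambda>h. g \<otimes>\<^bsub>G\<^esub> h \<otimes>\<^bsub>G\<^esub> inv\<^bsub>G\<^esub> g) \<one>\<^bsub>G\<^esub>"

record ('p, 'ep, 'm, 'em, 'g) pbundle =
  total_atlas :: "('p, 'ep) atlas"
  base_atlas :: "('m, 'em) atlas"
  proj :: "'p \<Rightarrow> 'm"
  act :: "'p \<Rightarrow> 'g \<Rightarrow> 'p"

definition principal_bundle ::
    "('g, 'eg::real_normed_vector) lie_group_data \<Rightarrow>
     ('p, 'ep::real_normed_vector, 'm, 'em::real_normed_vector, 'g) pbundle \<Rightarrow> bool" where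
  "principal_bundle G P \<longleftrightarrow>
     smooth_manifold (total_atlas P) \<and> smooth_manifold (base_atlas P) \<and>
     smooth_map (total_atlas P) (base_atlas P) (proj P) \<and>
     smooth_map (prod_atlas (total_atlas P) (group_atlas G)) (total_atlas P) (\<lambda>(p, g). act P p g) \<and>
     (\<forall>p\<in>points (total_atlas P). act P p \<one>\<^bsub>G\<^esub> = p \<and>
        (\<forall>g\<in>carrier G. proj P (act P p g) = proj P p \<and>
           (\<forall>h\<in>carrier G. act P (act P p g) h = act P p (g \<otimes>\<^bsub>G\<^esub> h)))) \<and>
     (\<forall>m\<in>points (base_atlas P). \<exists>W \<tau>.
        openin (manifold_topology (base_atlas P)) W \<and> m \<in> W \<and>
        diffeomorphism (prod_atlas (restrict_atlas (base_atlas P) W) (group_atlas G))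
          (restrict_atlas (total_atlas P) (proj P -` W)) \<tau> \<and>
        (\<forall>n\<in>W. \<forall>g\<in>carrier G. proj P (\<tau> (n, g)) = n \<and>
           (\<forall>h\<in>carrier G. \<tau> (n, g \<otimes>\<^bsub>G\<^esub> h) = act P (\<tau> (n, g)) h)))"

definition act_tangent ::
    "('p, 'ep::real_normed_vector, 'm, 'em, 'g) pbundle \<Rightarrow> 'g \<Rightarrow> 'p \<Rightarrow> ('p, 'ep) tvec \<Rightarrow> ('p, 'ep) tvec"
  where
  "act_tangent P g = tangent_map (total_atlas P) (total_atlas P) (\<lambda>p. act P p g)"

definition proj_tangent ::
    "('p, 'ep::real_normed_vector, 'm, 'em::real_normed_vector, 'g) pbundle \<Rightarrow> 'p \<Rightarrow>
     ('p, 'ep) tvec \<Rightarrow> ('m, 'em) tvec" where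
  "proj_tangent P = tangent_map (total_atlas P) (base_atlas P) (proj P)"

definition fundamental_field ::
    "('g, 'eg::real_normed_vector) lie_group_data \<Rightarrow>
     ('p, 'ep::real_normed_vector, 'm, 'em, 'g) pbundle \<Rightarrow> ('g, 'eg) tvec \<Rightarrow> 'p \<Rightarrow> ('p, 'ep) tvec" where
  "fundamental_field G P \<xi> p =
     tangent_map (group_atlas G) (total_atlas P) (\<lambda>g. act P p g) \<one>\<^bsub>G\<^esub> \<xi>"

definition principal_connection ::
    "('g, 'eg::real_normed_vector) lie_group_data \<Rightarrow>
     ('p, 'ep::real_normed_vector, 'm, 'em, 'g) pbundle \<Rightarrow>
     ('p \<Rightarrow> ('p, 'ep) tvec \<Rightarrow> ('g, 'eg) tvec) \<Rightarrow> bool" where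
  "principal_connection G P \<A> \<longleftrightarrow>
     (\<forall>p\<in>points (total_atlas P). \<forall>v\<in>tangent_space (total_atlas P) p. \<A> p v \<in> lie_algebra G) \<and>
     (\<forall>d\<in>group_atlas G.
        covector_field_along (total_atlas P) (total_atlas P) id (\<lambda>p v. \<A> p v d)) \<and>
     (\<forall>p\<in>points (total_atlas P). \<forall>v\<in>tangent_space (total_atlas P) p. \<forall>g\<in>carrier G.
        \<A> (act P p g) (act_tangent P g p v) = Ad G (inv\<^bsub>G\<^esub> g) (\<A> p v)) \<and>
     (\<forall>p\<in>points (total_atlas P). \<forall>\<xi>\<in>lie_algebra G. \<A> p (fundamental_field G P \<xi> p) = \<xi>)"

definition Hor ::
    "('p, 'ep::real_normed_vector, 'm, 'em::real_normed_vector, 'g) pbundle \<Rightarrow>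
     ('p \<Rightarrow> ('p, 'ep) tvec \<Rightarrow> ('g, 'eg::real_normed_vector) tvec) \<Rightarrow> 'p \<Rightarrow>
     ('m, 'em) tvec \<Rightarrow> ('p, 'ep) tvec" where
  "Hor P \<A> p v =
     (THE u. u \<in> tangent_space (total_atlas P) p \<and> proj_tangent P p u = v \<and> \<A> p u = (\<lambda>_. 0))"

text \<open>
  Passage to the quotient: \<open>descend\<close> is the function on the base determined by a function that is
  constant on the fibres, \<open>reduce_form\<close> is the one-form on the base of which \<open>\<gamma>\<close> is the pullback.
\<close>

definition descend :: "('p, 'ep, 'm, 'em, 'g) pbundle \<Rightarrow> ('p \<Rightarrow> 'x) \<Rightarrow> 'm \<Rightarrow> 'x" where
  "descend P f m = (THE y. \<forall>p\<in>points (total_atlas P). proj P p = m \<longrightarrow> f p = y)"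

definition reduce_form ::
    "('p, 'ep::real_normed_vector, 'm, 'em::real_normed_vector, 'g) pbundle \<Rightarrow>
     ('p \<Rightarrow> ('p, 'ep) tvec \<Rightarrow> real) \<Rightarrow> 'm \<Rightarrow> ('m, 'em) tvec \<Rightarrow> real" where
  "reduce_form P \<gamma> m v = (THE r. \<forall>p\<in>points (total_atlas P). \<forall>u\<in>tangent_space (total_atlas P) p.
     proj P p = m \<and> proj_tangent P p u = v \<longrightarrow> \<gamma> p u = r)"


section \<open>Infinitesimal automorphisms and their dual\<close>

definition aut_algebra ::
    "('g, 'eg::real_normed_vector) lie_group_data \<Rightarrow>
     ('q, 'eq::real_normed_vector, 's, 'es, 'g) pbundle \<Rightarrow> ('q \<Rightarrow> ('q, 'eq) tvec) set" where
  "aut_algebra G PS = {U \<in> vector_fields (total_atlas PS).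
     \<forall>p\<in>points (total_atlas PS). \<forall>g\<in>carrier G. U (act PS p g) = act_tangent PS g p (U p)}"

definition base_field ::
    "('q, 'eq::real_normed_vector, 's, 'es::real_normed_vector, 'g) pbundle \<Rightarrow>
     ('q \<Rightarrow> ('q, 'eq) tvec) \<Rightarrow> 's \<Rightarrow> ('s, 'es) tvec" where
  "base_field PS U = descend PS (\<lambda>p. proj_tangent PS p (U p))"

text \<open>
  The space \<open>F\<^sub>O(P\<^sub>S, o\<^sup>*)\<close>. An \<open>o\<^sup>*\<close>-valued function assigns to each point a covector at the
  identity, so its smoothness is that of a covector field along the constant map.
\<close>

definition equivariant_dual_functions ::
    "('g, 'eg::real_normed_vector) lie_group_data \<Rightarrow>
     ('q, 'eq::real_normed_vector, 's, 'es, 'g) pbundle \<Rightarrow> ('q \<Rightarrow> ('g, 'eg) tvec \<Rightarrow> real) set" where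
  "equivariant_dual_functions G PS = {l.
     covector_field_along (total_atlas PS) (group_atlas G) (\<lambda>_. \<one>\<^bsub>G\<^esub>) l \<and>
     (\<forall>p\<in>points (total_atlas PS). \<forall>g\<in>carrier G. \<forall>\<xi>\<in>lie_algebra G.
        l (act PS p g) \<xi> = l p (Ad G g \<xi>))}"

text \<open>
  The integrands of the \<open>L\<^sup>2\<close> pairings of \<open>(\<beta>, l) \<in> X(S)\<^sup>* \<times> F\<^sub>O(P\<^sub>S, o)\<^sup>*\<close> with
  \<open>([U], \<A>\<^sub>S(U))\<close>, as functions on \<open>S\<close>, and the element of \<open>aut(P\<^sub>S)\<^sup>*\<close> identified with
  \<open>(\<beta>, l)\<close> by means of the connection \<open>\<A>\<^sub>S\<close>.
\<close>

definition base_contraction ::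
    "('q, 'eq::real_normed_vector, 's, 'es::real_normed_vector, 'g) pbundle \<Rightarrow>
     ('s \<Rightarrow> ('s, 'es) tvec \<Rightarrow> real) \<Rightarrow> ('q \<Rightarrow> ('q, 'eq) tvec) \<Rightarrow> 's \<Rightarrow> real" where
  "base_contraction PS \<beta> U = (\<lambda>s. \<beta> s (base_field PS U s))"

definition fiber_contraction ::
    "('q, 'eq::real_normed_vector, 's, 'es, 'g) pbundle \<Rightarrow>
     ('q \<Rightarrow> ('q, 'eq) tvec \<Rightarrow> ('g, 'eg) tvec) \<Rightarrow>
     ('q \<Rightarrow> ('g, 'eg::real_normed_vector) tvec \<Rightarrow> real) \<Rightarrow> ('q \<Rightarrow> ('q, 'eq) tvec) \<Rightarrow> 's \<Rightarrow> real" where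
  "fiber_contraction PS \<A>S l U = descend PS (\<lambda>p. l p (\<A>S p (U p)))"

definition aut_dual_of_pair ::
    "('q, 'eq::real_normed_vector, 's, 'es::real_normed_vector, 'g) pbundle \<Rightarrow>
     ('s \<Rightarrow> ('s, 'es) tvec list \<Rightarrow> real) \<Rightarrow>
     ('q \<Rightarrow> ('q, 'eq) tvec \<Rightarrow> ('g, 'eg::real_normed_vector) tvec) \<Rightarrow>
     ('s \<Rightarrow> ('s, 'es) tvec \<Rightarrow> real) \<times> ('q \<Rightarrow> ('g, 'eg) tvec \<Rightarrow> real) \<Rightarrow>
     ('q \<Rightarrow> ('q, 'eq) tvec) \<Rightarrow> real" where
  "aut_dual_of_pair PS \<omega> \<A>S = (\<lambda>(\<beta>, l) U.
     integral_over (base_atlas PS) \<omega> (base_contraction PS \<beta> U) +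
     integral_over (base_atlas PS) \<omega> (fiber_contraction PS \<A>S l U))"


section \<open>The Kaluza-Klein configuration space\<close>

definition base_map ::
    "('p, 'ep, 'm, 'em, 'g) pbundle \<Rightarrow> ('q, 'eq, 's, 'es, 'g) pbundle \<Rightarrow> ('q \<Rightarrow> 'p) \<Rightarrow> 's \<Rightarrow> 'm" where
  "base_map P PS Q = descend PS (\<lambda>p. proj P (Q p))"

definition Q_KK ::
    "('g, 'eg) lie_group_data \<Rightarrow>
     ('p, 'ep::real_normed_vector, 'm, 'em::real_normed_vector, 'g) pbundle \<Rightarrow>
     ('q, 'eq::real_normed_vector, 's, 'es::real_normed_vector, 'g) pbundle \<Rightarrow> ('q \<Rightarrow> 'p) set" where
  "Q_KK G P PS = {Q.
     smooth_map (total_atlas PS) (total_atlas P) Q \<and>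
     (\<forall>p\<in>points (total_atlas PS). \<forall>g\<in>carrier G. Q (act PS p g) = act P (Q p) g) \<and>
     embedding (base_atlas PS) (base_atlas P) (base_map P PS Q)}"

definition cotangent_Q_KK ::
    "('g, 'eg) lie_group_data \<Rightarrow>
     ('p, 'ep::real_normed_vector, 'm, 'em, 'g) pbundle \<Rightarrow>
     ('q, 'eq::real_normed_vector, 's, 'es, 'g) pbundle \<Rightarrow> ('q \<Rightarrow> 'p) \<Rightarrow>
     ('q \<Rightarrow> ('p, 'ep) tvec \<Rightarrow> real) set" where
  "cotangent_Q_KK G P PS Q = {\<alpha>.
     covector_field_along (total_atlas PS) (total_atlas P) Q \<alpha> \<and>
     (\<forall>p\<in>points (total_atlas PS). \<forall>g\<in>carrier G. \<forall>v\<in>tangent_space (total_atlas P) (Q p).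
        \<alpha> (act PS p g) (act_tangent P g (Q p) v) = \<alpha> p v)}"

definition Q_KK_contraction ::
    "('q, 'eq, 's, 'es, 'g) pbundle \<Rightarrow> ('q \<Rightarrow> ('p, 'ep) tvec \<Rightarrow> real) \<Rightarrow>
     ('q \<Rightarrow> ('p, 'ep) tvec) \<Rightarrow> 's \<Rightarrow> real" where
  "Q_KK_contraction PS \<alpha> V = descend PS (\<lambda>p. \<alpha> p (V p))"

definition Q_KK_pairing ::
    "('q, 'eq, 's, 'es::real_normed_vector, 'g) pbundle \<Rightarrow>
     ('s \<Rightarrow> ('s, 'es) tvec list \<Rightarrow> real) \<Rightarrow>
     ('q \<Rightarrow> ('p, 'ep) tvec \<Rightarrow> real) \<Rightarrow> ('q \<Rightarrow> ('p, 'ep) tvec) \<Rightarrow> real" where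
  "Q_KK_pairing PS \<omega> \<alpha> V =
     integral_over (base_atlas PS) \<omega> (Q_KK_contraction PS \<alpha> V)"


section \<open>Momentum maps\<close>

text \<open>
  The momentum map of a cotangent-lifted action, for a pairing of covectors with tangent vectors and
  the infinitesimal generators \<open>gen \<xi> q\<close> of the action on the configuration manifold.
\<close>

definition cotangent_momentum_map ::
    "('cov \<Rightarrow> 'vec \<Rightarrow> real) \<Rightarrow> ('lie \<Rightarrow> 'conf \<Rightarrow> 'vec) \<Rightarrow> 'conf \<Rightarrow> 'cov \<Rightarrow> 'lie \<Rightarrow> real" where
  "cotangent_momentum_map pair gen q \<alpha> \<xi> = pair \<alpha> (gen \<xi> q)"

definition fiber_momentum_map ::
    "('g, 'eg::real_normed_vector) lie_group_data \<Rightarrow>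
     ('p, 'ep::real_normed_vector, 'm, 'em, 'g) pbundle \<Rightarrow>
     'p \<Rightarrow> (('p, 'ep) tvec \<Rightarrow> real) \<Rightarrow> ('g, 'eg) tvec \<Rightarrow> real" where
  "fiber_momentum_map G P = cotangent_momentum_map (\<lambda>\<alpha> v. \<alpha> v) (fundamental_field G P)"

text \<open>The infinitesimal generator of \<open>U\<close> for the action by composition on the right:\<close>

definition composition_generator ::
    "('p, 'ep::real_normed_vector, 'm, 'em, 'g) pbundle \<Rightarrow>
     ('q, 'eq::real_normed_vector, 's, 'es, 'g) pbundle \<Rightarrow>
     ('q \<Rightarrow> ('q, 'eq) tvec) \<Rightarrow> ('q \<Rightarrow> 'p) \<Rightarrow> 'q \<Rightarrow> ('p, 'ep) tvec" where
  "composition_generator P PS U Q = (\<lambda>p. tangent_map (total_atlas PS) (total_atlas P) Q p (U p))"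

definition J_R ::
    "('p, 'ep::real_normed_vector, 'm, 'em, 'g) pbundle \<Rightarrow>
     ('q, 'eq::real_normed_vector, 's, 'es::real_normed_vector, 'g) pbundle \<Rightarrow>
     ('s \<Rightarrow> ('s, 'es) tvec list \<Rightarrow> real) \<Rightarrow>
     ('q \<Rightarrow> 'p) \<Rightarrow> ('q \<Rightarrow> ('p, 'ep) tvec \<Rightarrow> real) \<Rightarrow> ('q \<Rightarrow> ('q, 'eq) tvec) \<Rightarrow> real" where
  "J_R P PS \<omega> = cotangent_momentum_map (Q_KK_pairing PS \<omega>) (composition_generator P PS)"

text \<open>The components \<open>\<^bold>P\<^sup>\<A>\<^sub>\<^bold>Q = (Hor\<^sup>\<A>)\<^sup>* \<P>\<close> and \<open>\<zeta> = \<J> \<circ> \<P>\<close> of a covector \<open>\<P>\<close> at \<open>Q\<close>:\<close>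

definition horizontal_momentum ::
    "('p, 'ep::real_normed_vector, 'm, 'em::real_normed_vector, 'g) pbundle \<Rightarrow>
     ('q, 'eq, 's, 'es, 'g) pbundle \<Rightarrow>
     ('p \<Rightarrow> ('p, 'ep) tvec \<Rightarrow> ('g, 'eg::real_normed_vector) tvec) \<Rightarrow>
     ('q \<Rightarrow> 'p) \<Rightarrow> ('q \<Rightarrow> ('p, 'ep) tvec \<Rightarrow> real) \<Rightarrow> 's \<Rightarrow> ('m, 'em) tvec \<Rightarrow> real" where
  "horizontal_momentum P PS \<A> Q \<P> s v = descend PS (\<lambda>p. \<P> p (Hor P \<A> (Q p) v)) s"

definition fiber_momentum ::
    "('g, 'eg::real_normed_vector) lie_group_data \<Rightarrow>
     ('p, 'ep::real_normed_vector, 'm, 'em, 'g) pbundle \<Rightarrow>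
     ('q \<Rightarrow> 'p) \<Rightarrow> ('q \<Rightarrow> ('p, 'ep) tvec \<Rightarrow> real) \<Rightarrow> 'q \<Rightarrow> ('g, 'eg) tvec \<Rightarrow> real" where
  "fiber_momentum G P Q \<P> = (\<lambda>p. fiber_momentum_map G P (Q p) (\<P> p))"

text \<open>The one-form on \<open>P\<^sub>S\<close> given by \<open>\<zeta> \<cdot> (Q\<^sup>*\<A> - \<A>\<^sub>S)\<close>:\<close>

definition connection_difference_form ::
    "('p, 'ep::real_normed_vector, 'm, 'em, 'g) pbundle \<Rightarrow>
     ('q, 'eq::real_normed_vector, 's, 'es, 'g) pbundle \<Rightarrow>
     ('p \<Rightarrow> ('p, 'ep) tvec \<Rightarrow> ('g, 'eg::real_normed_vector) tvec) \<Rightarrow>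
     ('q \<Rightarrow> ('q, 'eq) tvec \<Rightarrow> ('g, 'eg) tvec) \<Rightarrow>
     ('q \<Rightarrow> 'p) \<Rightarrow> ('q \<Rightarrow> ('g, 'eg) tvec \<Rightarrow> real) \<Rightarrow> 'q \<Rightarrow> ('q, 'eq) tvec \<Rightarrow> real" where
  "connection_difference_form P PS \<A> \<A>S Q \<zeta> p u =
     \<zeta> p (\<lambda>d. \<A> (Q p) (tangent_map (total_atlas PS) (total_atlas P) Q p u) d - \<A>S p u d)"

end

(*
  Let u be a tangent vector of P_S at p. Split TQ(u) into its A-horizontal part and the vertical part
  generated by A(TQ(u)). The covector P(p) sees the horizontal part through P^A applied to dQ[u] and the
  vertical part through zeta, and writing A(TQ(u)) = (Q^*A - A_S)(u) + A_S(u) gives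
  P(p)(TQ(u)) = beta([u]) + zeta(p)(A_S(u)). Taking u = U(p) and integrating yields the formula for J_R.
  The same identity, read as beta([u]) = P(p)(TQ(u)) - zeta(p)(A_S(u)) and evaluated along a smooth local
  section of P_S, shows that beta is a smooth one-form. That every vertical vector is generated by the Lie
  algebra follows by differentiating x = sigma(pi(x)) k(x), where sigma is a local section and k the group
  component relative to it.
*)
theory Submission
  imports Defs
begin

section \<open>Bounded coordinates and calculus of smooth functions\<close>

text \<open>The model spaces are merely normed spaces with a finite spanning set, and
  \<open>Ck_on\<close> differentiates in constant directions, so even the chain rule for smooth maps
  rests on bounded coordinate functionals. Local sections and group components exist only near a
  point; smoothness is therefore treated as a property of a map at a point, and identities of maps
  are differentiated as equalities on a neighbourhood.

  On S the form \<beta> is given by definite descriptions (\<open>Hor\<close>,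
  \<open>descend\<close>, \<open>reduce_form\<close>). They denote what they should because the
  structure group acts transitively on the fibres and every vertical vector is fundamental.
  Linearity and smoothness of \<beta> are hard to read off its definition: treating the two summands
  separately would call for smoothness of the horizontal lift. In the sum the terms with \<A>
  cancel; what remains is built from \<P>, TQ, \<zeta> and the connection on P_S, all smooth along a
  section. The equality of momentum maps is an equality of integrands at each point of S, followed
  by additivity of the integral.\<close>

definition finite_dim :: "'e::real_vector itself \<Rightarrow> bool" where
  "finite_dim _ \<longleftrightarrow> (\<exists>B::'e set. finite B \<and> span B = UNIV)"

lemma finite_dim_prod:
  assumes "finite_dim TYPE('e::real_vector)" "finite_dim TYPE('f::real_vector)"
  shows "finite_dim TYPE('e::real_vector \<times> 'f::real_vector)"
proof -
  obtain B :: "'e set" and C :: "'f set"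
    where B: "finite B" "span B = UNIV" and C: "finite C" "span C = UNIV"
    using assms by (auto simp: finite_dim_def)
  let ?D = "(\<lambda>b. (b, 0)) ` B \<union> (\<lambda>c. (0, c)) ` C"
  have lin: "linear (\<lambda>b::'e. (b, 0::'f))" "linear (\<lambda>c::'f. (0::'e, c))"
    by (auto intro!: linearI)
  have l: "(b, 0) \<in> span ?D" for b
  proof -
    have "(b, 0) \<in> (\<lambda>b. (b, 0)) ` span B" using B by auto
    then show ?thesis
      using linear_span_image[OF lin(1), of B] span_mono[of "(\<lambda>b. (b, 0)) ` B" ?D] by auto
  qed
  have r: "(0, c) \<in> span ?D" for c
  proof -
    have "(0, c) \<in> (\<lambda>c. (0, c)) ` span C" using C by auto
    then show ?thesis
      using linear_span_image[OF lin(2), of C] span_mono[of "(\<lambda>c. (0, c)) ` C" ?D] by auto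
  qed
  have "(b, c) \<in> span ?D" for b c
    using span_add[OF l[of b] r[of c]] by simp
  then have "span ?D = UNIV" by auto
  then show ?thesis
    unfolding finite_dim_def using B C by (intro exI[of _ ?D]) auto
qed

text \<open>The bound makes the coefficients of a convergent sequence Cauchy; the combination formed
  with their limits is the limit of the sequence.\<close>

lemma closed_span_if_coefficients_bounded:
  fixes B :: "'e::real_normed_vector set"
  assumes fin: "finite B"
    and bound: "\<And>u b. b \<in> B \<Longrightarrow> \<bar>u b\<bar> \<le> C * norm (\<Sum>b\<in>B. u b *\<^sub>R b)"
  shows "closed (span B)"
  unfolding closed_sequential_limits
proof (intro allI impI, elim conjE)
  fix x l
  assume x: "\<forall>n. x n \<in> span B" and lim: "x \<longlonglongrightarrow> l"
  have "\<exists>u. x n = (\<Sum>b\<in>B. u b *\<^sub>R b)" for n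
    using x fin by (auto simp: span_finite image_iff)
  then obtain u where u: "\<And>n. x n = (\<Sum>b\<in>B. u n b *\<^sub>R b)" by metis
  have "convergent (\<lambda>n. u n b)" if b: "b \<in> B" for b
  proof (rule Cauchy_convergent, rule metric_CauchyI)
    fix e :: real assume e: "0 < e"
    \<comment> \<open>A positive constant in place of C, so that e can be divided by it.\<close>
    define D where "D = max C 1"
    have D: "D > 0" "C \<le> D" by (auto simp: D_def)
    have "Cauchy x" using lim by (rule LIMSEQ_imp_Cauchy)
    then obtain N where N: "\<And>m n. m \<ge> N \<Longrightarrow> n \<ge> N \<Longrightarrow> dist (x m) (x n) < e / D"
      using metric_CauchyD[of x "e / D"] e D by auto
    have "dist (u m b) (u n b) < e" if "m \<ge> N" "n \<ge> N" for m n
    proof -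
      have "\<bar>u m b - u n b\<bar> \<le> C * norm (\<Sum>b\<in>B. (u m b - u n b) *\<^sub>R b)"
        using bound[OF b, of "\<lambda>b. u m b - u n b"] by simp
      also have "\<dots> = C * norm (x m - x n)"
        by (simp add: u scaleR_left_diff_distrib sum_subtractf)
      also have "\<dots> \<le> D * norm (x m - x n)"
        using D by (intro mult_right_mono) auto
      also have "\<dots> < e"
        using N[OF that] D by (simp add: dist_norm field_simps)
      finally show ?thesis by (simp add: dist_norm)
    qed
    then show "\<exists>M. \<forall>m\<ge>M. \<forall>n\<ge>M. dist (u m b) (u n b) < e" by blast
  qed
  then obtain w where w: "\<And>b. b \<in> B \<Longrightarrow> (\<lambda>n. u n b) \<longlonglongrightarrow> w b"
    unfolding convergent_def by metis
  have "x \<longlonglongrightarrow> (\<Sum>b\<in>B. w b *\<^sub>R b)"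
    unfolding u[abs_def] by (intro tendsto_intros w)
  then have "l = (\<Sum>b\<in>B. w b *\<^sub>R b)" using lim LIMSEQ_unique by blast
  then show "l \<in> span B" by (simp add: span_sum span_scale span_base)
qed

text \<open>When a is adjoined to B, the previous lemma makes the span of B closed, so a has
  positive distance \<delta> from it. This distance controls the coefficient of a; subtracting that
  term leaves a vector of the span of B, to which the induction hypothesis applies.\<close>

lemma coefficients_bounded:
  fixes B :: "'e::real_normed_vector set"
  assumes "finite B" "independent B"
  shows "\<exists>C\<ge>0. \<forall>u. \<forall>b\<in>B. \<bar>u b\<bar> \<le> C * norm (\<Sum>b\<in>B. u b *\<^sub>R b)"
  using assms
proof (induction B)
  case empty
  then show ?case by auto
next
  case (insert a B)
  have ind: "independent B" and a: "a \<notin> span B"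
    using insert by (auto simp: independent_insert)
  obtain C where C: "C \<ge> 0" "\<And>u b. b \<in> B \<Longrightarrow> \<bar>u b\<bar> \<le> C * norm (\<Sum>b\<in>B. u b *\<^sub>R b)"
    using insert.IH[OF ind] by auto
  have "closed (span B)"
    by (rule closed_span_if_coefficients_bounded[OF insert.hyps(1) C(2)])
  then have \<delta>: "infdist a (span B) > 0"
    using infdist_pos_not_in_closed[of "span B" a] a span_zero by blast
  define \<delta> where "\<delta> = infdist a (span B)"
  have \<delta>: "\<delta> > 0" using \<delta> by (simp add: \<delta>_def)
  \<comment> \<open>The first entry bounds the coefficient of a by \<open>norm S / \<delta>\<close>;
    the second bounds the others, through the norm of \<open>S - u a *\<^sub>R a\<close>.\<close>
  define D where "D = max (1 / \<delta>) (C * (1 + norm a / \<delta>))"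
  have *: "\<bar>u b\<bar> \<le> D * norm (\<Sum>b\<in>insert a B. u b *\<^sub>R b)" if b: "b \<in> insert a B" for u b
  proof -
    define y where "y = (\<Sum>b\<in>B. u b *\<^sub>R b)"
    define S where "S = u a *\<^sub>R a + y"
    have S: "(\<Sum>b\<in>insert a B. u b *\<^sub>R b) = S"
      using insert.hyps by (simp add: S_def y_def)
    have y: "y \<in> span B" by (simp add: y_def span_sum span_scale span_base)
    have ua: "\<bar>u a\<bar> \<le> norm S / \<delta>"
    proof (cases "u a = 0")
      case False
      \<comment> \<open>Divided by \<open>u a\<close>, the vector S is the difference of a and a
        point of the span of B.\<close>
      have "\<delta> \<le> dist a (- (1 / u a) *\<^sub>R y)"
        unfolding \<delta>_def by (intro infdist_le span_scale y)
      also have "\<dots> = norm ((1 / u a) *\<^sub>R S)"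
        using False by (simp add: dist_norm S_def scaleR_add_right)
      also have "\<dots> = norm S / \<bar>u a\<bar>" by simp
      finally show ?thesis using False \<delta> by (simp add: field_simps)
    qed (use \<delta> in simp)
    show ?thesis
    proof (cases "b = a")
      case True
      have "norm S / \<delta> \<le> D * norm S"
        using mult_right_mono[of "1 / \<delta>" D "norm S"] by (simp add: D_def)
      then show ?thesis unfolding S using True ua by simp
    next
      case False
      then have "\<bar>u b\<bar> \<le> C * norm y" using b C(2) by (auto simp: y_def)
      also have "norm y = norm (S - u a *\<^sub>R a)" by (simp add: S_def)
      also have "C * \<dots> \<le> C * (norm S + \<bar>u a\<bar> * norm a)"
        using C(1) by (intro mult_left_mono) (auto intro: order_trans[OF norm_triangle_ineq4])
      also have "\<dots> \<le> C * (norm S + norm S / \<delta> * norm a)"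
        using C(1) ua by (intro mult_left_mono add_left_mono mult_right_mono) auto
      also have "\<dots> = C * (1 + norm a / \<delta>) * norm S" by (simp add: algebra_simps)
      also have "\<dots> \<le> D * norm S" by (intro mult_right_mono) (auto simp: D_def)
      finally show ?thesis unfolding S .
    qed
  qed
  have "D \<ge> 0" using \<delta> by (auto simp: D_def le_max_iff_disj)
  with * show ?case by blast
qed

text \<open>\<^const>\<open>Ck_on\<close> speaks about derivatives in constant directions; the bounded coordinate
  functionals reduce derivatives in varying directions to these.\<close>

lemma finite_dim_coordinates:
  assumes "finite_dim TYPE('e::real_normed_vector)"
  obtains B :: "'e::real_normed_vector set" and \<kappa> :: "'e \<Rightarrow> 'e \<Rightarrow> real" where
    "finite B" "\<And>b. bounded_linear (\<kappa> b)" "\<And>x. x = (\<Sum>b\<in>B. \<kappa> b x *\<^sub>R b)"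
proof -
  obtain B0 :: "'e set" where B0: "finite B0" "span B0 = UNIV"
    using assms by (auto simp: finite_dim_def)
  obtain B where B: "B \<subseteq> B0" "independent B" "B0 \<subseteq> span B"
    by (rule maximal_independent_subset)
  have fin: "finite B" using B(1) B0(1) finite_subset by blast
  have sp: "span B = UNIV"
    using span_mono[OF B(3)] B0 by (simp add: span_span top.extremum_unique)
  obtain C where C: "C \<ge> 0" "\<And>u b. b \<in> B \<Longrightarrow> \<bar>u b\<bar> \<le> C * norm (\<Sum>b\<in>B. u b *\<^sub>R b)"
    using coefficients_bounded[OF fin B(2)] by auto
  let ?\<kappa> = "\<lambda>b x. representation B x b"
  have eq: "x = (\<Sum>b\<in>B. ?\<kappa> b x *\<^sub>R b)" for x
    by (rule sum_representation_eq[symmetric]) (use B fin sp in auto)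
  have "bounded_linear (?\<kappa> b)" for b
  proof (rule bounded_linear_intro[where K = C])
    show "norm (?\<kappa> b x) \<le> norm x * C" for x
    proof (cases "b \<in> B")
      case True
      then show ?thesis using C(2)[of b "\<lambda>b. ?\<kappa> b x"] eq[of x] by (simp add: mult.commute)
    next
      case False
      then have "?\<kappa> b x = 0" using representation_ne_zero by blast
      then show ?thesis using C(1) by simp
    qed
  qed (use B sp in \<open>auto simp: representation_add representation_scale\<close>)
  with fin eq show thesis by (intro that)
qed

section \<open>Calculus of C^k and smooth maps between normed spaces\<close>

lemma Ck_on_cong:
  assumes X: "open X" and f: "Ck_on k X f" and eq: "\<And>x. x \<in> X \<Longrightarrow> f x = g x"
  shows "Ck_on k X g"
  using f eq
proof (induction k arbitrary: f g)
  case 0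
  then show ?case using continuous_on_cong[of X X f g] by simp
next
  case (Suc k)
  \<comment> \<open>Derivatives are taken in the whole space, so agreement on an open set, not just
    at x, is what transfers them.\<close>
  have d: "g differentiable (at x)" and D: "frechet_derivative f (at x) = frechet_derivative g (at x)"
    if x: "x \<in> X" for x
  proof -
    have f: "f differentiable (at x)" using Suc.prems(1) x by simp
    then show "g differentiable (at x)"
      using has_derivative_transform_within_open[OF _ X x] Suc.prems(2)
      unfolding differentiable_def by blast
    show "frechet_derivative f (at x) = frechet_derivative g (at x)"
      by (rule frechet_derivative_transform_within_open[OF f X x Suc.prems(2)])
  qed
  have "Ck_on k X (\<lambda>x. frechet_derivative g (at x) v)" for v
    by (rule Suc.IH[of "\<lambda>x. frechet_derivative f (at x) v"]) (use Suc.prems(1) D in auto)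
  then show ?case using d by simp
qed

text \<open>The closure proofs below know derivatives by formulas; uniqueness of the derivative lets
  a formula stand in for \<open>frechet_derivative\<close>.\<close>

lemma Ck_on_differentiableI:
  assumes X: "open X" and f: "\<And>x. x \<in> X \<Longrightarrow> (f has_derivative f' x) (at x)"
    and Ck: "\<And>v. Ck_on k X (\<lambda>x. f' x v)"
  shows "Ck_on (Suc k) X f"
proof -
  have "frechet_derivative f (at x) = f' x" if "x \<in> X" for x
    using frechet_derivative_at[OF f[OF that]] by simp
  then show ?thesis
    using f Ck_on_cong[OF X Ck] by (auto simp: differentiable_def)
qed

lemma Ck_on_has_derivative:
  "Ck_on (Suc k) X f \<Longrightarrow> x \<in> X \<Longrightarrow> (f has_derivative frechet_derivative f (at x)) (at x)"
  using frechet_derivative_works[of f "at x"] by simp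

lemma Ck_on_SucD: "Ck_on (Suc k) X f \<Longrightarrow> Ck_on k X f"
proof (induction k arbitrary: f)
  case 0
  then show ?case
    by (auto simp: intro!: continuous_at_imp_continuous_on differentiable_imp_continuous_within)
next
  case (Suc k)
  then show ?case by (simp only: Ck_on.simps) blast
qed

lemma Ck_on_subset: "Ck_on k X f \<Longrightarrow> Y \<subseteq> X \<Longrightarrow> Ck_on k Y f"
  by (induction k arbitrary: f) (auto intro: continuous_on_subset)

lemma Ck_on_locally:
  "(\<And>x. x \<in> X \<Longrightarrow> \<exists>N. open N \<and> x \<in> N \<and> Ck_on k N f) \<Longrightarrow> Ck_on k X f"
proof (induction k arbitrary: f)
  case 0
  have "continuous (at x) f" if "x \<in> X" for x
    using 0[OF that] continuous_on_eq_continuous_at by force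
  then show ?case by (simp add: continuous_at_imp_continuous_on)
next
  case (Suc k)
  have "Ck_on k X (\<lambda>x. frechet_derivative f (at x) v)" for v
    by (rule Suc.IH) (use Suc.prems in \<open>simp; blast\<close>)
  moreover have "f differentiable (at x)" if "x \<in> X" for x
    using Suc.prems[OF that] by auto
  ultimately show ?case by simp
qed

lemma Ck_on_const: "Ck_on k X (\<lambda>x. c)"
  by (induction k arbitrary: c) auto

lemma Ck_on_bounded_linear_compose:
  assumes L: "bounded_linear L" and X: "open X" and f: "Ck_on k X f"
  shows "Ck_on k X (\<lambda>x. L (f x))"
  using f
proof (induction k arbitrary: f)
  case 0
  then show ?case using linear_continuous_on_compose bounded_linear.continuous_on[OF L] by auto
next
  case (Suc k)
  show ?case
    by (rule Ck_on_differentiableI[OF X bounded_linear.has_derivative[OF L Ck_on_has_derivative[OF Suc.prems]]])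
       (use Suc in auto)
qed

lemma Ck_on_id: "open X \<Longrightarrow> Ck_on k X (\<lambda>x. x)"
  by (cases k) (simp_all add: Ck_on_const)

lemma Ck_on_add:
  assumes X: "open X" and "Ck_on k X f" "Ck_on k X g"
  shows "Ck_on k X (\<lambda>x. f x + g x)"
  using assms(2-3)
proof (induction k arbitrary: f g)
  case 0
  then show ?case by (simp add: continuous_on_add)
next
  case (Suc k)
  show ?case
    by (rule Ck_on_differentiableI[OF X
          has_derivative_add[OF Ck_on_has_derivative[OF Suc.prems(1)] Ck_on_has_derivative[OF Suc.prems(2)]]])
       (use Suc in auto)
qed

lemma Ck_on_scaleR:
  assumes X: "open X" and "Ck_on k X f" "Ck_on k X g"
  shows "Ck_on k X (\<lambda>x. f x *\<^sub>R g x)"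
  using assms(2-3)
proof (induction k arbitrary: f g)
  case 0
  then show ?case by (simp add: continuous_on_scaleR)
next
  case (Suc k)
  \<comment> \<open>In each product one factor is f or g itself, which \<open>Ck_on_SucD\<close>
    lowers to the class of the induction hypothesis.\<close>
  have "Ck_on k X (\<lambda>x. f x *\<^sub>R frechet_derivative g (at x) v + frechet_derivative f (at x) v *\<^sub>R g x)" for v
    by (rule Ck_on_add[OF X Suc.IH Suc.IH])
       (use Suc.prems Suc.prems[THEN Ck_on_SucD] in auto)
  then show ?case
    using Ck_on_differentiableI[OF X
          has_derivative_scaleR[OF Ck_on_has_derivative[OF Suc.prems(1)] Ck_on_has_derivative[OF Suc.prems(2)]]]
    by blast
qed

lemma Ck_on_sum:
  assumes "open X" "\<And>i. i \<in> I \<Longrightarrow> Ck_on k X (f i)"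
  shows "Ck_on k X (\<lambda>x. \<Sum>i\<in>I. f i x)"
  using assms(2)
proof (induction I rule: infinite_finite_induct)
  case (insert i I)
  then show ?case using Ck_on_add[OF assms(1), of k "f i" "\<lambda>x. \<Sum>i\<in>I. f i x"] by simp
qed (simp_all add: Ck_on_const)

text \<open>In the chain rule the derivative of g is applied to a direction that varies with x.
  Expanding that direction in coordinates gives a finite sum of real functions times derivatives of
  g in fixed directions b. The induction leaves g arbitrary, since it passes to these directional
  derivatives while f merely drops in class.\<close>

lemma Ck_on_compose:
  fixes f :: "'a::real_normed_vector \<Rightarrow> 'b::real_normed_vector"
    and g :: "'b \<Rightarrow> 'c::real_normed_vector"
  assumes fd: "finite_dim TYPE('b)" and X: "open X"
    and "Ck_on k X f" "Ck_on k Y g" and fY: "f ` X \<subseteq> Y"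
  shows "Ck_on k X (\<lambda>x. g (f x))"
  using assms(3,4)
proof (induction k arbitrary: g)
  case 0
  then show ?case using continuous_on_compose2 fY by auto
next
  case (Suc k)
  obtain B :: "'b set" and \<kappa> where B: "finite B" and \<kappa>: "\<And>b. bounded_linear (\<kappa> b)"
    and eq: "\<And>x. x = (\<Sum>b\<in>B. \<kappa> b x *\<^sub>R b)"
    using finite_dim_coordinates[OF fd] by metis
  let ?Df = "\<lambda>x. frechet_derivative f (at x)" and ?Dg = "\<lambda>x. frechet_derivative g (at (f x))"
  have der: "((\<lambda>x. g (f x)) has_derivative (\<lambda>v. ?Dg x (?Df x v))) (at x)" if x: "x \<in> X" for x
    using diff_chain_at[OF Ck_on_has_derivative[OF Suc.prems(1) x] Ck_on_has_derivative[OF Suc.prems(2)]] x fY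
    by (auto simp: o_def)
  have "Ck_on k X (\<lambda>x. ?Dg x (?Df x v))" for v
  proof (rule Ck_on_cong[OF X])
    show "Ck_on k X (\<lambda>x. \<Sum>b\<in>B. \<kappa> b (?Df x v) *\<^sub>R ?Dg x b)"
    proof (rule Ck_on_sum[OF X], rule Ck_on_scaleR[OF X])
      fix b
      show "Ck_on k X (\<lambda>x. \<kappa> b (?Df x v))"
        using Suc.prems(1) by (intro Ck_on_bounded_linear_compose[OF \<kappa> X]) simp
      show "Ck_on k X (\<lambda>x. ?Dg x b)"
        by (rule Suc.IH[of "\<lambda>y. frechet_derivative g (at y) b"])
          (use Ck_on_SucD[OF Suc.prems(1)] Suc.prems(2) in auto)
    qed
    show "(\<Sum>b\<in>B. \<kappa> b (?Df x v) *\<^sub>R ?Dg x b) = ?Dg x (?Df x v)" if x: "x \<in> X" for x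
    proof -
      have "linear (?Dg x)"
        using x fY Suc.prems(2) by (intro linear_frechet_derivative) auto
      then have "?Dg x (\<Sum>b\<in>B. \<kappa> b (?Df x v) *\<^sub>R b) = (\<Sum>b\<in>B. \<kappa> b (?Df x v) *\<^sub>R ?Dg x b)"
        by (simp add: linear_sum linear_scale)
      then show ?thesis by (simp add: eq[symmetric])
    qed
  qed
  then show ?case using Ck_on_differentiableI[OF X der] by blast
qed

lemma smooth_on_cong:
  "open X \<Longrightarrow> smooth_on X f \<Longrightarrow> (\<And>x. x \<in> X \<Longrightarrow> f x = g x) \<Longrightarrow> smooth_on X g"
  using Ck_on_cong[of X _ f g] by (simp add: smooth_on_def)

lemma smooth_on_subset: "smooth_on X f \<Longrightarrow> Y \<subseteq> X \<Longrightarrow> smooth_on Y f"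
  using Ck_on_subset[of _ X f Y] by (simp add: smooth_on_def)

lemma smooth_on_locally:
  
  assumes "\<And>x. x \<in> X \<Longrightarrow> \<exists>N. open N \<and> x \<in> N \<and> smooth_on N f"
  shows "smooth_on X f"
  unfolding smooth_on_def
proof
  fix k
  show "Ck_on k X f"
  proof (rule Ck_on_locally)
    fix x assume "x \<in> X"
    then obtain N where "open N" "x \<in> N" "smooth_on N f" using assms by blast
    then show "\<exists>N. open N \<and> x \<in> N \<and> Ck_on k N f" by (auto simp: smooth_on_def)
  qed
qed

lemma smooth_on_const: "smooth_on X (\<lambda>x. c)"
  by (simp add: smooth_on_def Ck_on_const)

lemma smooth_on_id: "open X \<Longrightarrow> smooth_on X (\<lambda>x. x)"
  by (simp add: smooth_on_def Ck_on_id)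

lemma smooth_on_bounded_linear_compose:
  "bounded_linear L \<Longrightarrow> open X \<Longrightarrow> smooth_on X f \<Longrightarrow> smooth_on X (\<lambda>x. L (f x))"
  by (simp add: smooth_on_def Ck_on_bounded_linear_compose)

lemma smooth_on_add:
  "open X \<Longrightarrow> smooth_on X f \<Longrightarrow> smooth_on X g \<Longrightarrow> smooth_on X (\<lambda>x. f x + g x)"
  by (simp add: smooth_on_def Ck_on_add)

lemma smooth_on_scaleR:
  "open X \<Longrightarrow> smooth_on X f \<Longrightarrow> smooth_on X g \<Longrightarrow> smooth_on X (\<lambda>x. f x *\<^sub>R g x)"
  by (simp add: smooth_on_def Ck_on_scaleR)

lemma smooth_on_Pair:
  assumes "open X" "smooth_on X f" "smooth_on X g"
  shows "smooth_on X (\<lambda>x. (f x, g x))"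
proof -
  \<comment> \<open>The two summands are bounded linear images of f and g.\<close>
  have "smooth_on X (\<lambda>x. (f x, 0) + (0, g x))"
    using assms
      smooth_on_bounded_linear_compose[OF bounded_linear_Pair[OF bounded_linear_ident bounded_linear_zero]]
      smooth_on_bounded_linear_compose[OF bounded_linear_Pair[OF bounded_linear_zero bounded_linear_ident]]
    by (intro smooth_on_add) auto
  then show ?thesis by simp
qed

lemma smooth_on_compose:
  fixes f :: "'a::real_normed_vector \<Rightarrow> 'b::real_normed_vector"
  assumes "finite_dim TYPE('b)" "open X" "smooth_on X f" "smooth_on Y g" "f ` X \<subseteq> Y"
  shows "smooth_on X (\<lambda>x. g (f x))"
  unfolding smooth_on_def
proof
  fix k
  show "Ck_on k X (\<lambda>x. g (f x))"
    by (rule Ck_on_compose[OF assms(1,2) _ _ assms(5)]) (use assms(3,4) in \<open>simp_all add: smooth_on_def\<close>)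
qed

lemma smooth_on_Ck_on: "smooth_on X f \<Longrightarrow> Ck_on k X f"
  by (simp add: smooth_on_def)

lemma smooth_on_frechet_derivative:
  assumes "smooth_on X f" shows "smooth_on X (\<lambda>x. frechet_derivative f (at x) v)"
  unfolding smooth_on_def
proof
  fix k
  show "Ck_on k X (\<lambda>x. frechet_derivative f (at x) v)"
    using smooth_on_Ck_on[OF assms, of "Suc k"] by simp
qed

lemma smooth_on_differentiable: "smooth_on X f \<Longrightarrow> x \<in> X \<Longrightarrow> f differentiable (at x)"
  using smooth_on_Ck_on[of X f "Suc 0"] by simp

lemma smooth_on_continuous: "smooth_on X f \<Longrightarrow> continuous_on X f"
  using smooth_on_Ck_on[of X f 0] by simp

section \<open>Maps that are smooth near a point\<close>

text \<open>Product and restricted atlases are used below without proving that they are smooth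
  manifolds. This weaker condition, easily checked for them, is what the chain rule asks
  for.\<close>

definition charts :: "('a, 'e::real_normed_vector) atlas \<Rightarrow> bool" where
  "charts A \<longleftrightarrow> finite_dim TYPE('e) \<and> (\<forall>c\<in>A. inj_on (snd c) (fst c) \<and> open (snd c ` fst c))"

lemma charts_finite_dim: "charts (A :: ('a, 'e::real_normed_vector) atlas) \<Longrightarrow> finite_dim TYPE('e)"
  by (simp add: charts_def)

lemma charts_inj: "charts A \<Longrightarrow> c \<in> A \<Longrightarrow> inj_on (snd c) (fst c)"
  by (simp add: charts_def)

lemma charts_open: "charts A \<Longrightarrow> c \<in> A \<Longrightarrow> open (snd c ` fst c)"
  by (simp add: charts_def)

lemma charts_param: "charts A \<Longrightarrow> c \<in> A \<Longrightarrow> x \<in> fst c \<Longrightarrow> param c (snd c x) = x"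
  by (simp add: charts_inj)

lemma smooth_manifold_charts: "smooth_manifold A \<Longrightarrow> charts A"
  by (simp add: smooth_manifold_def charts_def finite_dim_def)

lemma charts_prod_atlas:
  assumes A: "charts (A :: ('a, 'e::real_normed_vector) atlas)"
    and B: "charts (B :: ('b, 'f::real_normed_vector) atlas)"
  shows "charts (prod_atlas A B)"
  unfolding charts_def
proof (intro conjI ballI)
  show "finite_dim TYPE('e \<times> 'f)"
    using A B by (simp add: charts_def finite_dim_prod)
  fix x assume "x \<in> prod_atlas A B"
  then obtain c d where x: "x = (fst c \<times> fst d, map_prod (snd c) (snd d))" and cd: "c \<in> A" "d \<in> B"
    by (auto simp: prod_atlas_def)
  show "inj_on (snd x) (fst x)"
    using cd A B by (simp add: x charts_def map_prod_inj_on)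
  have "open ((snd c ` fst c) \<times> (snd d ` fst d))"
    using cd A B by (intro open_Times) (simp_all add: charts_def)
  then show "open (snd x ` fst x)"
    by (simp add: x map_prod_surj_on)
qed

lemma prod_atlas_chart:
  "c \<in> A \<Longrightarrow> d \<in> B \<Longrightarrow> (fst c \<times> fst d, map_prod (snd c) (snd d)) \<in> prod_atlas A B"
  unfolding prod_atlas_def by blast

lemma pointsI: "c \<in> A \<Longrightarrow> p \<in> fst c \<Longrightarrow> p \<in> points A"
  by (auto simp: points_def)

lemma pointsE:
  assumes "p \<in> points A" obtains c where "c \<in> A" "p \<in> fst c"
  using assms by (auto simp: points_def)

lemma points_prod_atlas: "points (prod_atlas A B) = points A \<times> points B"
proof (intro equalityI subsetI)
  fix x assume "x \<in> points A \<times> points B"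
  then obtain c d where "c \<in> A" "d \<in> B" "x \<in> fst c \<times> fst d"
    by (auto elim!: pointsE)
  then show "x \<in> points (prod_atlas A B)"
    using pointsI[OF prod_atlas_chart[of c A d B], of x] by simp
qed (auto simp: points_def prod_atlas_def)

lemma points_restrict_atlas: "points (restrict_atlas A W) = points A \<inter> W"
  by (auto simp: points_def restrict_atlas_def)

lemma topspace_manifold_topology:
  assumes "smooth_manifold A"
  shows "topspace (manifold_topology A) = points A"
proof -
  have "points A \<inter> fst c = fst c" if "c \<in> A" for c using that by (auto simp: points_def)
  then have "openin (manifold_topology A) (points A)"
    using smooth_manifold_charts[OF assms] by (simp add: openin_manifold_topology[OF assms] charts_def)
  moreover have "topspace (manifold_topology A) \<subseteq> points A"
    using openin_topspace[of "manifold_topology A"] unfolding openin_manifold_topology[OF assms] by blast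
  ultimately show ?thesis using openin_subset by blast
qed

lemma charts_restrict_atlas:
  assumes "smooth_manifold A" "openin (manifold_topology A) W"
  shows "charts (restrict_atlas A W)"
  using assms smooth_manifold_charts[OF assms(1)] openin_manifold_topology[OF assms(1)]
  by (auto simp: charts_def restrict_atlas_def Int_commute intro: inj_on_subset)

text \<open>With this atlas, functions with values in a normed space are maps between manifolds, so that
  the chain rule below covers them as well.\<close>

definition vector_atlas :: "('a, 'a) atlas" where
  "vector_atlas = {(UNIV, id)}"

lemma charts_vector_atlas: "finite_dim TYPE('e::real_normed_vector) \<Longrightarrow> charts (vector_atlas :: ('e, 'e) atlas)"
  by (simp add: charts_def vector_atlas_def)

lemma points_vector_atlas [simp]: "points vector_atlas = UNIV"
  by (simp add: points_def vector_atlas_def)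

section \<open>Neighbourhoods of a point in terms of charts\<close>

abbreviation near :: "('a, 'e::real_normed_vector) atlas \<Rightarrow> 'a \<Rightarrow> 'a filter" where
  "near A p \<equiv> nhdsin (manifold_topology A) p"

lemma eventually_near_chartD:
  assumes A: "smooth_manifold A" and c: "c \<in> A" "p \<in> fst c" and ev: "eventually P (near A p)"
  obtains N where "open N" "snd c p \<in> N" "N \<subseteq> snd c ` fst c" "\<And>y. y \<in> N \<Longrightarrow> P (param c y)"
proof -
  have "p \<in> points A" using c by (rule pointsI)
  then obtain W where W: "openin (manifold_topology A) W" "p \<in> W" "\<And>x. x \<in> W \<Longrightarrow> P x"
    using ev by (auto simp: eventually_nhdsin topspace_manifold_topology[OF A])
  show thesis
  proof (rule that[of "snd c ` (W \<inter> fst c)"])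
    show "open (snd c ` (W \<inter> fst c))"
      using W(1) c by (simp add: openin_manifold_topology[OF A])
    show "P (param c y)" if "y \<in> snd c ` (W \<inter> fst c)" for y
      using that W(3) charts_param[OF smooth_manifold_charts[OF A] c(1)] by auto
  qed (use W c in auto)
qed

text \<open>In any other chart d the set in question becomes the preimage of N under the coordinate
  change, which is continuous.\<close>

lemma eventually_near_chartI:
  assumes A: "smooth_manifold A" and c: "c \<in> A" "p \<in> fst c" and N: "open N" "snd c p \<in> N"
  shows "eventually (\<lambda>x. x \<in> fst c \<and> snd c x \<in> N) (near A p)"
proof -
  define W where "W = {x \<in> fst c. snd c x \<in> N}"
  have "open (snd d ` (W \<inter> fst d))" if d: "d \<in> A" for d
  proof -
    let ?Z = "snd d ` (fst d \<inter> fst c)"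
    have "smooth_on ?Z (local_rep d c id)" and op: "open ?Z"
      using A c d by (auto simp: smooth_manifold_def)
    then have "open (?Z \<inter> local_rep d c id -` N)"
      using continuous_on_open_vimage[OF op] N smooth_on_continuous by (auto simp: Int_commute)
    moreover have "?Z \<inter> local_rep d c id -` N = snd d ` (W \<inter> fst d)"
      using charts_param[OF smooth_manifold_charts[OF A] d] 
      by (auto simp: W_def local_rep_def)
    ultimately show ?thesis by simp
  qed
  moreover have "W \<subseteq> points A" using c by (auto simp: W_def points_def)
  ultimately have "openin (manifold_topology A) W"
    by (simp add: openin_manifold_topology[OF A])
  moreover have "p \<in> W" using c N by (simp add: W_def)
  ultimately show ?thesis
    unfolding eventually_nhdsin W_def by blast
qed

lemma eventually_near_points:
  assumes "smooth_manifold A"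
  shows "eventually (\<lambda>x. x \<in> points A) (near A p)"
  unfolding eventually_nhdsin topspace_manifold_topology[OF assms]
  using openin_topspace[of "manifold_topology A"] topspace_manifold_topology[OF assms] by auto

lemma eventually_near_openin:
  "openin (manifold_topology A) W \<Longrightarrow> p \<in> W \<Longrightarrow> eventually (\<lambda>x. x \<in> W) (near A p)"
  by (auto simp: eventually_nhdsin)

text \<open>Local sections and local group components are smooth only on an open set, which
  \<open>smooth_map\<close> cannot express. Requiring N to consist of coordinates of points that F
  sends into the target chart builds in continuity.\<close>

definition smooth_near ::
    "('a, 'e::real_normed_vector) atlas \<Rightarrow> ('b, 'f::real_normed_vector) atlas \<Rightarrow> ('a \<Rightarrow> 'b) \<Rightarrow> 'a \<Rightarrow> bool"
  where
  "smooth_near A B F p \<longleftrightarrow> p \<in> points A \<and> F p \<in> points B \<and>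
     (\<forall>c\<in>A. \<forall>d\<in>B. p \<in> fst c \<longrightarrow> F p \<in> fst d \<longrightarrow>
        (\<exists>N. open N \<and> snd c p \<in> N \<and> N \<subseteq> snd c ` (fst c \<inter> F -` fst d) \<and>
             smooth_on N (local_rep c d F)))"

lemma smooth_nearE:
  assumes "smooth_near A B F p" "c \<in> A" "d \<in> B" "p \<in> fst c" "F p \<in> fst d"
  obtains N where "open N" "snd c p \<in> N" "N \<subseteq> snd c ` (fst c \<inter> F -` fst d)"
    "smooth_on N (local_rep c d F)"
  using assms unfolding smooth_near_def by blast

lemma smooth_near_points: "smooth_near A B F p \<Longrightarrow> p \<in> points A" "smooth_near A B F p \<Longrightarrow> F p \<in> points B"
  by (simp_all add: smooth_near_def)

lemma smooth_near_differentiable: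
  assumes "smooth_near A B F p" "c \<in> A" "d \<in> B" "p \<in> fst c" "F p \<in> fst d"
  shows "local_rep c d F differentiable (at (snd c p))"
proof -
  obtain N where "snd c p \<in> N" "smooth_on N (local_rep c d F)"
    using assms by (rule smooth_nearE)
  then show ?thesis using smooth_on_differentiable by blast
qed

lemma smooth_map_imp_smooth_near:
  assumes "smooth_map A B F" "p \<in> points A"
  shows "smooth_near A B F p"
  unfolding smooth_near_def
proof (intro conjI ballI impI)
  fix c d assume cd: "c \<in> A" "d \<in> B" "p \<in> fst c" "F p \<in> fst d"
  then show "\<exists>N. open N \<and> snd c p \<in> N \<and> N \<subseteq> snd c ` (fst c \<inter> F -` fst d) \<and> smooth_on N (local_rep c d F)"
    using assms by (intro exI[of _ "snd c ` (fst c \<inter> F -` fst d)"]) (auto simp: smooth_map_def)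
qed (use assms in \<open>auto simp: smooth_map_def\<close>)

lemma smooth_near_id:
  assumes "smooth_manifold A" "p \<in> points A"
  shows "smooth_near A A id p"
  by (rule smooth_map_imp_smooth_near) (use assms in \<open>auto simp: smooth_map_def smooth_manifold_def\<close>)

text \<open>The neighbourhood is cut down so that F maps it into the middle chart d and the image
  lies where H is smooth; on it the coordinate representation of the composite factors through
  d.\<close>

lemma local_rep_compose:
  fixes A :: "('a, 'e::real_normed_vector) atlas" and B :: "('b, 'f::real_normed_vector) atlas"
  assumes A: "charts A" and B: "charts B"
    and F: "smooth_near A B F p" and H: "smooth_near B C H (F p)"
    and c: "c \<in> A" "p \<in> fst c" and d: "d \<in> B" "F p \<in> fst d" and e: "e \<in> C" "H (F p) \<in> fst e"
  obtains N where "open N" "snd c p \<in> N" "N \<subseteq> snd c ` (fst c \<inter> (\<lambda>x. H (F x)) -` fst e)"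
    "smooth_on N (local_rep c e (\<lambda>x. H (F x)))"
    "\<And>y. y \<in> N \<Longrightarrow> local_rep c e (\<lambda>x. H (F x)) y = local_rep d e H (local_rep c d F y)"
proof -
  let ?f = "local_rep c d F"
  obtain N1 where N1: "open N1" "snd c p \<in> N1" "N1 \<subseteq> snd c ` (fst c \<inter> F -` fst d)" "smooth_on N1 ?f"
    using F c(1) d(1) c(2) d(2) by (rule smooth_nearE)
  obtain N2 where N2: "open N2" "snd d (F p) \<in> N2" "N2 \<subseteq> snd d ` (fst d \<inter> H -` fst e)"
    "smooth_on N2 (local_rep d e H)"
    using H d(1) e(1) d(2) e(2) by (rule smooth_nearE)
  define N where "N = N1 \<inter> ?f -` N2"
  have op: "open N"
    using continuous_on_open_vimage[OF N1(1)] smooth_on_continuous[OF N1(4)] N2(1)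
    by (auto simp: N_def Int_commute)
  have pc: "\<And>x. x \<in> fst c \<Longrightarrow> param c (snd c x) = x" and pd: "\<And>x. x \<in> fst d \<Longrightarrow> param d (snd d x) = x"
    using charts_param[OF A c(1)] charts_param[OF B d(1)] by auto
  have *: "\<exists>x. y = snd c x \<and> x \<in> fst c \<and> F x \<in> fst d \<and> H (F x) \<in> fst e" if "y \<in> N" for y
  proof -
    obtain x where x: "y = snd c x" "x \<in> fst c" "F x \<in> fst d"
      using \<open>y \<in> N\<close> N1(3) by (auto simp: N_def)
    have "snd d (F x) \<in> N2" using \<open>y \<in> N\<close> x pc by (auto simp: N_def local_rep_def)
    then obtain z where "snd d (F x) = snd d z" "z \<in> fst d" "H z \<in> fst e" using N2(3) by auto
    \<comment> \<open>Injectivity of the middle chart identifies z with \<open>F x\<close>.\<close>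
    then have "H (F x) \<in> fst e" using charts_inj[OF B d(1)] x(3) by (auto simp: inj_on_def)
    with x show ?thesis by blast
  qed
  have eq: "local_rep c e (\<lambda>x. H (F x)) y = local_rep d e H (?f y)" if "y \<in> N" for y
    using *[OF that] pc pd by (auto simp: local_rep_def)
  have "smooth_on N (\<lambda>y. local_rep d e H (?f y))"
    by (rule smooth_on_compose[OF charts_finite_dim[OF B] op smooth_on_subset[OF N1(4)] N2(4)])
       (auto simp: N_def)
  then have "smooth_on N (local_rep c e (\<lambda>x. H (F x)))"
    by (rule smooth_on_cong[OF op]) (simp add: eq)
  moreover have "snd c p \<in> N" using N1(2) N2(2) pc c by (simp add: N_def local_rep_def)
  moreover have "N \<subseteq> snd c ` (fst c \<inter> (\<lambda>x. H (F x)) -` fst e)" using * by fastforce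
  ultimately show thesis using op eq that by blast
qed

lemma smooth_near_compose:
  assumes A: "charts A" and B: "charts B"
    and F: "smooth_near A B F p" and H: "smooth_near B C H (F p)"
  shows "smooth_near A C (\<lambda>x. H (F x)) p"
  unfolding smooth_near_def
proof (intro conjI ballI impI)
  fix c e assume ce: "c \<in> A" "e \<in> C" "p \<in> fst c" "H (F p) \<in> fst e"
  obtain d where d: "d \<in> B" "F p \<in> fst d" using smooth_near_points(2)[OF F] by (rule pointsE)
  show "\<exists>N. open N \<and> snd c p \<in> N \<and> N \<subseteq> snd c ` (fst c \<inter> (\<lambda>x. H (F x)) -` fst e) \<and>
      smooth_on N (local_rep c e (\<lambda>x. H (F x)))"
    using local_rep_compose[OF A B F H ce(1,3) d ce(2,4)] by metis
qed (use smooth_near_points[OF F] smooth_near_points[OF H] in auto)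

lemma frechet_derivative_local_rep_compose:
  assumes A: "charts A" and B: "charts B"
    and F: "smooth_near A B F p" and H: "smooth_near B C H (F p)"
    and c: "c \<in> A" "p \<in> fst c" and d: "d \<in> B" "F p \<in> fst d" and e: "e \<in> C" "H (F p) \<in> fst e"
  shows "frechet_derivative (local_rep c e (\<lambda>x. H (F x))) (at (snd c p)) v =
    frechet_derivative (local_rep d e H) (at (snd d (F p)))
      (frechet_derivative (local_rep c d F) (at (snd c p)) v)"
proof -
  obtain N where N: "open N" "snd c p \<in> N" "smooth_on N (local_rep c e (\<lambda>x. H (F x)))"
    "\<And>y. y \<in> N \<Longrightarrow> local_rep c e (\<lambda>x. H (F x)) y = (local_rep d e H \<circ> local_rep c d F) y"
    using local_rep_compose[OF A B F H c d e] by (metis comp_apply)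
  have dF: "local_rep c d F differentiable (at (snd c p))"
    by (rule smooth_near_differentiable[OF F c(1) d(1) c(2) d(2)])
  have dp: "local_rep c d F (snd c p) = snd d (F p)"
    using c charts_param[OF A] by (simp add: local_rep_def)
  have dH: "local_rep d e H differentiable (at (local_rep c d F (snd c p)))"
    unfolding dp by (rule smooth_near_differentiable[OF H d(1) e(1) d(2) e(2)])
  have "frechet_derivative (local_rep c e (\<lambda>x. H (F x))) (at (snd c p)) =
      frechet_derivative (local_rep d e H \<circ> local_rep c d F) (at (snd c p))"
    by (rule frechet_derivative_transform_within_open[OF smooth_on_differentiable[OF N(3,2)] N(1,2,4)])
  also have "\<dots> = frechet_derivative (local_rep d e H) (at (snd d (F p))) \<circ>
      frechet_derivative (local_rep c d F) (at (snd c p))"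
    using frechet_derivative_compose[OF dF dH] dp by simp
  finally show ?thesis by simp
qed

lemma smooth_near_cong:
  assumes A: "smooth_manifold A" and F: "smooth_near A B F p"
    and ev: "eventually (\<lambda>x. F x = F' x) (near A p)"
  shows "smooth_near A B F' p"
proof -
  have p: "p \<in> points A" using F by (rule smooth_near_points)
  have eq: "F' p = F p"
    using ev p by (auto simp: eventually_nhdsin topspace_manifold_topology[OF A])
  show ?thesis
    unfolding smooth_near_def
  proof (intro conjI ballI impI)
    fix c d assume cd: "c \<in> A" "d \<in> B" "p \<in> fst c" "F' p \<in> fst d"
    obtain N1 where N1: "open N1" "snd c p \<in> N1" "N1 \<subseteq> snd c ` (fst c \<inter> F -` fst d)" "smooth_on N1 (local_rep c d F)"
      using smooth_nearE[OF F cd(1,2,3)] cd(4) eq by metis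
    obtain N2 where N2: "open N2" "snd c p \<in> N2" "N2 \<subseteq> snd c ` fst c"
      "\<And>y. y \<in> N2 \<Longrightarrow> F (param c y) = F' (param c y)"
      using eventually_near_chartD[OF A cd(1,3) ev] by metis
    have "smooth_on (N1 \<inter> N2) (local_rep c d F')"
      by (rule smooth_on_cong[OF open_Int[OF N1(1) N2(1)] smooth_on_subset[OF N1(4)]])
         (auto simp: local_rep_def N2(4))
    moreover have "N1 \<inter> N2 \<subseteq> snd c ` (fst c \<inter> F' -` fst d)"
      using N1(3) N2(4) charts_param[OF smooth_manifold_charts[OF A] cd(1)] by fastforce
    ultimately show "\<exists>N. open N \<and> snd c p \<in> N \<and> N \<subseteq> snd c ` (fst c \<inter> F' -` fst d) \<and> smooth_on N (local_rep c d F')"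
      using N1 N2 by (intro exI[of _ "N1 \<inter> N2"]) auto
  qed (use eq smooth_near_points[OF F] in auto)
qed

text \<open>Continuity of F at p, drawn from the domain condition on N in
  \<open>smooth_near\<close>.\<close>

lemma eventually_near_smooth:
  assumes A: "smooth_manifold A" and F: "smooth_near A B F p" and d: "d \<in> B" "F p \<in> fst d"
  shows "eventually (\<lambda>x. F x \<in> fst d) (near A p)"
proof -
  obtain c where c: "c \<in> A" "p \<in> fst c" using smooth_near_points(1)[OF F] by (rule pointsE)
  obtain N where N: "open N" "snd c p \<in> N" "N \<subseteq> snd c ` (fst c \<inter> F -` fst d)"
    using smooth_nearE[OF F c(1) d(1) c(2) d(2)] by metis
  show ?thesis
    using eventually_near_chartI[OF A c N(1,2)]
  proof (rule eventually_mono)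
    fix x assume "x \<in> fst c \<and> snd c x \<in> N"
    then show "F x \<in> fst d"
      using N(3) charts_inj[OF smooth_manifold_charts[OF A] c(1)] by (fastforce simp: inj_on_def)
  qed
qed

lemma smooth_near_const:
  assumes "charts A" "p \<in> points A" "q \<in> points B"
  shows "smooth_near A B (\<lambda>_. q) p"
  unfolding smooth_near_def
proof (intro conjI ballI impI)
  fix c d assume "c \<in> A" "d \<in> B" "p \<in> fst c" "q \<in> fst d"
  then show "\<exists>N. open N \<and> snd c p \<in> N \<and> N \<subseteq> snd c ` (fst c \<inter> (\<lambda>_. q) -` fst d) \<and>
      smooth_on N (local_rep c d (\<lambda>_. q))"
    using charts_open[OF assms(1)]
    by (intro exI[of _ "snd c ` fst c"]) (auto simp: local_rep_def o_def smooth_on_const)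
qed (use assms in auto)

lemma local_rep_Pair:
  "local_rep c (fst d \<times> fst e, map_prod (snd d) (snd e)) (\<lambda>x. (F x, H x)) =
     (\<lambda>y. (local_rep c d F y, local_rep c e H y))"
  by (simp add: local_rep_def o_def)

lemma smooth_near_Pair:
  assumes A: "charts A" and F: "smooth_near A B F p" and H: "smooth_near A C H p"
  shows "smooth_near A (prod_atlas B C) (\<lambda>x. (F x, H x)) p"
  unfolding smooth_near_def
proof (intro conjI ballI impI)
  fix c g assume c: "c \<in> A" "p \<in> fst c" and g: "g \<in> prod_atlas B C" and pg: "(F p, H p) \<in> fst g"
  obtain d e where de: "d \<in> B" "e \<in> C" and g: "g = (fst d \<times> fst e, map_prod (snd d) (snd e))"
    using g by (auto simp: prod_atlas_def)
  obtain N1 where N1: "open N1" "snd c p \<in> N1" "N1 \<subseteq> snd c ` (fst c \<inter> F -` fst d)" "smooth_on N1 (local_rep c d F)"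
    using smooth_nearE[OF F c(1) de(1) c(2)] pg g by auto
  obtain N2 where N2: "open N2" "snd c p \<in> N2" "N2 \<subseteq> snd c ` (fst c \<inter> H -` fst e)" "smooth_on N2 (local_rep c e H)"
    using smooth_nearE[OF H c(1) de(2) c(2)] pg g by auto
  have op: "open (N1 \<inter> N2)" using N1 N2 by auto
  have "smooth_on (N1 \<inter> N2) (local_rep c g (\<lambda>x. (F x, H x)))"
    unfolding g local_rep_Pair
    by (rule smooth_on_Pair[OF op smooth_on_subset[OF N1(4)] smooth_on_subset[OF N2(4)]]) auto
  moreover have "N1 \<inter> N2 \<subseteq> snd c ` (fst c \<inter> (\<lambda>x. (F x, H x)) -` fst g)"
  proof
    fix y assume y: "y \<in> N1 \<inter> N2"
    then obtain x x' where "y = snd c x" "x \<in> fst c" "F x \<in> fst d" "y = snd c x'" "x' \<in> fst c" "H x' \<in> fst e"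
      using N1(3) N2(3) by blast
    then show "y \<in> snd c ` (fst c \<inter> (\<lambda>x. (F x, H x)) -` fst g)"
      using charts_inj[OF A c(1)] by (auto simp: inj_on_def g)
  qed
  ultimately show "\<exists>N. open N \<and> snd c p \<in> N \<and> N \<subseteq> snd c ` (fst c \<inter> (\<lambda>x. (F x, H x)) -` fst g) \<and>
      smooth_on N (local_rep c g (\<lambda>x. (F x, H x)))"
    using N1 N2 op by (intro exI[of _ "N1 \<inter> N2"]) auto
qed (use assms in \<open>auto simp: points_prod_atlas dest: smooth_near_points\<close>)

section \<open>Inclusions of open subsets\<close>

lemma param_restrict:
  assumes "inj_on (snd c) (fst c)" "x \<in> fst c" "x \<in> W"
  shows "inv_into (fst c \<inter> W) (snd c) (snd c x) = x"
  using assms by (intro inv_into_f_f) (auto intro: inj_on_subset)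

text \<open>Local trivialisations are maps between restricted atlases; these two inclusions carry
  them to and from the full atlases.\<close>

lemma smooth_near_restrict:
  assumes A: "smooth_manifold A" and W: "openin (manifold_topology A) W" "p \<in> W"
  shows "smooth_near A (restrict_atlas A W) id p" "smooth_near (restrict_atlas A W) A id p"
proof -
  have p: "p \<in> points A" using W by (auto simp: openin_manifold_topology[OF A])
  have inj: "inj_on (snd c) (fst c)" if "c \<in> A" for c
    using charts_inj smooth_manifold_charts[OF A] that by blast
  have id: "\<exists>N. open N \<and> snd c p \<in> N \<and> N \<subseteq> snd c ` (fst c \<inter> fst d \<inter> W) \<and>
      smooth_on N (local_rep c d id)" if cd: "c \<in> A" "d \<in> A" "p \<in> fst c" "p \<in> fst d" for c d
  proof -
    have op: "open (snd c ` (W \<inter> fst c))" "open (snd c ` (fst c \<inter> fst d))"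
      using W A cd by (auto simp: openin_manifold_topology[OF A] smooth_manifold_def)
    show ?thesis
    proof (intro exI[of _ "snd c ` (W \<inter> fst c) \<inter> snd c ` (fst c \<inter> fst d)"] conjI)
      show "smooth_on (snd c ` (W \<inter> fst c) \<inter> snd c ` (fst c \<inter> fst d)) (local_rep c d id)"
        by (rule smooth_on_subset[of "snd c ` (fst c \<inter> fst d)"]) (use A cd in \<open>auto simp: smooth_manifold_def\<close>)
      show "snd c ` (W \<inter> fst c) \<inter> snd c ` (fst c \<inter> fst d) \<subseteq> snd c ` (fst c \<inter> fst d \<inter> W)"
        using inj[OF cd(1)] by (auto simp: inj_on_def)
    qed (use op W cd in auto)
  qed
  show "smooth_near A (restrict_atlas A W) id p"
    unfolding smooth_near_def
  proof (intro conjI ballI impI)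
    fix c d' assume c: "c \<in> A" "p \<in> fst c" and d': "d' \<in> restrict_atlas A W" "id p \<in> fst d'"
    then obtain d where d: "d \<in> A" "d' = (fst d \<inter> W, snd d)" "p \<in> fst d" by (auto simp: restrict_atlas_def)
    obtain N where "open N" "snd c p \<in> N" "N \<subseteq> snd c ` (fst c \<inter> fst d \<inter> W)" "smooth_on N (local_rep c d id)"
      using id[OF c(1) d(1) c(2) d(3)] by blast
    then show "\<exists>N. open N \<and> snd c p \<in> N \<and> N \<subseteq> snd c ` (fst c \<inter> id -` fst d') \<and> smooth_on N (local_rep c d' id)"
      by (intro exI[of _ N]) (auto simp: d(2) local_rep_def)
  qed (use p W in \<open>auto simp: points_restrict_atlas\<close>)
  show "smooth_near (restrict_atlas A W) A id p"
    unfolding smooth_near_def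
  proof (intro conjI ballI impI)
    fix c' d assume c': "c' \<in> restrict_atlas A W" "p \<in> fst c'" and d: "d \<in> A" "id p \<in> fst d"
    then obtain c where c: "c \<in> A" "c' = (fst c \<inter> W, snd c)" "p \<in> fst c" by (auto simp: restrict_atlas_def)
    obtain N where N: "open N" "snd c p \<in> N" "N \<subseteq> snd c ` (fst c \<inter> fst d \<inter> W)" "smooth_on N (local_rep c d id)"
      using id[OF c(1) d(1) c(3)] d(2) by auto
    \<comment> \<open>The two parametrisations invert the same coordinate map over different
      domains; they agree at coordinates of points of W.\<close>
    have "local_rep c d id y = local_rep c' d id y" if "y \<in> N" for y
    proof -
      obtain x where "y = snd c x" "x \<in> fst c" "x \<in> W" using N(3) \<open>y \<in> N\<close> by auto
      then show ?thesis using inj[OF c(1)] param_restrict[OF inj[OF c(1)], of x W] by (simp add: local_rep_def c(2))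
    qed
    then have "smooth_on N (local_rep c' d id)" by (rule smooth_on_cong[OF N(1,4)])
    then show "\<exists>N. open N \<and> snd c' p \<in> N \<and> N \<subseteq> snd c' ` (fst c' \<inter> id -` fst d) \<and> smooth_on N (local_rep c' d id)"
      using N by (intro exI[of _ N]) (auto simp: c(2))
  qed (use p W in \<open>auto simp: points_restrict_atlas\<close>)
qed

section \<open>Tangent maps\<close>

abbreviation Dloc ::
    "('a, 'e::real_normed_vector) chart \<Rightarrow> ('b, 'f::real_normed_vector) chart \<Rightarrow> ('a \<Rightarrow> 'b) \<Rightarrow> 'a \<Rightarrow> 'e \<Rightarrow> 'f" where
  "Dloc c d F p \<equiv> frechet_derivative (local_rep c d F) (at (snd c p))"

lemma linear_Dloc:
  "smooth_near A B F p \<Longrightarrow> c \<in> A \<Longrightarrow> d \<in> B \<Longrightarrow> p \<in> fst c \<Longrightarrow> F p \<in> fst d \<Longrightarrow> linear (Dloc c d F p)"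
  by (intro linear_frechet_derivative smooth_near_differentiable)

lemma linear_Dloc_id:
  assumes "smooth_manifold A" "c \<in> A" "d \<in> A" "p \<in> fst c" "p \<in> fst d"
  shows "linear (Dloc c d id p)"
  by (rule linear_Dloc[OF smooth_near_id[OF assms(1) pointsI[OF assms(2,4)]]]) (use assms in auto)

lemma linear_lincomb: "linear L \<Longrightarrow> L (a *\<^sub>R v + b *\<^sub>R w) = a *\<^sub>R L v + b *\<^sub>R L w"
  by (simp add: linear_add linear_scale)

text \<open>The chain rule for \<open>id\<close> composed with itself. It makes the family
  \<open>coord_vector\<close> compatible with all coordinate changes.\<close>

lemma Dloc_id_cocycle:
  assumes "smooth_manifold A" "c \<in> A" "d \<in> A" "e \<in> A" "p \<in> fst c" "p \<in> fst d" "p \<in> fst e"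
  shows "Dloc c e id p v = Dloc d e id p (Dloc c d id p v)"
proof -
  note ch = smooth_manifold_charts[OF assms(1)]
  note id = smooth_near_id[OF assms(1) pointsI[OF assms(2,5)]]
  have "(\<lambda>x. id (id x)) = (id :: 'a \<Rightarrow> 'a)" by auto
  then show ?thesis
    using frechet_derivative_local_rep_compose[OF ch ch id, of A id c d e v] id assms by simp
qed

lemma Dloc_id_same:
  assumes "smooth_manifold A" "c \<in> A" "p \<in> fst c"
  shows "Dloc c c id p v = v"
proof -
  note ch = smooth_manifold_charts[OF assms(1)]
  have "frechet_derivative (\<lambda>y. y) (at (snd c p)) = Dloc c c id p"
    by (rule frechet_derivative_transform_within_open[OF _ charts_open[OF ch assms(2)]])
       (use assms charts_param[OF ch assms(2)] in \<open>auto simp: local_rep_def\<close>)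
  then show ?thesis by (metis frechet_derivative_ident)
qed

section \<open>Tangent spaces and coordinate vectors\<close>

lemma tangent_space_chart:
  assumes "v \<in> tangent_space A p" "c \<in> A" "d \<in> A" "p \<in> fst c" "p \<in> fst d"
  shows "v d = Dloc c d id p (v c)"
  using assms unfolding tangent_space_def by blast

lemma tangent_space_outside:
  "v \<in> tangent_space A p \<Longrightarrow> \<not> (c \<in> A \<and> p \<in> fst c) \<Longrightarrow> v c = 0"
  unfolding tangent_space_def by blast

text \<open>Coordinate changes fix the entries at charts around p, and all other entries are zero by
  convention, so one chart decides equality.\<close>

lemma tangent_space_eqI:
  assumes "v \<in> tangent_space A p" "w \<in> tangent_space A p" "c \<in> A" "p \<in> fst c" "v c = w c"
  shows "v = w"
proof
  fix d
  show "v d = w d"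
  proof (cases "d \<in> A \<and> p \<in> fst d")
    case True
    then show ?thesis
      using tangent_space_chart[OF assms(1,3) _ assms(4)] tangent_space_chart[OF assms(2,3) _ assms(4)] assms(5)
      by metis
  qed (use assms(1,2)[THEN tangent_space_outside] in auto)
qed

lemma tangent_space_lincomb:
  assumes "smooth_manifold A" "v \<in> tangent_space A p" "w \<in> tangent_space A p"
  shows "(\<lambda>c. a *\<^sub>R v c + b *\<^sub>R w c) \<in> tangent_space A p"
  unfolding tangent_space_def
proof (intro CollectI conjI ballI allI impI)
  fix c d assume cd: "c \<in> A" "d \<in> A" "p \<in> fst c \<and> p \<in> fst d"
  then show "a *\<^sub>R v d + b *\<^sub>R w d = Dloc c d id p (a *\<^sub>R v c + b *\<^sub>R w c)"
    using linear_lincomb[OF linear_Dloc_id[OF assms(1) cd(1,2)], of p a "v c" b "w c"]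
      tangent_space_chart[OF assms(2) cd(1,2)] tangent_space_chart[OF assms(3) cd(1,2)] by simp
qed (use assms(2,3)[THEN tangent_space_outside] in auto)

lemma tangent_space_diff:
  assumes "smooth_manifold A" "v \<in> tangent_space A p" "w \<in> tangent_space A p"
  shows "(\<lambda>c. v c - w c) \<in> tangent_space A p"
  using tangent_space_lincomb[OF assms, of 1 "-1"] by simp

lemma tangent_space_zero:
  assumes "smooth_manifold A"
  shows "(\<lambda>_. 0) \<in> tangent_space A p"
  using linear_0[OF linear_Dloc_id[OF assms]] by (auto simp: tangent_space_def)

lemma coord_vector_tangent_space:
  assumes A: "smooth_manifold A" and c: "c \<in> A" "p \<in> fst c"
  shows "coord_vector A c p e \<in> tangent_space A p"
  unfolding tangent_space_def
proof (intro CollectI conjI ballI allI impI)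
  fix d d' assume d: "d \<in> A" "d' \<in> A" "p \<in> fst d \<and> p \<in> fst d'"
  then show "coord_vector A c p e d' = Dloc d d' id p (coord_vector A c p e d)"
    using Dloc_id_cocycle[OF A c(1) d(1,2)] c(2) by (simp add: coord_vector_def)
qed (auto simp: coord_vector_def)

lemma coord_vector_same:
  assumes "smooth_manifold A" "c \<in> A" "p \<in> fst c"
  shows "coord_vector A c p e c = e"
  using assms Dloc_id_same[OF assms] by (simp add: coord_vector_def)

lemma coord_vector_of_tangent:
  assumes A: "smooth_manifold A" and c: "c \<in> A" "p \<in> fst c" and v: "v \<in> tangent_space A p"
  shows "coord_vector A c p (v c) = v"
  by (rule tangent_space_eqI[OF coord_vector_tangent_space[OF A c] v c coord_vector_same[OF A c]])

lemma coord_vector_lincomb: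
  assumes A: "smooth_manifold A" and c: "c \<in> A" "p \<in> fst c"
  shows "coord_vector A c p (a *\<^sub>R v + b *\<^sub>R w) =
    (\<lambda>d. a *\<^sub>R coord_vector A c p v d + b *\<^sub>R coord_vector A c p w d)"
proof (rule tangent_space_eqI[OF coord_vector_tangent_space[OF A c] _ c])
  show "(\<lambda>d. a *\<^sub>R coord_vector A c p v d + b *\<^sub>R coord_vector A c p w d) \<in> tangent_space A p"
    by (intro tangent_space_lincomb A coord_vector_tangent_space c)
qed (simp add: coord_vector_same[OF A c])

lemma tangent_linear_coord_vector:
  assumes A: "smooth_manifold A" and c: "c \<in> A" "p \<in> fst c" and f: "tangent_linear A p f"
  shows "linear (\<lambda>e. f (coord_vector A c p e))"
proof (rule linearI)
  have *: "f (coord_vector A c p (a *\<^sub>R v + b *\<^sub>R w)) =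
      a *\<^sub>R f (coord_vector A c p v) + b *\<^sub>R f (coord_vector A c p w)" for a b v w
    using f coord_vector_tangent_space[OF A c] unfolding coord_vector_lincomb[OF A c] tangent_linear_def
    by blast
  show "f (coord_vector A c p (v + w)) = f (coord_vector A c p v) + f (coord_vector A c p w)" for v w
    using *[of 1 v 1 w] by simp
  show "f (coord_vector A c p (a *\<^sub>R v)) = a *\<^sub>R f (coord_vector A c p v)" for a v
    using *[of a v 0 v] by simp
qed

lemma tangent_linear_lincomb:
  "tangent_linear A p f \<Longrightarrow> v \<in> tangent_space A p \<Longrightarrow> w \<in> tangent_space A p \<Longrightarrow>
    f (\<lambda>c. a *\<^sub>R v c + b *\<^sub>R w c) = a *\<^sub>R f v + b *\<^sub>R f w"
  by (simp add: tangent_linear_def)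

lemma tangent_linear_diff:
  assumes "tangent_linear A p f" "v \<in> tangent_space A p" "w \<in> tangent_space A p"
  shows "f (\<lambda>c. v c - w c) = f v - f w"
  using tangent_linear_lincomb[OF assms, of 1 "-1"] by simp

text \<open>This removes the choice of chart in \<open>tangent_map\<close>: the chain rule through
  the change from the chosen chart to c turns one expression into the other.\<close>

lemma tangent_map_chart:
  assumes A: "smooth_manifold A" and F: "smooth_near A B F p" and v: "v \<in> tangent_space A p"
    and c: "c \<in> A" "p \<in> fst c" and d: "d \<in> B" "F p \<in> fst d"
  shows "tangent_map A B F p v d = Dloc c d F p (v c)"
proof -
  define c' where "c' = (SOME c. c \<in> A \<and> p \<in> fst c)"
  have c': "c' \<in> A" "p \<in> fst c'"
    using someI[of "\<lambda>c. c \<in> A \<and> p \<in> fst c" c] c by (auto simp: c'_def)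
  note ch = smooth_manifold_charts[OF A] and id = smooth_near_id[OF A pointsI[OF c]]
  have "Dloc c' d F p (v c') = Dloc c d F p (Dloc c' c id p (v c'))"
    using frechet_derivative_local_rep_compose[OF ch ch id, of B F c' c d "v c'"] F c c' d by simp
  also have "Dloc c' c id p (v c') = v c"
    using tangent_space_chart[OF v c'(1) c(1) c'(2) c(2)] by simp
  finally show ?thesis using d by (simp add: tangent_map_def Let_def c'_def)
qed

lemma tangent_map_outside: "\<not> (d \<in> B \<and> F p \<in> fst d) \<Longrightarrow> tangent_map A B F p v d = 0"
  unfolding tangent_map_def by (rule if_not_P)

lemma tangent_map_tangent_space:
  assumes A: "smooth_manifold A" and B: "smooth_manifold B"
    and F: "smooth_near A B F p" and v: "v \<in> tangent_space A p"
  shows "tangent_map A B F p v \<in> tangent_space B (F p)"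
  unfolding tangent_space_def
proof (intro CollectI conjI ballI allI impI)
  obtain c where c: "c \<in> A" "p \<in> fst c" using smooth_near_points(1)[OF F] by (rule pointsE)
  note ch = smooth_manifold_charts[OF A] smooth_manifold_charts[OF B]
  fix d e assume d: "d \<in> B" "e \<in> B" "F p \<in> fst d \<and> F p \<in> fst e"
  have "Dloc c e F p (v c) = Dloc d e id (F p) (Dloc c d F p (v c))"
    using frechet_derivative_local_rep_compose[OF ch F smooth_near_id[OF B smooth_near_points(2)[OF F]] c d(1) _ d(2)] d
    by (simp add: id_def)
  then show "tangent_map A B F p v e = Dloc d e id (F p) (tangent_map A B F p v d)"
    using d by (simp add: tangent_map_chart[OF A F v c])
qed (auto simp: tangent_map_def)

lemma tangent_map_compose:
  assumes A: "smooth_manifold A" and B: "smooth_manifold B"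
    and F: "smooth_near A B F p" and H: "smooth_near B C H (F p)" and v: "v \<in> tangent_space A p"
  shows "tangent_map A C (\<lambda>x. H (F x)) p v = tangent_map B C H (F p) (tangent_map A B F p v)"
proof
  fix e
  obtain c where c: "c \<in> A" "p \<in> fst c" using smooth_near_points(1)[OF F] by (rule pointsE)
  obtain d where d: "d \<in> B" "F p \<in> fst d" using smooth_near_points(2)[OF F] by (rule pointsE)
  note ch = smooth_manifold_charts[OF A] smooth_manifold_charts[OF B]
  note HF = smooth_near_compose[OF ch F H]
  show "tangent_map A C (\<lambda>x. H (F x)) p v e = tangent_map B C H (F p) (tangent_map A B F p v) e"
  proof (cases "e \<in> C \<and> H (F p) \<in> fst e")
    case True
    then have e: "e \<in> C" "H (F p) \<in> fst e" by auto
    show ?thesis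
      using frechet_derivative_local_rep_compose[OF ch F H c d e] 
      by (simp add: tangent_map_chart[OF A HF v c e] tangent_map_chart[OF A F v c d]
          tangent_map_chart[OF B H tangent_map_tangent_space[OF A B F v] d e])
  qed (simp add: tangent_map_outside)
qed

lemma tangent_map_id:
  assumes A: "smooth_manifold A" and p: "p \<in> points A" and v: "v \<in> tangent_space A p"
  shows "tangent_map A A id p v = v"
proof -
  obtain c where c: "c \<in> A" "p \<in> fst c" using p by (rule pointsE)
  note id = smooth_near_id[OF A p]
  show ?thesis
  proof (rule tangent_space_eqI[OF _ v c])
    show "tangent_map A A id p v \<in> tangent_space A p"
      using tangent_map_tangent_space[OF A A id v] by simp
    show "tangent_map A A id p v c = v c"
      using tangent_map_chart[OF A id v c c(1)] c Dloc_id_same[OF A c] by simp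
  qed
qed

text \<open>Identities such as \<pi>(x g) = \<pi>(x) hold at points of the manifold or over an open
  set, not for all elements of the type. Equality near p is what is available for differentiating
  them.\<close>

lemma tangent_map_cong:
  assumes A: "smooth_manifold A" and F: "smooth_near A B F p"
    and ev: "eventually (\<lambda>x. F x = F' x) (near A p)" and v: "v \<in> tangent_space A p"
  shows "tangent_map A B F p v = tangent_map A B F' p v"
proof
  fix d
  obtain c where c: "c \<in> A" "p \<in> fst c" using smooth_near_points(1)[OF F] by (rule pointsE)
  note F' = smooth_near_cong[OF A F ev]
  have eq: "F p = F' p"
    using ev smooth_near_points(1)[OF F] by (auto simp: eventually_nhdsin topspace_manifold_topology[OF A])
  obtain N where N: "open N" "snd c p \<in> N" "N \<subseteq> snd c ` fst c" "\<And>y. y \<in> N \<Longrightarrow> F (param c y) = F' (param c y)"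
    by (rule eventually_near_chartD[OF A c ev]) (rule that)
  show "tangent_map A B F p v d = tangent_map A B F' p v d"
  proof (cases "d \<in> B \<and> F p \<in> fst d")
    case True
    then have d: "d \<in> B" "F p \<in> fst d" by auto
    have "Dloc c d F p = Dloc c d F' p"
      by (rule frechet_derivative_transform_within_open[OF smooth_near_differentiable[OF F c(1) d(1) c(2) d(2)] N(1,2)])
         (simp add: local_rep_def N(4))
    then show ?thesis
      using tangent_map_chart[OF A F v c d] tangent_map_chart[OF A F' v c d(1)] d eq by simp
  next
    case False
    then have "\<not> (d \<in> B \<and> F' p \<in> fst d)" using eq by simp
    with False show ?thesis by (simp add: tangent_map_outside)
  qed
qed

lemma tangent_map_lincomb:
  assumes A: "smooth_manifold A" and F: "smooth_near A B F p"
    and v: "v \<in> tangent_space A p" and w: "w \<in> tangent_space A p"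
  shows "tangent_map A B F p (\<lambda>c. a *\<^sub>R v c + b *\<^sub>R w c) =
    (\<lambda>d. a *\<^sub>R tangent_map A B F p v d + b *\<^sub>R tangent_map A B F p w d)"
proof
  fix d
  obtain c where c: "c \<in> A" "p \<in> fst c" using smooth_near_points(1)[OF F] by (rule pointsE)
  show "tangent_map A B F p (\<lambda>c. a *\<^sub>R v c + b *\<^sub>R w c) d =
      a *\<^sub>R tangent_map A B F p v d + b *\<^sub>R tangent_map A B F p w d"
  proof (cases "d \<in> B \<and> F p \<in> fst d")
    case True
    then have d: "d \<in> B" "F p \<in> fst d" by auto
    show ?thesis
      using linear_lincomb[OF linear_Dloc[OF F c(1) d(1) c(2) d(2)]]
      by (simp add: tangent_map_chart[OF A F v c d] tangent_map_chart[OF A F w c d]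
        tangent_map_chart[OF A F tangent_space_lincomb[OF A v w] c d])
  qed (simp add: tangent_map_outside)
qed

lemma tangent_map_diff:
  assumes "smooth_manifold A" "smooth_near A B F p" "v \<in> tangent_space A p" "w \<in> tangent_space A p"
  shows "tangent_map A B F p (\<lambda>c. v c - w c) =
    (\<lambda>d. tangent_map A B F p v d - tangent_map A B F p w d)"
  using tangent_map_lincomb[OF assms, of 1 "-1"] by simp

lemma tangent_map_zero:
  assumes "smooth_manifold A" "smooth_near A B F p"
  shows "tangent_map A B F p (\<lambda>_. 0) = (\<lambda>_. 0)"
  using tangent_map_lincomb[OF assms tangent_space_zero[OF assms(1)] tangent_space_zero[OF assms(1)], of 0 0]
  by simp

lemma tangent_map_const:
  assumes A: "smooth_manifold A" and p: "p \<in> points A" and q: "q \<in> points B" and v: "v \<in> tangent_space A p"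
  shows "tangent_map A B (\<lambda>_. q) p v = (\<lambda>_. 0)"
proof
  fix d
  obtain c where c: "c \<in> A" "p \<in> fst c" using p by (rule pointsE)
  note F = smooth_near_const[OF smooth_manifold_charts[OF A] p q]
  show "tangent_map A B (\<lambda>_. q) p v d = 0"
  proof (cases "d \<in> B \<and> q \<in> fst d")
    case True
    then show ?thesis
      using tangent_map_chart[OF A F v c] by (simp add: local_rep_def o_def)
  qed (simp add: tangent_map_outside)
qed

section \<open>Partial derivatives and the product rule\<close>

lemma frechet_derivative_Pair:
  assumes "f differentiable (at x)" "h differentiable (at x)"
  shows "frechet_derivative (\<lambda>y. (f y, h y)) (at x) w =
    (frechet_derivative f (at x) w, frechet_derivative h (at x) w)"
  using frechet_derivative_at[OF has_derivative_Pair[OF assms[unfolded frechet_derivative_works]]] by metis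

lemma local_rep_const: "local_rep a d (\<lambda>_. q) = (\<lambda>_. snd d q)"
  by (simp add: local_rep_def o_def)

text \<open>With q frozen the map is \<mu> after the inclusion of x as (x, q), whose coordinate
  derivative sends w to (w, 0).\<close>

lemma Dloc_partial_left:
  assumes B: "smooth_manifold B" and C: "smooth_manifold C"
    and \<mu>: "smooth_near (prod_atlas B C) E \<mu> (p, q)"
    and b: "b \<in> B" "p \<in> fst b" and c: "c \<in> C" "q \<in> fst c" and e: "e \<in> E" "\<mu> (p, q) \<in> fst e"
  shows "smooth_near B E (\<lambda>x. \<mu> (x, q)) p"
    "Dloc b e (\<lambda>x. \<mu> (x, q)) p w =
      frechet_derivative (local_rep (fst b \<times> fst c, map_prod (snd b) (snd c)) e \<mu>) (at (snd b p, snd c q)) (w, 0)"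
proof -
  note ch = smooth_manifold_charts[OF B] charts_prod_atlas[OF smooth_manifold_charts[OF B] smooth_manifold_charts[OF C]]
  let ?bc = "(fst b \<times> fst c, map_prod (snd b) (snd c))"
  have bc: "?bc \<in> prod_atlas B C" "(p, q) \<in> fst ?bc"
    using b c prod_atlas_chart[OF b(1) c(1)] by simp_all
  have id: "smooth_near B B (\<lambda>x. x) p"
    using smooth_near_id[OF B pointsI[OF b]] by (simp add: id_def)
  note pair = smooth_near_Pair[OF ch(1) id smooth_near_const[OF ch(1) pointsI[OF b] pointsI[OF c]]]
  show "smooth_near B E (\<lambda>x. \<mu> (x, q)) p"
    by (rule smooth_near_compose[OF ch pair \<mu>])
  have "Dloc b ?bc (\<lambda>b. (b, q)) p w = (w, 0)"
    unfolding local_rep_Pair local_rep_const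
    using frechet_derivative_Pair[OF smooth_near_differentiable[OF id b(1) b(1) b(2) b(2)] differentiable_const]
      Dloc_id_same[OF B b]
    by (simp add: id_def)
  then show "Dloc b e (\<lambda>x. \<mu> (x, q)) p w =
      frechet_derivative (local_rep ?bc e \<mu>) (at (snd b p, snd c q)) (w, 0)"
    using frechet_derivative_local_rep_compose[OF ch pair \<mu> b bc e, of w] by simp
qed

lemma Dloc_partial_right:
  assumes B: "smooth_manifold B" and C: "smooth_manifold C"
    and \<mu>: "smooth_near (prod_atlas B C) E \<mu> (p, q)"
    and b: "b \<in> B" "p \<in> fst b" and c: "c \<in> C" "q \<in> fst c" and e: "e \<in> E" "\<mu> (p, q) \<in> fst e"
  shows "smooth_near C E (\<lambda>x. \<mu> (p, x)) q"
    "Dloc c e (\<lambda>x. \<mu> (p, x)) q w =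
      frechet_derivative (local_rep (fst b \<times> fst c, map_prod (snd b) (snd c)) e \<mu>) (at (snd b p, snd c q)) (0, w)"
proof -
  note ch = smooth_manifold_charts[OF C] charts_prod_atlas[OF smooth_manifold_charts[OF B] smooth_manifold_charts[OF C]]
  let ?bc = "(fst b \<times> fst c, map_prod (snd b) (snd c))"
  have bc: "?bc \<in> prod_atlas B C" "(p, q) \<in> fst ?bc"
    using b c prod_atlas_chart[OF b(1) c(1)] by simp_all
  have id: "smooth_near C C (\<lambda>x. x) q"
    using smooth_near_id[OF C pointsI[OF c]] by (simp add: id_def)
  note pair = smooth_near_Pair[OF ch(1) smooth_near_const[OF ch(1) pointsI[OF c] pointsI[OF b]] id]
  show "smooth_near C E (\<lambda>x. \<mu> (p, x)) q"
    by (rule smooth_near_compose[OF ch pair \<mu>])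
  have "Dloc c ?bc (\<lambda>x. (p, x)) q w = (0, w)"
    unfolding local_rep_Pair local_rep_const
    using frechet_derivative_Pair[OF differentiable_const smooth_near_differentiable[OF id c(1) c(1) c(2) c(2)]]
      Dloc_id_same[OF C c]
    by (simp add: id_def)
  then show "Dloc c e (\<lambda>x. \<mu> (p, x)) q w =
      frechet_derivative (local_rep ?bc e \<mu>) (at (snd b p, snd c q)) (0, w)"
    using frechet_derivative_local_rep_compose[OF ch pair \<mu> c bc e, of w] by simp
qed

text \<open>The coordinate derivative of \<mu> is additive, and each direction is a sum of one along
  the first and one along the second factor. With partial tangent maps in the statement, tangent
  spaces of the product do not have to be introduced.\<close>

lemma tangent_map_Pair:
  assumes A: "smooth_manifold A" and B: "smooth_manifold B" and C: "smooth_manifold C"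
    and F: "smooth_near A B F p" and H: "smooth_near A C H p"
    and \<mu>: "smooth_near (prod_atlas B C) E \<mu> (F p, H p)" and v: "v \<in> tangent_space A p"
  shows "tangent_map A E (\<lambda>x. \<mu> (F x, H x)) p v = (\<lambda>e.
    tangent_map B E (\<lambda>b. \<mu> (b, H p)) (F p) (tangent_map A B F p v) e +
    tangent_map C E (\<lambda>c. \<mu> (F p, c)) (H p) (tangent_map A C H p v) e)"
proof
  fix e
  note chA = smooth_manifold_charts[OF A]
  note chBC = charts_prod_atlas[OF smooth_manifold_charts[OF B] smooth_manifold_charts[OF C]]
  note FH = smooth_near_Pair[OF chA F H]
  obtain a where a: "a \<in> A" "p \<in> fst a" using smooth_near_points(1)[OF F] by (rule pointsE)
  obtain b where b: "b \<in> B" "F p \<in> fst b" using smooth_near_points(2)[OF F] by (rule pointsE)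
  obtain c where c: "c \<in> C" "H p \<in> fst c" using smooth_near_points(2)[OF H] by (rule pointsE)
  let ?bc = "(fst b \<times> fst c, map_prod (snd b) (snd c))"
  have bc: "?bc \<in> prod_atlas B C" "(F p, H p) \<in> fst ?bc"
    using b c prod_atlas_chart[OF b(1) c(1)] by simp_all
  show "tangent_map A E (\<lambda>x. \<mu> (F x, H x)) p v e =
    tangent_map B E (\<lambda>b. \<mu> (b, H p)) (F p) (tangent_map A B F p v) e +
    tangent_map C E (\<lambda>c. \<mu> (F p, c)) (H p) (tangent_map A C H p v) e"
  proof (cases "e \<in> E \<and> \<mu> (F p, H p) \<in> fst e")
    case True
    then have e: "e \<in> E" "\<mu> (F p, H p) \<in> fst e" by auto
    note left = Dloc_partial_left[OF B C \<mu> b c e] and right = Dloc_partial_right[OF B C \<mu> b c e]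
    let ?D = "frechet_derivative (local_rep ?bc e \<mu>) (at (snd b (F p), snd c (H p)))"
    have lin: "linear ?D"
      using linear_Dloc[OF \<mu> bc(1) e(1) bc(2) e(2)] by simp
    have "Dloc a e (\<lambda>x. \<mu> (F x, H x)) p (v a) = ?D (Dloc a b F p (v a), Dloc a c H p (v a))"
      using frechet_derivative_local_rep_compose[OF chA chBC FH \<mu> a bc e]
        frechet_derivative_Pair[OF smooth_near_differentiable[OF F a(1) b(1) a(2) b(2)]
          smooth_near_differentiable[OF H a(1) c(1) a(2) c(2)]]
      by (simp add: local_rep_Pair)
    also have "\<dots> = ?D (Dloc a b F p (v a), 0) + ?D (0, Dloc a c H p (v a))"
      using linear_add[OF lin, of "(Dloc a b F p (v a), 0)" "(0, Dloc a c H p (v a))"] by simp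
    finally show ?thesis
      using tangent_map_chart[OF A smooth_near_compose[OF chA chBC FH \<mu>] v a e]
        tangent_map_chart[OF B left(1) tangent_map_tangent_space[OF A B F v] b e]
        tangent_map_chart[OF C right(1) tangent_map_tangent_space[OF A C H v] c e]
        tangent_map_chart[OF A F v a b] tangent_map_chart[OF A H v a c]
      by (simp add: left(2) right(2))
  qed (simp add: tangent_map_outside)
qed

section \<open>Smooth fields along maps\<close>

lemma local_rep_vector_atlas [simp]: "local_rep c (UNIV, id) f = (\<lambda>y. f (param c y))"
  by (simp add: local_rep_def o_def)

lemma smooth_near_vector_iff:
  "smooth_near A vector_atlas f p \<longleftrightarrow> p \<in> points A \<and> (\<forall>c\<in>A. p \<in> fst c \<longrightarrow>
    (\<exists>N. open N \<and> snd c p \<in> N \<and> N \<subseteq> snd c ` fst c \<and> smooth_on N (\<lambda>y. f (param c y))))"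
  by (simp add: smooth_near_def vector_atlas_def points_def)

lemma smooth_near_vectorE:
  assumes "smooth_near A vector_atlas f p" "c \<in> A" "p \<in> fst c"
  obtains N where "open N" "snd c p \<in> N" "N \<subseteq> snd c ` fst c" "smooth_on N (\<lambda>y. f (param c y))"
  using assms unfolding smooth_near_vector_iff by blast

lemma smooth_near_add:
  assumes f: "smooth_near A vector_atlas f p" and g: "smooth_near A vector_atlas g p"
  shows "smooth_near A vector_atlas (\<lambda>x. f x + g x) p"
  unfolding smooth_near_vector_iff
proof (intro conjI ballI impI)
  fix c assume c: "c \<in> A" "p \<in> fst c"
  obtain M where M: "open M" "snd c p \<in> M" "M \<subseteq> snd c ` fst c" "smooth_on M (\<lambda>y. f (param c y))"
    using f c by (rule smooth_near_vectorE)
  obtain N where N: "open N" "snd c p \<in> N" "N \<subseteq> snd c ` fst c" "smooth_on N (\<lambda>y. g (param c y))"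
    using g c by (rule smooth_near_vectorE)
  have "smooth_on (M \<inter> N) (\<lambda>y. f (param c y) + g (param c y))"
    by (rule smooth_on_add[OF open_Int[OF M(1) N(1)] smooth_on_subset[OF M(4)] smooth_on_subset[OF N(4)]]) auto
  then show "\<exists>N. open N \<and> snd c p \<in> N \<and> N \<subseteq> snd c ` fst c \<and> smooth_on N (\<lambda>y. f (param c y) + g (param c y))"
    using M N by (intro exI[of _ "M \<inter> N"]) auto
qed (rule smooth_near_points(1)[OF f])

lemma smooth_near_scaleR:
  assumes f: "smooth_near A vector_atlas f p" and g: "smooth_near A vector_atlas g p"
  shows "smooth_near A vector_atlas (\<lambda>x. f x *\<^sub>R g x) p"
  unfolding smooth_near_vector_iff
proof (intro conjI ballI impI)
  fix c assume c: "c \<in> A" "p \<in> fst c"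
  obtain M where M: "open M" "snd c p \<in> M" "M \<subseteq> snd c ` fst c" "smooth_on M (\<lambda>y. f (param c y))"
    using f c by (rule smooth_near_vectorE)
  obtain N where N: "open N" "snd c p \<in> N" "N \<subseteq> snd c ` fst c" "smooth_on N (\<lambda>y. g (param c y))"
    using g c by (rule smooth_near_vectorE)
  have "smooth_on (M \<inter> N) (\<lambda>y. f (param c y) *\<^sub>R g (param c y))"
    by (rule smooth_on_scaleR[OF open_Int[OF M(1) N(1)] smooth_on_subset[OF M(4)] smooth_on_subset[OF N(4)]]) auto
  then show "\<exists>N. open N \<and> snd c p \<in> N \<and> N \<subseteq> snd c ` fst c \<and> smooth_on N (\<lambda>y. f (param c y) *\<^sub>R g (param c y))"
    using M N by (intro exI[of _ "M \<inter> N"]) auto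
qed (rule smooth_near_points(1)[OF f])

lemma smooth_near_bounded_linear:
  assumes L: "bounded_linear L" and f: "smooth_near A vector_atlas f p"
  shows "smooth_near A vector_atlas (\<lambda>x. L (f x)) p"
  unfolding smooth_near_vector_iff
proof (intro conjI ballI impI)
  fix c assume c: "c \<in> A" "p \<in> fst c"
  obtain N where N: "open N" "snd c p \<in> N" "N \<subseteq> snd c ` fst c" "smooth_on N (\<lambda>y. f (param c y))"
    using f c by (rule smooth_near_vectorE)
  show "\<exists>N. open N \<and> snd c p \<in> N \<and> N \<subseteq> snd c ` fst c \<and> smooth_on N (\<lambda>y. L (f (param c y)))"
    using N smooth_on_bounded_linear_compose[OF L N(1,4)] by blast
qed (rule smooth_near_points(1)[OF f])

lemma smooth_near_sum:
  assumes "charts A" "p \<in> points A" "\<And>i. i \<in> I \<Longrightarrow> smooth_near A vector_atlas (f i) p"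
  shows "smooth_near A vector_atlas (\<lambda>x. \<Sum>i\<in>I. f i x) p"
  using assms(3)
proof (induction I rule: infinite_finite_induct)
  case (insert i I)
  then show ?case using smooth_near_add[of A "f i" p "\<lambda>x. \<Sum>i\<in>I. f i x"] by simp
qed (simp_all add: smooth_near_const[OF assms(1,2)])

lemma smooth_near_diff:
  fixes f g :: "'a \<Rightarrow> 'w::real_normed_vector"
  assumes f: "smooth_near A vector_atlas f p" and g: "smooth_near A vector_atlas g p"
  shows "smooth_near A vector_atlas (\<lambda>x. f x - g x) p"
  using smooth_near_add[OF f smooth_near_bounded_linear[OF bounded_linear_minus[OF bounded_linear_ident] g]] by simp

text \<open>Fields along F are defined to be smooth on chart overlaps. Smoothness of F makes the
  overlaps open, so this becomes smoothness near each point, where composition and pairing rules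
  apply; the next lemma leads back.\<close>

lemma smooth_near_if_smooth_on_overlap:
  assumes B: "charts B" and F: "smooth_map B A F" and a: "a \<in> A" "F x \<in> fst a" and x: "x \<in> points B"
    and f: "\<And>b. b \<in> B \<Longrightarrow> smooth_on (snd b ` (fst b \<inter> F -` fst a)) (\<lambda>y. f (param b y))"
  shows "smooth_near B vector_atlas f x"
  unfolding smooth_near_vector_iff
proof (intro conjI ballI impI x)
  fix b assume b: "b \<in> B" "x \<in> fst b"
  have "open (snd b ` (fst b \<inter> F -` fst a))" using F b a by (simp add: smooth_map_def)
  then show "\<exists>N. open N \<and> snd b x \<in> N \<and> N \<subseteq> snd b ` fst b \<and> smooth_on N (\<lambda>y. f (param b y))"
    using f[OF b(1)] a b by (intro exI[of _ "snd b ` (fst b \<inter> F -` fst a)"]) auto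
qed

lemma smooth_on_if_smooth_near:
  assumes B: "charts B" and b: "b \<in> B" and f: "\<And>x. x \<in> Z \<Longrightarrow> x \<in> fst b \<and> smooth_near B vector_atlas f x"
  shows "smooth_on (snd b ` Z) (\<lambda>y. f (param b y))"
proof (rule smooth_on_locally)
  fix y assume "y \<in> snd b ` Z"
  then obtain x where x: "x \<in> Z" "y = snd b x" by auto
  then obtain N where "open N" "snd b x \<in> N" "smooth_on N (\<lambda>y. f (param b y))"
    using f[OF x(1)] smooth_near_vectorE[of B f x b] b by metis
  then show "\<exists>N. open N \<and> y \<in> N \<and> smooth_on N (\<lambda>y. f (param b y))" using x(2) by blast
qed

lemma smooth_near_coordinate:
  assumes A: "smooth_manifold A" and a: "a \<in> A" "p \<in> fst a"
  shows "smooth_near A vector_atlas (snd a) p"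
  unfolding smooth_near_vector_iff
proof (intro conjI ballI impI)
  fix c assume c: "c \<in> A" "p \<in> fst c"
  have *: "open (snd c ` (fst c \<inter> fst a))" "smooth_on (snd c ` (fst c \<inter> fst a)) (local_rep c a id)"
    using A c(1) a(1) by (auto simp: smooth_manifold_def)
  have "local_rep c a id = (\<lambda>y. snd a (param c y))" by (simp add: local_rep_def o_def)
  with * show "\<exists>N. open N \<and> snd c p \<in> N \<and> N \<subseteq> snd c ` fst c \<and> smooth_on N (\<lambda>y. snd a (param c y))"
    using a c by (intro exI[of _ "snd c ` (fst c \<inter> fst a)"]) auto
qed (rule pointsI[OF a])

lemma smooth_near_vector_vector:
  assumes "open N" "x \<in> N" "smooth_on N f"
  shows "smooth_near vector_atlas vector_atlas f x"
  unfolding smooth_near_vector_iff using assms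
  by (auto simp: vector_atlas_def points_def intro!: exI[of _ N])

text \<open>As a function of the base point, the derivative is the coordinate map of a followed by a
  directional derivative of the local representation.\<close>

lemma smooth_near_Dloc:
  fixes A :: "('a, 'e::real_normed_vector) atlas"
  assumes A: "smooth_manifold A" and H: "smooth_near A C H p"
    and a: "a \<in> A" "p \<in> fst a" and d: "d \<in> C" "H p \<in> fst d"
  shows "smooth_near A vector_atlas (\<lambda>z. Dloc a d H z e) p"
proof -
  note ch = smooth_manifold_charts[OF A]
  obtain N where N: "open N" "snd a p \<in> N" "smooth_on N (local_rep a d H)"
    using smooth_nearE[OF H a(1) d(1) a(2) d(2)] by metis
  show ?thesis
    by (rule smooth_near_compose[OF ch charts_vector_atlas[OF charts_finite_dim[OF ch]]
          smooth_near_coordinate[OF A a]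
          smooth_near_vector_vector[OF N(1,2) smooth_on_frechet_derivative[OF N(3)]]])
qed

lemma smooth_near_coord_vector:
  assumes A: "smooth_manifold A" and a: "a \<in> A" "p \<in> fst a" and b: "b \<in> A" "p \<in> fst b"
  shows "smooth_near A vector_atlas (\<lambda>x. coord_vector A a x e b) p"
proof (rule smooth_near_cong[OF A])
  note id = smooth_near_id[OF A pointsI[OF a]]
  show "smooth_near A vector_atlas (\<lambda>x. Dloc a b id x e) p"
    by (rule smooth_near_Dloc[OF A id a b(1)]) (simp add: b)
  show "\<forall>\<^sub>F x in near A p. Dloc a b id x e = coord_vector A a x e b"
    using eventually_near_smooth[OF A id b(1)] b
    by (auto elim!: eventually_mono simp: coord_vector_def)
qed

text \<open>Expanding V in bounded coordinates of the chart a writes the pairing as a finite sum of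
  coordinates of V times values of \<alpha> on coordinate vectors. The values of \<alpha> lie in any
  normed space, so the lemma covers components of tangent maps as well as real covectors.\<close>

lemma smooth_near_pairing:
  fixes A :: "('a, 'e::real_normed_vector) atlas" and B :: "('b, 'f::real_normed_vector) atlas"
    and \<alpha> :: "'b \<Rightarrow> ('a, 'e) tvec \<Rightarrow> 'w::real_normed_vector"
  assumes A: "smooth_manifold A" and B: "smooth_manifold B" and F: "smooth_near B A F x0"
    and a: "a \<in> A" "F x0 \<in> fst a"
    and \<alpha>: "\<forall>\<^sub>F x in near B x0. tangent_linear A (F x) (\<alpha> x)"
    and V: "\<forall>\<^sub>F x in near B x0. V x \<in> tangent_space A (F x)"
    and sV: "smooth_near B vector_atlas (\<lambda>x. V x a) x0"
    and s\<alpha>: "\<And>e. smooth_near B vector_atlas (\<lambda>x. \<alpha> x (coord_vector A a (F x) e)) x0"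
  shows "smooth_near B vector_atlas (\<lambda>x. \<alpha> x (V x)) x0"
proof -
  note ch = smooth_manifold_charts[OF B]
  obtain E :: "'e set" and \<kappa> where E: "finite E" and \<kappa>: "\<And>b. bounded_linear (\<kappa> b)"
    and eq: "\<And>x. x = (\<Sum>b\<in>E. \<kappa> b x *\<^sub>R b)"
    using finite_dim_coordinates[OF charts_finite_dim[OF smooth_manifold_charts[OF A]]] by metis
  have "smooth_near B vector_atlas (\<lambda>x. \<Sum>b\<in>E. \<kappa> b (V x a) *\<^sub>R \<alpha> x (coord_vector A a (F x) b)) x0"
    by (rule smooth_near_sum[OF ch smooth_near_points(1)[OF F]], rule smooth_near_scaleR,
        rule smooth_near_bounded_linear[OF \<kappa> sV], rule s\<alpha>)
  then show ?thesis
  proof (rule smooth_near_cong[OF B])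
    show "\<forall>\<^sub>F x in near B x0. (\<Sum>b\<in>E. \<kappa> b (V x a) *\<^sub>R \<alpha> x (coord_vector A a (F x) b)) = \<alpha> x (V x)"
      using \<alpha> V eventually_near_smooth[OF B F a]
    proof eventually_elim
      case (elim x)
      have lin: "linear (\<lambda>e. \<alpha> x (coord_vector A a (F x) e))"
        by (rule tangent_linear_coord_vector[OF A a(1) elim(3,1)])
      have "\<alpha> x (V x) = \<alpha> x (coord_vector A a (F x) (V x a))"
        using coord_vector_of_tangent[OF A a(1) elim(3,2)] by simp
      also have "\<dots> = \<alpha> x (coord_vector A a (F x) (\<Sum>b\<in>E. \<kappa> b (V x a) *\<^sub>R b))"
        by (simp add: eq[symmetric])
      also have "\<dots> = (\<Sum>b\<in>E. \<kappa> b (V x a) *\<^sub>R \<alpha> x (coord_vector A a (F x) b))"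
        using linear_sum[OF lin, of "\<lambda>b. \<kappa> b (V x a) *\<^sub>R b" E] linear_scale[OF lin] by simp
      finally show ?case by simp
    qed
  qed
qed

text \<open>The d-component of the tangent map of H is a vector-valued covector field along F, so
  the pairing lemma applies; its values on coordinate vectors are directional derivatives of
  H.\<close>

lemma smooth_near_tangent_map:
  assumes A: "smooth_manifold A" and B: "smooth_manifold B" and F: "smooth_near B A F x0"
    and a: "a \<in> A" "F x0 \<in> fst a" and d: "d \<in> C" "H (F x0) \<in> fst d"
    and H: "\<forall>\<^sub>F x in near B x0. smooth_near A C H (F x)"
    and V: "\<forall>\<^sub>F x in near B x0. V x \<in> tangent_space A (F x)"
    and sV: "smooth_near B vector_atlas (\<lambda>x. V x a) x0"
  shows "smooth_near B vector_atlas (\<lambda>x. tangent_map A C H (F x) (V x) d) x0"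
proof (rule smooth_near_pairing[OF A B F a _ V sV])
  show "\<forall>\<^sub>F x in near B x0. tangent_linear A (F x) (\<lambda>v. tangent_map A C H (F x) v d)"
    using H
  proof eventually_elim
    case (elim x)
    then show ?case
      unfolding tangent_linear_def using tangent_map_lincomb[OF A elim] by simp
  qed
  fix e
  have H0: "smooth_near A C H (F x0)"
    using H smooth_near_points(1)[OF F] by (auto simp: eventually_nhdsin topspace_manifold_topology[OF B])
  note ch = smooth_manifold_charts[OF A] smooth_manifold_charts[OF B]
  have "\<forall>\<^sub>F x in near B x0. H (F x) \<in> fst d"
    by (rule eventually_near_smooth[OF B smooth_near_compose[OF ch(2,1) F H0] d])
  then have "\<forall>\<^sub>F x in near B x0. Dloc a d H (F x) e = tangent_map A C H (F x) (coord_vector A a (F x) e) d"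
    using H eventually_near_smooth[OF B F a]
  proof eventually_elim
    case (elim x)
    then show ?case
      using tangent_map_chart[OF A elim(2) coord_vector_tangent_space[OF A a(1) elim(3)] a(1) elim(3) d(1) elim(1)]
      by (simp add: coord_vector_same[OF A a(1) elim(3)])
  qed
  then show "smooth_near B vector_atlas (\<lambda>x. tangent_map A C H (F x) (coord_vector A a (F x) e) d) x0"
    by (rule smooth_near_cong[OF B smooth_near_compose[OF ch(2,1) F smooth_near_Dloc[OF A H0 a d]]])
qed

section \<open>Covector fields along smooth maps, and maps of product manifolds\<close>

lemma covector_field_along_smooth_near:
  assumes B: "smooth_manifold B" and F: "smooth_map B A F" and \<alpha>: "covector_field_along B A F \<alpha>"
    and x: "x \<in> points B" and a: "a \<in> A" "F x \<in> fst a"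
  shows "smooth_near B vector_atlas (\<lambda>x. \<alpha> x (coord_vector A a (F x) e)) x"
  by (rule smooth_near_if_smooth_on_overlap[OF smooth_manifold_charts[OF B] F a x])
     (use \<alpha> a in \<open>simp add: covector_field_along_def\<close>)

lemma covector_field_along_linear:
  "covector_field_along B A F \<alpha> \<Longrightarrow> x \<in> points B \<Longrightarrow> tangent_linear A (F x) (\<alpha> x)"
  by (simp add: covector_field_along_def)

lemma covector_field_alongI:
  assumes B: "smooth_manifold B"
    and lin: "\<And>x. x \<in> points B \<Longrightarrow> tangent_linear A (F x) (\<alpha> x)"
    and sm: "\<And>x a e. x \<in> points B \<Longrightarrow> a \<in> A \<Longrightarrow> F x \<in> fst a \<Longrightarrow>
      smooth_near B vector_atlas (\<lambda>x. \<alpha> x (coord_vector A a (F x) e)) x"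
  shows "covector_field_along B A F \<alpha>"
  unfolding covector_field_along_def
proof (intro conjI ballI allI lin)
  fix b a e assume ba: "b \<in> B" "a \<in> A"
  show "smooth_on (snd b ` (fst b \<inter> F -` fst a)) (\<lambda>y. \<alpha> (param b y) (coord_vector A a (F (param b y)) e))"
    by (rule smooth_on_if_smooth_near[OF smooth_manifold_charts[OF B] ba(1)])
       (use sm ba pointsI[OF ba(1)] in auto)
qed

lemma eventually_near_compose:
  assumes A: "smooth_manifold A" and B: "smooth_manifold B" and F: "smooth_near A B F p"
    and P: "eventually P (near B (F p))"
  shows "\<forall>\<^sub>F x in near A p. P (F x)"
proof -
  obtain c where c: "c \<in> A" "p \<in> fst c" using smooth_near_points(1)[OF F] by (rule pointsE)
  obtain d where d: "d \<in> B" "F p \<in> fst d" using smooth_near_points(2)[OF F] by (rule pointsE)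
  note pc = charts_param[OF smooth_manifold_charts[OF A] c(1)]
    and pd = charts_param[OF smooth_manifold_charts[OF B] d(1)]
  obtain N1 where N1: "open N1" "snd c p \<in> N1" "N1 \<subseteq> snd c ` (fst c \<inter> F -` fst d)" "smooth_on N1 (local_rep c d F)"
    using F c(1) d(1) c(2) d(2) by (rule smooth_nearE)
  obtain N2 where N2: "open N2" "snd d (F p) \<in> N2" "\<And>y. y \<in> N2 \<Longrightarrow> P (param d y)"
    using eventually_near_chartD[OF B d P] by metis
  let ?N = "N1 \<inter> local_rep c d F -` N2"
  have "open ?N"
    using continuous_on_open_vimage[OF N1(1)] smooth_on_continuous[OF N1(4)] N2(1)
    by (auto simp: Int_commute)
  moreover have "snd c p \<in> ?N" using N1 N2 c pc by (simp add: local_rep_def)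
  ultimately show ?thesis
  proof (rule eventually_mono[OF eventually_near_chartI[OF A c]])
    fix x assume x: "x \<in> fst c \<and> snd c x \<in> ?N"
    then have "F x \<in> fst d"
      using N1(3) charts_inj[OF smooth_manifold_charts[OF A] c(1)] by (fastforce simp: inj_on_def)
    moreover have "snd d (F x) \<in> N2" using x pc[of x] by (simp add: local_rep_def)
    ultimately show "P (F x)" using N2(3) pd by fastforce
  qed
qed

lemma openin_vimage_smooth_map:
  assumes A: "smooth_manifold A" and B: "smooth_manifold B" and F: "smooth_map A B F"
    and W: "openin (manifold_topology B) W"
  shows "openin (manifold_topology A) (points A \<inter> F -` W)"
proof (subst openin_subopen, intro ballI)
  fix x assume x: "x \<in> points A \<inter> F -` W"
  have "\<forall>\<^sub>F y in near A x. F y \<in> W"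
    using x by (intro eventually_near_compose[OF A B smooth_map_imp_smooth_near[OF F]] eventually_near_openin[OF W]) auto
  then obtain S where "openin (manifold_topology A) S" "x \<in> S" "\<And>y. y \<in> S \<Longrightarrow> F y \<in> W"
    using x by (auto simp: eventually_nhdsin topspace_manifold_topology[OF A])
  then show "\<exists>T. openin (manifold_topology A) T \<and> x \<in> T \<and> T \<subseteq> points A \<inter> F -` W"
    using openin_subset[of "manifold_topology A" S] by (intro exI[of _ S]) (auto simp: topspace_manifold_topology[OF A])
qed

text \<open>In product coordinates this is the linear projection followed by a coordinate change. It
  extracts the group component from an inverse trivialisation.\<close>

lemma smooth_near_snd:
  fixes A :: "('a, 'e::real_normed_vector) atlas" and B :: "('b, 'f::real_normed_vector) atlas"
  assumes A: "charts A" and B: "smooth_manifold B" and pq: "p \<in> points A" "q \<in> points B"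
  shows "smooth_near (prod_atlas A B) B snd (p, q)"
  unfolding smooth_near_def
proof (intro conjI ballI impI)
  note ch = smooth_manifold_charts[OF B]
  fix g e assume g: "g \<in> prod_atlas A B" "(p, q) \<in> fst g" and e: "e \<in> B" "snd (p, q) \<in> fst e"
  then obtain c d where cd: "c \<in> A" "d \<in> B" "g = (fst c \<times> fst d, map_prod (snd c) (snd d))" "p \<in> fst c" "q \<in> fst d"
    by (auto simp: prod_atlas_def)
  obtain N where N: "open N" "snd d q \<in> N" "N \<subseteq> snd d ` (fst d \<inter> id -` fst e)" "smooth_on N (local_rep d e id)"
    using smooth_nearE[OF smooth_near_id[OF B pq(2)] cd(2) e(1) cd(5)] e(2) by auto
  let ?N = "snd c ` fst c \<times> N"
  have op: "open ?N" using charts_open[OF A cd(1)] N(1) by (rule open_Times)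
  have sub: "\<exists>x z. y = (snd c x, snd d z) \<and> x \<in> fst c \<and> z \<in> fst d \<and> z \<in> fst e" if "y \<in> ?N" for y
    using that N(3) by fastforce
  have "smooth_on ?N (\<lambda>y. local_rep d e id (snd y))"
    by (rule smooth_on_compose[OF charts_finite_dim[OF ch] op
          smooth_on_bounded_linear_compose[OF bounded_linear_snd op smooth_on_id[OF op]] N(4)]) auto
  then have "smooth_on ?N (local_rep g e snd)"
  proof (rule smooth_on_cong[OF op])
    fix y assume "y \<in> ?N"
    then obtain x z where y: "y = (snd c x, snd d z)" "x \<in> fst c" "z \<in> fst d" using sub by blast
    have "param g (snd g (x, z)) = (x, z)"
      using charts_param[OF charts_prod_atlas[OF A ch] g(1), of "(x, z)"] y cd(3) by simp
    then have "param g y = (x, z)" by (simp add: cd(3) y(1))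
    then show "local_rep d e id (snd y) = local_rep g e snd y"
      using charts_param[OF ch cd(2) y(3)] by (simp add: local_rep_def y(1))
  qed
  moreover have "?N \<subseteq> snd g ` (fst g \<inter> snd -` fst e)"
  proof
    fix y assume "y \<in> ?N"
    then obtain x z where "y = (snd c x, snd d z)" "x \<in> fst c" "z \<in> fst d" "z \<in> fst e" using sub by blast
    then show "y \<in> snd g ` (fst g \<inter> snd -` fst e)"
      by (intro image_eqI[of _ _ "(x, z)"]) (simp_all add: cd(3))
  qed
  ultimately show "\<exists>N. open N \<and> snd g (p, q) \<in> N \<and> N \<subseteq> snd g ` (fst g \<inter> snd -` fst e) \<and> smooth_on N (local_rep g e snd)"
    using op N(2) cd by (intro exI[of _ ?N]) auto
qed (use pq in \<open>simp_all add: points_prod_atlas\<close>)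

lemma smooth_near_compose2:
  assumes "charts A" "charts B" "charts C" "smooth_near A B F p" "smooth_near A C H p"
    and "smooth_near (prod_atlas B C) E (\<lambda>(b, c). \<mu> b c) (F p, H p)"
  shows "smooth_near A E (\<lambda>x. \<mu> (F x) (H x)) p"
  using smooth_near_compose[OF assms(1) charts_prod_atlas[OF assms(2,3)] smooth_near_Pair[OF assms(1,4,5)] assms(6)]
  by simp

text \<open>The tangent map in the second variable is the total coordinate derivative in the fixed
  direction \<open>(0, v c)\<close>, evaluated at a point depending smoothly on x.\<close>

lemma smooth_near_partial_derivative:
  fixes B :: "('b, 'f::real_normed_vector) atlas" and C :: "('c, 'h::real_normed_vector) atlas"
  assumes B: "smooth_manifold B" and C: "smooth_manifold C"
    and \<mu>: "\<forall>\<^sub>F x in near B p. smooth_near (prod_atlas B C) E (\<lambda>(b, c). \<mu> b c) (x, q)"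
    and p: "p \<in> points B" and e: "e \<in> E" "\<mu> p q \<in> fst e" and v: "v \<in> tangent_space C q"
  shows "smooth_near B vector_atlas (\<lambda>x. tangent_map C E (\<mu> x) q v e) p"
proof -
  let ?m = "\<lambda>(b, c). \<mu> b c"
  have \<mu>0: "smooth_near (prod_atlas B C) E ?m (p, q)"
    using \<mu> p by (auto simp: eventually_nhdsin topspace_manifold_topology[OF B])
  note chB = smooth_manifold_charts[OF B] and chC = smooth_manifold_charts[OF C]
  note chBC = charts_prod_atlas[OF chB chC]
  have q: "q \<in> points C" using smooth_near_points(1)[OF \<mu>0] by (simp add: points_prod_atlas)
  obtain b where b: "b \<in> B" "p \<in> fst b" using p by (rule pointsE)
  obtain c where c: "c \<in> C" "q \<in> fst c" using q by (rule pointsE)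
  let ?bc = "(fst b \<times> fst c, map_prod (snd b) (snd c))"
  have bc: "?bc \<in> prod_atlas B C" "(p, q) \<in> fst ?bc"
    using b c prod_atlas_chart[OF b(1) c(1)] by simp_all
  obtain N where N: "open N" "snd ?bc (p, q) \<in> N" "smooth_on N (local_rep ?bc e ?m)"
    using smooth_nearE[OF \<mu>0 bc(1) e(1) bc(2)] e(2) by auto
  let ?D = "\<lambda>y. frechet_derivative (local_rep ?bc e ?m) (at y) (0, v c)"
  \<comment> \<open>The inclusion is affine in the coordinates of x: a linear part plus a
    constant.\<close>
  have "smooth_near B vector_atlas (\<lambda>x. (snd b x, 0) + (0 :: 'f, snd c q)) p"
    by (intro smooth_near_add smooth_near_const[OF chB p]
        smooth_near_bounded_linear[OF bounded_linear_Pair[OF bounded_linear_ident bounded_linear_zero]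
          smooth_near_coordinate[OF B b]]) simp
  then have *: "smooth_near B vector_atlas (\<lambda>x. (snd b x, snd c q)) p" by simp
  have fd: "finite_dim TYPE('f \<times> 'h)" by (rule charts_finite_dim[OF chBC])
  have D: "smooth_near vector_atlas vector_atlas ?D (snd b p, snd c q)"
    by (rule smooth_near_vector_vector[OF N(1) _ smooth_on_frechet_derivative[OF N(3)]]) (use N(2) in simp)
  have "smooth_near B vector_atlas (\<lambda>x. ?D (snd b x, snd c q)) p"
    by (rule smooth_near_compose[OF chB charts_vector_atlas[OF fd] * D])
  then show ?thesis
  proof (rule smooth_near_cong[OF B])
    have idB: "smooth_near B B id p" by (rule smooth_near_id[OF B p])
    have "smooth_near B E (\<lambda>x. \<mu> x q) p"
      using Dloc_partial_left(1)[OF B C \<mu>0 b c e(1)] e(2) by simp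
    from eventually_near_smooth[OF B this e]
    have "\<forall>\<^sub>F x in near B p. \<mu> x q \<in> fst e" .
    moreover have "\<forall>\<^sub>F x in near B p. x \<in> fst b"
      using eventually_near_smooth[OF B idB b(1)] b(2) by simp
    ultimately show "\<forall>\<^sub>F x in near B p. ?D (snd b x, snd c q) = tangent_map C E (\<mu> x) q v e"
      using \<mu>
    proof eventually_elim
      case (elim x)
      have m: "(\<lambda>(b, c). \<mu> b c) (x, q) \<in> fst e" using elim(1) by simp
      note right = Dloc_partial_right[OF B C elim(3) b(1) elim(2) c e(1) m]
      show ?case
        using tangent_map_chart[OF C right(1) v c e(1)] elim(1) right(2)[of "v c"] by simp
    qed
  qed
qed

section \<open>Principal bundles\<close>

locale principal_lie_bundle =
  fixes G :: "('g, 'eg::real_normed_vector) lie_group_data"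
    and P :: "('p, 'ep::real_normed_vector, 'm, 'em::real_normed_vector, 'g) pbundle"
  assumes lie: "lie_group G" and principal: "principal_bundle G P"
begin

abbreviation "TP \<equiv> total_atlas P"
abbreviation "MP \<equiv> base_atlas P"
abbreviation "GA \<equiv> group_atlas G"

lemma group: "Group.group G" and manifold_group: "smooth_manifold GA"
  and carrier_points: "carrier G = points GA"
  using lie by (auto simp: lie_group_def)

lemma manifold_total: "smooth_manifold TP" and manifold_base: "smooth_manifold MP"
  and smooth_map_proj: "smooth_map TP MP (proj P)"
  and smooth_map_action: "smooth_map (prod_atlas TP GA) TP (\<lambda>(p, g). act P p g)"
  using principal unfolding principal_bundle_def by blast+

lemma charts_total: "charts TP" and charts_base: "charts MP" and charts_group: "charts GA"
  by (simp_all add: smooth_manifold_charts manifold_total manifold_base manifold_group)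

lemma act_one: "p \<in> points TP \<Longrightarrow> act P p \<one>\<^bsub>G\<^esub> = p"
  and proj_act: "p \<in> points TP \<Longrightarrow> g \<in> carrier G \<Longrightarrow> proj P (act P p g) = proj P p"
  and act_act: "p \<in> points TP \<Longrightarrow> g \<in> carrier G \<Longrightarrow> h \<in> carrier G \<Longrightarrow>
    act P (act P p g) h = act P p (g \<otimes>\<^bsub>G\<^esub> h)"
  using principal unfolding principal_bundle_def by blast+

lemma one_carrier: "\<one>\<^bsub>G\<^esub> \<in> carrier G"
  by (rule monoid.one_closed[OF group.is_monoid[OF group]])

lemma one_points: "\<one>\<^bsub>G\<^esub> \<in> points GA"
  using one_carrier carrier_points by simp

lemma inv_carrier: "g \<in> carrier G \<Longrightarrow> inv\<^bsub>G\<^esub> g \<in> carrier G"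
  by (rule group.inv_closed[OF group])

lemma smooth_near_action:
  "p \<in> points TP \<Longrightarrow> g \<in> carrier G \<Longrightarrow> smooth_near (prod_atlas TP GA) TP (\<lambda>(p, g). act P p g) (p, g)"
  using smooth_map_imp_smooth_near[OF smooth_map_action] by (simp add: points_prod_atlas carrier_points)

lemma act_points: "p \<in> points TP \<Longrightarrow> g \<in> carrier G \<Longrightarrow> act P p g \<in> points TP"
  using smooth_near_points(2)[OF smooth_near_action] by simp

lemma proj_points: "p \<in> points TP \<Longrightarrow> proj P p \<in> points MP"
  using smooth_near_points(2)[OF smooth_map_imp_smooth_near[OF smooth_map_proj]] by simp

lemma smooth_near_proj: "p \<in> points TP \<Longrightarrow> smooth_near TP MP (proj P) p"
  by (rule smooth_map_imp_smooth_near[OF smooth_map_proj])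

lemma smooth_near_ident_total: "p \<in> points TP \<Longrightarrow> smooth_near TP TP (\<lambda>x. x) p"
  using smooth_near_id[OF manifold_total] by (simp add: id_def)

lemma smooth_near_ident_group: "g \<in> carrier G \<Longrightarrow> smooth_near GA GA (\<lambda>x. x) g"
  using smooth_near_id[OF manifold_group] by (simp add: id_def carrier_points)

lemma smooth_near_const_group: "charts A \<Longrightarrow> x \<in> points A \<Longrightarrow> g \<in> carrier G \<Longrightarrow> smooth_near A GA (\<lambda>_. g) x"
  by (simp add: smooth_near_const carrier_points)

lemma smooth_near_act: "p \<in> points TP \<Longrightarrow> g \<in> carrier G \<Longrightarrow> smooth_near TP TP (\<lambda>p. act P p g) p"
  by (rule smooth_near_compose2[OF charts_total charts_total charts_group smooth_near_ident_total
        smooth_near_const_group[OF charts_total] smooth_near_action])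

lemma smooth_near_orbit: "p \<in> points TP \<Longrightarrow> g \<in> carrier G \<Longrightarrow> smooth_near GA TP (act P p) g"
  by (rule smooth_near_compose2[OF charts_group charts_total charts_group
        smooth_near_const[OF charts_group] smooth_near_ident_group smooth_near_action])
     (simp_all add: carrier_points)

lemma smooth_near_group_mult:
  assumes "charts A" "smooth_near A GA f x" "smooth_near A GA h x"
  shows "smooth_near A GA (\<lambda>x. f x \<otimes>\<^bsub>G\<^esub> h x) x"
proof (rule smooth_near_compose2[OF assms(1) charts_group charts_group assms(2,3)])
  show "smooth_near (prod_atlas GA GA) GA (\<lambda>(g, h). g \<otimes>\<^bsub>G\<^esub> h) (f x, h x)"
    using lie smooth_near_points(2)[OF assms(2)] smooth_near_points(2)[OF assms(3)]
    by (intro smooth_map_imp_smooth_near) (auto simp: lie_group_def points_prod_atlas)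
qed

lemma smooth_near_conjugation:
  assumes "g \<in> carrier G" "h \<in> carrier G"
  shows "smooth_near GA GA (\<lambda>h. g \<otimes>\<^bsub>G\<^esub> h \<otimes>\<^bsub>G\<^esub> inv\<^bsub>G\<^esub> g) h"
  using assms carrier_points
  by (intro smooth_near_group_mult charts_group smooth_near_const_group smooth_near_ident_group inv_carrier) auto

lemma conjugation_one: "g \<in> carrier G \<Longrightarrow> g \<otimes>\<^bsub>G\<^esub> \<one>\<^bsub>G\<^esub> \<otimes>\<^bsub>G\<^esub> inv\<^bsub>G\<^esub> g = \<one>\<^bsub>G\<^esub>"
  by (simp add: monoid.r_one[OF group.is_monoid[OF group]] group.r_inv[OF group])

lemma eventually_near_total: "\<forall>\<^sub>F x in near TP p. x \<in> points TP"
  by (rule eventually_near_points[OF manifold_total])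

lemma eventually_near_group: "\<forall>\<^sub>F h in near GA g. h \<in> carrier G"
  using eventually_near_points[OF manifold_group] by (simp add: carrier_points)

lemma Ad_lie_algebra: "g \<in> carrier G \<Longrightarrow> \<xi> \<in> lie_algebra G \<Longrightarrow> Ad G g \<xi> \<in> lie_algebra G"
  using tangent_map_tangent_space[OF manifold_group manifold_group smooth_near_conjugation[OF _ one_carrier], of g \<xi>]
  by (simp add: Ad_def lie_algebra_def conjugation_one)

text \<open>Conjugations by g and by its inverse cancel on the group; the chain rule at the identity
  gives the claim. It reconciles the \<open>Ad G g\<close> in the law for o^*-valued functions with
  the inverse in the law for connections.\<close>

lemma Ad_Ad_inv:
  assumes g: "g \<in> carrier G" and \<xi>: "\<xi> \<in> lie_algebra G"
  shows "Ad G g (Ad G (inv\<^bsub>G\<^esub> g) \<xi>) = \<xi>"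
proof -
  interpret Group.group G by (rule group)
  let ?c = "\<lambda>g h. g \<otimes>\<^bsub>G\<^esub> h \<otimes>\<^bsub>G\<^esub> inv\<^bsub>G\<^esub> g"
  have ig: "inv\<^bsub>G\<^esub> g \<in> carrier G" using g by simp
  have \<xi>': "\<xi> \<in> tangent_space GA \<one>\<^bsub>G\<^esub>" using \<xi> by (simp add: lie_algebra_def)
  have sm: "smooth_near GA GA (?c g) (?c (inv\<^bsub>G\<^esub> g) \<one>\<^bsub>G\<^esub>)"
    using smooth_near_conjugation[OF g one_carrier] ig by (simp add: conjugation_one del: r_one inv_inv)
  have "Ad G g (Ad G (inv\<^bsub>G\<^esub> g) \<xi>) = tangent_map GA GA (\<lambda>h. ?c g (?c (inv\<^bsub>G\<^esub> g) h)) \<one>\<^bsub>G\<^esub> \<xi>"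
    using tangent_map_compose[OF manifold_group manifold_group smooth_near_conjugation[OF ig one_carrier] sm \<xi>'] 
      conjugation_one[OF ig]
    by (simp add: Ad_def del: r_one inv_inv)
  also have "\<dots> = tangent_map GA GA id \<one>\<^bsub>G\<^esub> \<xi>"
  proof (rule tangent_map_cong[OF manifold_group smooth_near_compose[OF charts_group charts_group smooth_near_conjugation[OF ig one_carrier] sm] _ \<xi>'])
    show "\<forall>\<^sub>F h in near GA \<one>\<^bsub>G\<^esub>. ?c g (?c (inv\<^bsub>G\<^esub> g) h) = id h"
      using eventually_near_group
    proof (rule eventually_mono)
      fix h assume h: "h \<in> carrier G"
      have "g \<otimes>\<^bsub>G\<^esub> (inv\<^bsub>G\<^esub> g \<otimes>\<^bsub>G\<^esub> h) = h"
        using g ig h m_assoc[of g "inv\<^bsub>G\<^esub> g" h] by simp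
      then show "?c g (?c (inv\<^bsub>G\<^esub> g) h) = id h" using g ig h by (simp add: m_assoc)
    qed
  qed
  also have "\<dots> = \<xi>" by (rule tangent_map_id[OF manifold_group one_points \<xi>'])
  finally show ?thesis .
qed

section \<open>The tangent action and fundamental vector fields\<close>

lemma act_tangent_space:
  "p \<in> points TP \<Longrightarrow> g \<in> carrier G \<Longrightarrow> u \<in> tangent_space TP p \<Longrightarrow>
    act_tangent P g p u \<in> tangent_space TP (act P p g)"
  unfolding act_tangent_def
  by (rule tangent_map_tangent_space[OF manifold_total manifold_total smooth_near_act])

lemma proj_tangent_space:
  "p \<in> points TP \<Longrightarrow> u \<in> tangent_space TP p \<Longrightarrow> proj_tangent P p u \<in> tangent_space MP (proj P p)"
  unfolding proj_tangent_def
  by (rule tangent_map_tangent_space[OF manifold_total manifold_base smooth_near_proj])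

text \<open>Differentiate \<pi>(x g) = \<pi>(x) with respect to x.\<close>

lemma proj_act_tangent:
  assumes p: "p \<in> points TP" and g: "g \<in> carrier G" and u: "u \<in> tangent_space TP p"
  shows "proj_tangent P (act P p g) (act_tangent P g p u) = proj_tangent P p u"
  unfolding proj_tangent_def act_tangent_def
proof (subst tangent_map_compose[OF manifold_total manifold_total smooth_near_act[OF p g] smooth_near_proj u, symmetric])
  show "act P p g \<in> points TP" using p g by (rule act_points)
  show "tangent_map TP MP (\<lambda>x. proj P (act P x g)) p u = tangent_map TP MP (proj P) p u"
    by (rule sym, rule tangent_map_cong[OF manifold_total smooth_near_proj[OF p] _ u],
        rule eventually_mono[OF eventually_near_total]) (simp add: proj_act g)
qed

lemma proj_tangent_diff:
  assumes "p \<in> points TP" "u \<in> tangent_space TP p" "v \<in> tangent_space TP p"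
  shows "proj_tangent P p (\<lambda>c. u c - v c) = (\<lambda>c. proj_tangent P p u c - proj_tangent P p v c)"
  unfolding proj_tangent_def by (rule tangent_map_diff[OF manifold_total smooth_near_proj]) (use assms in auto)

lemma fundamental_field_tangent_space:
  assumes "p \<in> points TP" "\<xi> \<in> lie_algebra G"
  shows "fundamental_field G P \<xi> p \<in> tangent_space TP p"
  using tangent_map_tangent_space[OF manifold_group manifold_total smooth_near_orbit[OF assms(1) one_carrier], of \<xi>] assms
  by (simp add: act_one fundamental_field_def lie_algebra_def)

lemma fundamental_field_lincomb:
  assumes "p \<in> points TP" "\<xi> \<in> lie_algebra G" "\<eta> \<in> lie_algebra G"
  shows "fundamental_field G P (\<lambda>c. a *\<^sub>R \<xi> c + b *\<^sub>R \<eta> c) p =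
    (\<lambda>c. a *\<^sub>R fundamental_field G P \<xi> p c + b *\<^sub>R fundamental_field G P \<eta> p c)"
  unfolding fundamental_field_def
  by (rule tangent_map_lincomb[OF manifold_group smooth_near_orbit[OF assms(1) one_carrier]])
     (use assms in \<open>simp_all add: lie_algebra_def\<close>)

lemma fundamental_field_zero:
  "p \<in> points TP \<Longrightarrow> fundamental_field G P (\<lambda>_. 0) p = (\<lambda>_. 0)"
  unfolding fundamental_field_def by (rule tangent_map_zero[OF manifold_group smooth_near_orbit[OF _ one_carrier]])

text \<open>The orbit map followed by \<pi> is constant on the group.\<close>

lemma proj_fundamental_field:
  assumes p: "p \<in> points TP" and \<xi>: "\<xi> \<in> lie_algebra G"
  shows "proj_tangent P p (fundamental_field G P \<xi> p) = (\<lambda>_. 0)"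
proof -
  have \<xi>': "\<xi> \<in> tangent_space GA \<one>\<^bsub>G\<^esub>" using \<xi> by (simp add: lie_algebra_def)
  note orb = smooth_near_orbit[OF p one_carrier]
  have pr: "smooth_near TP MP (proj P) (act P p \<one>\<^bsub>G\<^esub>)"
    using smooth_near_proj[OF p] by (simp add: act_one p)
  have "proj_tangent P p (fundamental_field G P \<xi> p) = tangent_map GA MP (\<lambda>g. proj P (act P p g)) \<one>\<^bsub>G\<^esub> \<xi>"
    using tangent_map_compose[OF manifold_group manifold_total orb pr \<xi>']
    by (simp add: proj_tangent_def fundamental_field_def act_one p)
  also have "\<dots> = tangent_map GA MP (\<lambda>_. proj P p) \<one>\<^bsub>G\<^esub> \<xi>"
    by (rule tangent_map_cong[OF manifold_group smooth_near_compose[OF charts_group charts_total orb pr] _ \<xi>'],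
        rule eventually_mono[OF eventually_near_group]) (simp add: proj_act p)
  also have "\<dots> = (\<lambda>_. 0)"
    by (rule tangent_map_const[OF manifold_group one_points proj_points[OF p] \<xi>'])
  finally show ?thesis .
qed

text \<open>Differentiate \<open>p g h = (p (g h g\<^sup>-\<^sup>1)) g\<close> with respect to \<open>h\<close> at the identity.\<close>

lemma fundamental_field_act:
  assumes p: "p \<in> points TP" and g: "g \<in> carrier G" and \<xi>: "\<xi> \<in> lie_algebra G"
  shows "fundamental_field G P \<xi> (act P p g) = act_tangent P g p (fundamental_field G P (Ad G g \<xi>) p)"
proof -
  interpret Group.group G by (rule group)
  let ?c = "\<lambda>h. g \<otimes>\<^bsub>G\<^esub> h \<otimes>\<^bsub>G\<^esub> inv\<^bsub>G\<^esub> g"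
  have \<xi>': "\<xi> \<in> tangent_space GA \<one>\<^bsub>G\<^esub>" using \<xi> by (simp add: lie_algebra_def)
  note cj = smooth_near_conjugation[OF g one_carrier]
  have orb: "smooth_near GA TP (act P p) (?c \<one>\<^bsub>G\<^esub>)"
    using smooth_near_orbit[OF p one_carrier] by (simp add: conjugation_one g del: r_one)
  note orb_cj = smooth_near_compose[OF charts_group charts_group cj orb]
  have a: "smooth_near TP TP (\<lambda>p. act P p g) (act P p (?c \<one>\<^bsub>G\<^esub>))"
    using smooth_near_act[OF p g] by (simp add: conjugation_one g act_one p del: r_one)
  have "act_tangent P g p (fundamental_field G P (Ad G g \<xi>) p) =
      tangent_map TP TP (\<lambda>p. act P p g) (act P p (?c \<one>\<^bsub>G\<^esub>)) (tangent_map GA TP (\<lambda>h. act P p (?c h)) \<one>\<^bsub>G\<^esub> \<xi>)"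
    using tangent_map_compose[OF manifold_group manifold_group cj orb \<xi>']
    by (simp add: act_tangent_def fundamental_field_def Ad_def conjugation_one g act_one p del: r_one)
  also have "\<dots> = tangent_map GA TP (\<lambda>h. act P (act P p (?c h)) g) \<one>\<^bsub>G\<^esub> \<xi>"
    using tangent_map_compose[OF manifold_group manifold_total orb_cj a \<xi>'] by simp
  also have "\<dots> = fundamental_field G P \<xi> (act P p g)"
    unfolding fundamental_field_def
  proof (rule tangent_map_cong[OF manifold_group smooth_near_compose[OF charts_group charts_total orb_cj a] _ \<xi>'],
      rule eventually_mono[OF eventually_near_group])
    fix h assume h: "h \<in> carrier G"
    then show "act P (act P p (?c h)) g = act P (act P p g) h"
      using p g by (simp add: act_act m_assoc)
  qed
  finally show ?thesis by simp
qed

text \<open>A fundamental field is the partial derivative of the action in the group variable, at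
  the identity.\<close>

lemma smooth_near_fundamental_field:
  assumes p: "p \<in> points TP" and d: "d \<in> TP" "p \<in> fst d" and \<xi>: "\<xi> \<in> lie_algebra G"
  shows "smooth_near TP vector_atlas (\<lambda>p. fundamental_field G P \<xi> p d) p"
  unfolding fundamental_field_def
proof (rule smooth_near_partial_derivative[OF manifold_total manifold_group _ p d(1)])
  show "\<forall>\<^sub>F x in near TP p. smooth_near (prod_atlas TP GA) TP (\<lambda>(p, g). act P p g) (x, \<one>\<^bsub>G\<^esub>)"
    using eventually_near_total by (rule eventually_mono) (rule smooth_near_action[OF _ one_carrier])
qed (use d \<xi> p in \<open>simp_all add: act_one lie_algebra_def\<close>)

text \<open>A local trivialisation is normalised at p. If g0 is the group component of p, then
  \<sigma> is the slice of the trivialisation at g0, so it passes through p, and k is the group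
  component multiplied on the left by the inverse of g0. Then k is the identity at p, so that its
  derivative there takes values in the Lie algebra.\<close>

lemma local_section:
  assumes p: "p \<in> points TP"
  obtains W \<sigma> k where "openin (manifold_topology MP) W" "proj P p \<in> W" "\<sigma> (proj P p) = p"
    "\<And>n. n \<in> W \<Longrightarrow> smooth_near MP TP \<sigma> n" "\<And>n. n \<in> W \<Longrightarrow> proj P (\<sigma> n) = n"
    "smooth_near TP GA k p" "k p = \<one>\<^bsub>G\<^esub>"
    "\<And>x. x \<in> points TP \<Longrightarrow> proj P x \<in> W \<Longrightarrow> k x \<in> carrier G \<and> act P (\<sigma> (proj P x)) (k x) = x"
proof -
  interpret Group.group G by (rule group)
  define m where "m = proj P p"
  have m: "m \<in> points MP" using proj_points[OF p] by (simp add: m_def)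
  obtain W \<tau> where W: "openin (manifold_topology MP) W" "m \<in> W"
    and diff: "diffeomorphism (prod_atlas (restrict_atlas MP W) GA) (restrict_atlas TP (proj P -` W)) \<tau>"
    and \<tau>: "\<And>n g. n \<in> W \<Longrightarrow> g \<in> carrier G \<Longrightarrow> proj P (\<tau> (n, g)) = n"
      "\<And>n g h. n \<in> W \<Longrightarrow> g \<in> carrier G \<Longrightarrow> h \<in> carrier G \<Longrightarrow> \<tau> (n, g \<otimes>\<^bsub>G\<^esub> h) = act P (\<tau> (n, g)) h"
    using principal m unfolding principal_bundle_def by metis
  \<comment> \<open>The preimage of W under \<open>proj P\<close> may contain elements of the type
    outside the total space. Cutting them off leaves the restricted atlas unchanged and gives an
    open set.\<close>
  define V where "V = points TP \<inter> proj P -` W"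
  have "fst c \<inter> proj P -` W = fst c \<inter> V" if "c \<in> TP" for c
    using pointsI[OF that] by (auto simp: V_def)
  then have TV: "restrict_atlas TP (proj P -` W) = restrict_atlas TP V"
    by (auto simp: restrict_atlas_def)
  have V: "openin (manifold_topology TP) V"
    unfolding V_def by (rule openin_vimage_smooth_map[OF manifold_total manifold_base smooth_map_proj W(1)])
  let ?MW = "restrict_atlas MP W" and ?TV = "restrict_atlas TP V"
  have WM: "W \<subseteq> points MP"
    using W(1) by (simp add: openin_manifold_topology[OF manifold_base])
  have pts: "points (prod_atlas ?MW GA) = W \<times> carrier G" "points ?TV = V"
    using WM by (auto simp: points_prod_atlas points_restrict_atlas carrier_points V_def)
  note chMW = charts_restrict_atlas[OF manifold_base W(1)] and chTV = charts_restrict_atlas[OF manifold_total V]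
  note chMG = charts_prod_atlas[OF chMW charts_group]
  obtain H where sm\<tau>: "smooth_map (prod_atlas ?MW GA) ?TV \<tau>" and smH: "smooth_map ?TV (prod_atlas ?MW GA) H"
    and \<tau>H: "\<And>y. y \<in> V \<Longrightarrow> \<tau> (H y) = y"
    using diff unfolding TV diffeomorphism_def pts by blast
  have pV: "p \<in> V" using p W(2) by (simp add: V_def m_def)
  \<comment> \<open>The trivialisation covers the identity of W, so the first component of its
    inverse is the projection.\<close>
  have H: "fst (H y) = proj P y \<and> snd (H y) \<in> carrier G" if "y \<in> V" for y
  proof -
    have "H y \<in> W \<times> carrier G"
      using smH that unfolding smooth_map_def pts by blast
    then show ?thesis using \<tau>(1)[of "fst (H y)" "snd (H y)"] \<tau>H[OF that] by auto
  qed
  define g0 where "g0 = snd (H p)"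
  have g0: "g0 \<in> carrier G" using H[OF pV] by (simp add: g0_def)
  define \<sigma> where "\<sigma> n = \<tau> (n, g0)" for n
  define k where "k x = inv\<^bsub>G\<^esub> g0 \<otimes>\<^bsub>G\<^esub> snd (H x)" for x
  show thesis
  proof (rule that[of W \<sigma> k])
    show "openin (manifold_topology MP) W" by (rule W(1))
    show "proj P p \<in> W" using W(2) by (simp add: m_def)
    have "H p = (proj P p, g0)" using H[OF pV] by (simp add: g0_def prod_eq_iff)
    then show "\<sigma> (proj P p) = p" using \<tau>H[OF pV] by (simp add: \<sigma>_def)
    show "proj P (\<sigma> n) = n" if "n \<in> W" for n using \<tau>(1)[OF that g0] by (simp add: \<sigma>_def)
    show "smooth_near MP TP \<sigma> n" if n: "n \<in> W" for n
    proof -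
      have 1: "smooth_near MP (prod_atlas ?MW GA) (\<lambda>n. (id n, g0)) n"
        using WM n by (intro smooth_near_Pair charts_base smooth_near_restrict(1)[OF manifold_base W(1)]
            smooth_near_const_group g0) auto
      have 2: "smooth_near (prod_atlas ?MW GA) ?TV \<tau> (id n, g0)"
        using n g0 pts by (intro smooth_map_imp_smooth_near sm\<tau>) auto
      have 3: "smooth_near MP ?TV (\<lambda>n. \<tau> (id n, g0)) n"
        by (rule smooth_near_compose[OF charts_base chMG 1 2])
      have "\<tau> (id n, g0) \<in> V" using smooth_near_points(2)[OF 3] pts(2) by simp
      from smooth_near_compose[OF charts_base chTV 3 smooth_near_restrict(2)[OF manifold_total V this]]
      show ?thesis by (simp add: \<sigma>_def[abs_def])
    qed
    show "k p = \<one>\<^bsub>G\<^esub>" using g0 by (simp add: k_def g0_def)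
    show "k x \<in> carrier G \<and> act P (\<sigma> (proj P x)) (k x) = x" if x: "x \<in> points TP" "proj P x \<in> W" for x
    proof
      have xV: "x \<in> V" using x by (simp add: V_def)
      show k: "k x \<in> carrier G" using H[OF xV] g0 by (simp add: k_def)
      have "act P (\<sigma> (proj P x)) (k x) = \<tau> (proj P x, g0 \<otimes>\<^bsub>G\<^esub> k x)"
        using \<tau>(2)[OF x(2) g0 k] by (simp add: \<sigma>_def)
      also have "g0 \<otimes>\<^bsub>G\<^esub> k x = snd (H x)"
        using g0 H[OF xV] by (simp add: k_def m_assoc[symmetric])
      also have "\<tau> (proj P x, snd (H x)) = \<tau> (H x)" using H[OF xV] by (metis prod.collapse)
      finally show "act P (\<sigma> (proj P x)) (k x) = x" using \<tau>H[OF xV] by simp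
    qed
    have 1: "smooth_near TP (prod_atlas ?MW GA) (\<lambda>x. H (id x)) p"
      using pV pts by (intro smooth_near_compose[OF charts_total chTV smooth_near_restrict(1)[OF manifold_total V pV]]
            smooth_map_imp_smooth_near smH) auto
    have "H p \<in> W \<times> carrier G" using smooth_near_points(2)[OF 1] pts by simp
    then have "smooth_near (prod_atlas ?MW GA) GA snd (fst (H p), snd (H p))"
      using WM by (intro smooth_near_snd chMW manifold_group) (auto simp: points_restrict_atlas carrier_points)
    then have "smooth_near TP GA (\<lambda>x. snd (H (id x))) p"
      by (intro smooth_near_compose[OF charts_total chMG 1]) simp
    then show "smooth_near TP GA k p"
      using smooth_near_group_mult[OF charts_total smooth_near_const_group[OF charts_total p inv_carrier[OF g0]]]
      by (simp add: k_def[abs_def])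
  qed
qed

end

section \<open>Fibres, descent to the base and vertical vectors\<close>

context principal_lie_bundle
begin

text \<open>The local section through p has value p at \<pi>(x), so k(x) is an element that moves p
  to x.\<close>

lemma fibre_transitive:
  assumes p: "p \<in> points TP" and x: "x \<in> points TP" and eq: "proj P x = proj P p"
  obtains g where "g \<in> carrier G" "x = act P p g"
proof -
  obtain W \<sigma> k where s: "proj P p \<in> W" "\<sigma> (proj P p) = p"
    "\<And>x. x \<in> points TP \<Longrightarrow> proj P x \<in> W \<Longrightarrow> k x \<in> carrier G \<and> act P (\<sigma> (proj P x)) (k x) = x"
    using local_section[OF p] by metis
  then show thesis using that[of "k x"] s(3)[OF x] eq by simp
qed

text \<open>A trivialisation sends (m, 1) into the fibre over m. Hence statements on the base can be
  checked at points of the total space.\<close>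

lemma points_base_obtain:
  assumes m: "m \<in> points MP"
  obtains p where "p \<in> points TP" "proj P p = m"
proof -
  obtain W \<tau> where W: "m \<in> W"
    and diff: "diffeomorphism (prod_atlas (restrict_atlas MP W) GA) (restrict_atlas TP (proj P -` W)) \<tau>"
    and \<tau>: "\<And>n g. n \<in> W \<Longrightarrow> g \<in> carrier G \<Longrightarrow> proj P (\<tau> (n, g)) = n"
    using principal m unfolding principal_bundle_def by metis
  have "(m, \<one>\<^bsub>G\<^esub>) \<in> points (prod_atlas (restrict_atlas MP W) GA)"
    using m W one_points by (simp add: points_prod_atlas points_restrict_atlas)
  then have "\<tau> (m, \<one>\<^bsub>G\<^esub>) \<in> points (restrict_atlas TP (proj P -` W))"
    using diff unfolding diffeomorphism_def smooth_map_def by blast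
  then show thesis
    using that[of "\<tau> (m, \<one>\<^bsub>G\<^esub>)"] \<tau>[OF W one_carrier] by (simp add: points_restrict_atlas)
qed

text \<open>By transitivity, invariance at the single point p makes f constant on the whole fibre,
  so the description in \<open>descend\<close> has f p as its unique solution.\<close>

lemma descend_eq:
  assumes p: "p \<in> points TP" and inv: "\<And>g. g \<in> carrier G \<Longrightarrow> f (act P p g) = f p"
  shows "descend P f (proj P p) = f p"
  unfolding descend_def
proof (rule the_equality)
  show "\<forall>x\<in>points TP. proj P x = proj P p \<longrightarrow> f x = f p"
  proof (intro ballI impI)
    fix x assume "x \<in> points TP" "proj P x = proj P p"
    then obtain g where "g \<in> carrier G" "x = act P p g" using fibre_transitive[OF p] by metis
    then show "f x = f p" using inv by simp
  qed
qed (use p in blast)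

text \<open>The product rule applied to \<open>x = \<sigma>(\<pi>(x)) k(x)\<close> splits a tangent vector at \<open>p\<close> into its
  component along the section and a vertical one.\<close>

lemma vertical_is_fundamental:
  assumes p: "p \<in> points TP" and u: "u \<in> tangent_space TP p" and v: "proj_tangent P p u = (\<lambda>_. 0)"
  obtains \<xi> where "\<xi> \<in> lie_algebra G" "u = fundamental_field G P \<xi> p"
proof -
  obtain W \<sigma> k where s: "openin (manifold_topology MP) W" "proj P p \<in> W" "\<sigma> (proj P p) = p"
    "\<And>n. n \<in> W \<Longrightarrow> smooth_near MP TP \<sigma> n" "\<And>n. n \<in> W \<Longrightarrow> proj P (\<sigma> n) = n"
    "smooth_near TP GA k p" "k p = \<one>\<^bsub>G\<^esub>"
    "\<And>x. x \<in> points TP \<Longrightarrow> proj P x \<in> W \<Longrightarrow> k x \<in> carrier G \<and> act P (\<sigma> (proj P x)) (k x) = x"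
    using local_section[OF p] by metis
  let ?s = "\<lambda>x. \<sigma> (proj P x)" and ?\<xi> = "tangent_map TP GA k p u"
  have \<sigma>: "smooth_near MP TP \<sigma> (proj P p)" by (rule s(4)[OF s(2)])
  have sp: "smooth_near TP TP ?s p"
    by (rule smooth_near_compose[OF charts_total charts_base smooth_near_proj[OF p] \<sigma>])
  have a: "smooth_near (prod_atlas TP GA) TP (\<lambda>(p, g). act P p g) (?s p, k p)"
    using smooth_near_action[OF p one_carrier] s(3,7) by simp
  have W: "\<forall>\<^sub>F x in near TP p. proj P x \<in> W"
    by (rule eventually_near_compose[OF manifold_total manifold_base smooth_near_proj[OF p]])
       (rule eventually_near_openin[OF s(1,2)])
  have "\<forall>\<^sub>F x in near TP p. act P (?s x) (k x) = x"
    using W eventually_near_total by eventually_elim (use s(8) in blast)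
  then have "u = tangent_map TP TP (\<lambda>x. act P (?s x) (k x)) p u"
    using tangent_map_cong[OF manifold_total smooth_near_compose2[OF charts_total charts_total charts_group sp s(6) a], of id u]
      tangent_map_id[OF manifold_total p u] u by simp
  also have "\<dots> = (\<lambda>e. tangent_map TP TP (\<lambda>b. act P b (k p)) (?s p) (tangent_map TP TP ?s p u) e +
      tangent_map GA TP (act P (?s p)) (k p) ?\<xi> e)"
    using tangent_map_Pair[OF manifold_total manifold_total manifold_group sp s(6) a u] by simp
  \<comment> \<open>The section part factors through T\<pi>, which kills u. There remains the
    derivative of the orbit map of p at \<open>k p\<close>, which is the identity, applied to
    \<open>?\<xi>\<close>.\<close>
  also have "tangent_map TP TP ?s p u = (\<lambda>_. 0)"
    using tangent_map_compose[OF manifold_total manifold_base smooth_near_proj[OF p] \<sigma> u] v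
      tangent_map_zero[OF manifold_base \<sigma>]
    by (simp add: proj_tangent_def)
  also have "tangent_map TP TP (\<lambda>b. act P b (k p)) (?s p) (\<lambda>_. 0) = (\<lambda>_. 0)"
    using s(3,7) by (intro tangent_map_zero[OF manifold_total] smooth_near_act) (simp_all add: p one_carrier)
  also have "(\<lambda>e. 0 + tangent_map GA TP (act P (?s p)) (k p) ?\<xi> e) = fundamental_field G P ?\<xi> p"
    using s(3,7) by (simp add: fundamental_field_def)
  finally have "u = fundamental_field G P ?\<xi> p" .
  moreover have "?\<xi> \<in> lie_algebra G"
    using tangent_map_tangent_space[OF manifold_total manifold_group s(6) u] s(7) by (simp add: lie_algebra_def)
  ultimately show thesis by (rule that[rotated])
qed

lemma proj_tangent_lincomb:
  assumes "p \<in> points TP" "u \<in> tangent_space TP p" "v \<in> tangent_space TP p"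
  shows "proj_tangent P p (\<lambda>c. a *\<^sub>R u c + b *\<^sub>R v c) =
    (\<lambda>c. a *\<^sub>R proj_tangent P p u c + b *\<^sub>R proj_tangent P p v c)"
  unfolding proj_tangent_def by (rule tangent_map_lincomb[OF manifold_total smooth_near_proj]) (use assms in auto)

text \<open>The tangent map of a local section through p is a right inverse of T\<pi>.\<close>

lemma proj_tangent_surj:
  assumes p: "p \<in> points TP" and v: "v \<in> tangent_space MP (proj P p)"
  obtains u where "u \<in> tangent_space TP p" "proj_tangent P p u = v"
proof -
  obtain W \<sigma> where s: "openin (manifold_topology MP) W" "proj P p \<in> W" "\<sigma> (proj P p) = p"
    "\<And>n. n \<in> W \<Longrightarrow> smooth_near MP TP \<sigma> n" "\<And>n. n \<in> W \<Longrightarrow> proj P (\<sigma> n) = n"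
    using local_section[OF p] by metis
  have \<sigma>: "smooth_near MP TP \<sigma> (proj P p)" by (rule s(4)[OF s(2)])
  have pr: "smooth_near TP MP (proj P) (\<sigma> (proj P p))" using smooth_near_proj[OF p] s(3) by simp
  show thesis
  proof
    show "tangent_map MP TP \<sigma> (proj P p) v \<in> tangent_space TP p"
      using tangent_map_tangent_space[OF manifold_base manifold_total \<sigma> v] s(3) by simp
    have "proj_tangent P p (tangent_map MP TP \<sigma> (proj P p) v) = tangent_map MP MP (\<lambda>n. proj P (\<sigma> n)) (proj P p) v"
      using tangent_map_compose[OF manifold_base manifold_total \<sigma> pr v] s(3) by (simp add: proj_tangent_def)
    also have "\<dots> = tangent_map MP MP id (proj P p) v"
      by (rule tangent_map_cong[OF manifold_base smooth_near_compose[OF charts_base charts_total \<sigma> pr] _ v],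
          rule eventually_mono[OF eventually_near_openin[OF s(1,2)]]) (simp add: s(5))
    also have "\<dots> = v" by (rule tangent_map_id[OF manifold_base proj_points[OF p] v])
    finally show "proj_tangent P p (tangent_map MP TP \<sigma> (proj P p) v) = v" .
  qed
qed

end

section \<open>Principal connections and horizontal lifts\<close>

locale principal_lie_connection = principal_lie_bundle G P
  for G :: "('g, 'eg::real_normed_vector) lie_group_data"
    and P :: "('p, 'ep::real_normed_vector, 'm, 'em::real_normed_vector, 'g) pbundle" +
  fixes \<A> :: "'p \<Rightarrow> ('p, 'ep) tvec \<Rightarrow> ('g, 'eg) tvec"
  assumes connection: "principal_connection G P \<A>"
begin

lemma connection_lie_algebra:
  "p \<in> points TP \<Longrightarrow> u \<in> tangent_space TP p \<Longrightarrow> \<A> p u \<in> lie_algebra G"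
  and connection_act:
  "p \<in> points TP \<Longrightarrow> u \<in> tangent_space TP p \<Longrightarrow> g \<in> carrier G \<Longrightarrow>
    \<A> (act P p g) (act_tangent P g p u) = Ad G (inv\<^bsub>G\<^esub> g) (\<A> p u)"
  and connection_fundamental:
  "p \<in> points TP \<Longrightarrow> \<xi> \<in> lie_algebra G \<Longrightarrow> \<A> p (fundamental_field G P \<xi> p) = \<xi>"
  and connection_covector_field:
  "d \<in> GA \<Longrightarrow> covector_field_along TP TP id (\<lambda>p v. \<A> p v d)"
  using connection unfolding principal_connection_def by blast+

lemma connection_lincomb:
  assumes p: "p \<in> points TP" and u: "u \<in> tangent_space TP p" and v: "v \<in> tangent_space TP p"
  shows "\<A> p (\<lambda>c. a *\<^sub>R u c + b *\<^sub>R v c) = (\<lambda>d. a *\<^sub>R \<A> p u d + b *\<^sub>R \<A> p v d)"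
proof
  fix d
  have w: "(\<lambda>c. a *\<^sub>R u c + b *\<^sub>R v c) \<in> tangent_space TP p"
    by (rule tangent_space_lincomb[OF manifold_total u v])
  show "\<A> p (\<lambda>c. a *\<^sub>R u c + b *\<^sub>R v c) d = a *\<^sub>R \<A> p u d + b *\<^sub>R \<A> p v d"
  proof (cases "d \<in> GA")
    case True
    have "tangent_linear TP (id p) (\<lambda>v. \<A> p v d)"
      by (rule covector_field_along_linear[OF connection_covector_field[OF True] p])
    then show ?thesis using tangent_linear_lincomb u v by fastforce
  next
    \<comment> \<open>Linearity of the connection is given chart by chart over the group atlas; at
      all other charts a Lie algebra element is zero.\<close>
    case False
    have "\<A> p x d = 0" if "x \<in> tangent_space TP p" for x
      using connection_lie_algebra[OF p that] tangent_space_outside[of "\<A> p x" GA "\<one>\<^bsub>G\<^esub>" d] False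
      by (simp add: lie_algebra_def)
    then show ?thesis using u v w by simp
  qed
qed

lemma connection_diff:
  assumes "p \<in> points TP" "u \<in> tangent_space TP p" "v \<in> tangent_space TP p"
  shows "\<A> p (\<lambda>c. u c - v c) = (\<lambda>d. \<A> p u d - \<A> p v d)"
  using connection_lincomb[OF assms, of 1 "-1"] by simp

text \<open>Two horizontal lifts differ by a vertical vector, which is generated by some \<xi>. The
  connection sends it both to \<xi> and to 0.\<close>

lemma Hor_unique:
  assumes p: "p \<in> points TP" and u: "u \<in> tangent_space TP p" "\<A> p u = (\<lambda>_. 0)"
  shows "Hor P \<A> p (proj_tangent P p u) = u"
  unfolding Hor_def
proof (rule the_equality)
  fix w assume w: "w \<in> tangent_space TP p \<and> proj_tangent P p w = proj_tangent P p u \<and> \<A> p w = (\<lambda>_. 0)"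
  then have w': "w \<in> tangent_space TP p" by simp
  have d: "(\<lambda>c. w c - u c) \<in> tangent_space TP p" by (rule tangent_space_diff[OF manifold_total w' u(1)])
  have "proj_tangent P p (\<lambda>c. w c - u c) = (\<lambda>_. 0)"
    using proj_tangent_diff[OF p w' u(1)] w by simp
  then obtain \<xi> where \<xi>: "\<xi> \<in> lie_algebra G" "(\<lambda>c. w c - u c) = fundamental_field G P \<xi> p"
    using vertical_is_fundamental[OF p d] by metis
  have "\<xi> = \<A> p (\<lambda>c. w c - u c)" using connection_fundamental[OF p \<xi>(1)] \<xi>(2) by simp
  also have "\<dots> = (\<lambda>_. 0)" using connection_diff[OF p w' u(1)] w u by simp
  finally have "(\<lambda>c. w c - u c) = (\<lambda>_. 0)" using \<xi>(2) fundamental_field_zero[OF p] by simp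
  then show "w = u" by (auto simp: fun_eq_iff)
qed (use u in simp)

text \<open>Subtracting the fundamental vector generated by \<A>(u) kills the value of the
  connection and leaves the projection unchanged.\<close>

lemma Hor_tangent:
  assumes p: "p \<in> points TP" and u: "u \<in> tangent_space TP p"
  shows "Hor P \<A> p (proj_tangent P p u) = (\<lambda>c. u c - fundamental_field G P (\<A> p u) p c)" (is "_ = ?h")
    and "\<A> p (\<lambda>c. u c - fundamental_field G P (\<A> p u) p c) = (\<lambda>_. 0)"
    and "(\<lambda>c. u c - fundamental_field G P (\<A> p u) p c) \<in> tangent_space TP p"
proof -
  have A: "\<A> p u \<in> lie_algebra G" by (rule connection_lie_algebra[OF p u])
  have f: "fundamental_field G P (\<A> p u) p \<in> tangent_space TP p"
    by (rule fundamental_field_tangent_space[OF p A])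
  show h: "?h \<in> tangent_space TP p" by (rule tangent_space_diff[OF manifold_total u f])
  show Ah: "\<A> p ?h = (\<lambda>_. 0)"
    using connection_diff[OF p u f] connection_fundamental[OF p A] by simp
  have "proj_tangent P p ?h = proj_tangent P p u"
    using proj_tangent_diff[OF p u f] proj_fundamental_field[OF p A] by simp
  then show "Hor P \<A> p (proj_tangent P p u) = ?h"
    using Hor_unique[OF p h Ah] by simp
qed

text \<open>The translated lift has the same projection, and it is again horizontal because Ad fixes
  zero.\<close>

lemma Hor_act:
  assumes p: "p \<in> points TP" and g: "g \<in> carrier G" and v: "v \<in> tangent_space MP (proj P p)"
  shows "Hor P \<A> (act P p g) v = act_tangent P g p (Hor P \<A> p v)"
    and "Hor P \<A> p v \<in> tangent_space TP p"
proof -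
  obtain u where u: "u \<in> tangent_space TP p" "proj_tangent P p u = v"
    using proj_tangent_surj[OF p v] by metis
  define h where "h = Hor P \<A> p v"
  have h: "h \<in> tangent_space TP p" "\<A> p h = (\<lambda>_. 0)"
    using Hor_tangent[OF p u(1)] u(2) by (auto simp: h_def)
  then show "Hor P \<A> p v \<in> tangent_space TP p" by (simp add: h_def)
  have "proj_tangent P p h = v"
    using Hor_tangent(1)[OF p u(1)] u h proj_tangent_diff[OF p u(1) fundamental_field_tangent_space[OF p connection_lie_algebra[OF p u(1)]]]
      proj_fundamental_field[OF p connection_lie_algebra[OF p u(1)]]
    by (simp add: h_def)
  moreover have "\<A> (act P p g) (act_tangent P g p h) = (\<lambda>_. 0)"
  proof -
    have "Ad G (inv\<^bsub>G\<^esub> g) (\<lambda>_. 0) = (\<lambda>_. 0)"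
      unfolding Ad_def
      by (rule tangent_map_zero[OF manifold_group smooth_near_conjugation[OF inv_carrier[OF g] one_carrier]])
    then show ?thesis using connection_act[OF p h(1) g] h(2) by simp
  qed
  ultimately show "Hor P \<A> (act P p g) v = act_tangent P g p (Hor P \<A> p v)"
    using Hor_unique[OF act_points[OF p g] act_tangent_space[OF p g h(1)]] proj_act_tangent[OF p g h(1)]
    by (simp add: h_def)
qed

end

section \<open>The Kaluza-Klein momentum map\<close>

locale kaluza_klein =
  P: principal_lie_connection G P \<A> + S: principal_lie_connection G PS \<A>S
  for G :: "('g, 'eg::real_normed_vector) lie_group_data"
    and P :: "('p, 'ep::real_normed_vector, 'm, 'em::real_normed_vector, 'g) pbundle"
    and \<A> :: "'p \<Rightarrow> ('p, 'ep) tvec \<Rightarrow> ('g, 'eg) tvec"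
    and PS :: "('q, 'eq::real_normed_vector, 's, 'es::real_normed_vector, 'g) pbundle"
    and \<A>S :: "'q \<Rightarrow> ('q, 'eq) tvec \<Rightarrow> ('g, 'eg) tvec" +
  fixes Q :: "'q \<Rightarrow> 'p" and \<P> :: "'q \<Rightarrow> ('p, 'ep) tvec \<Rightarrow> real"
  assumes Q_KK: "Q \<in> Q_KK G P PS" and \<P>_cotangent: "\<P> \<in> cotangent_Q_KK G P PS Q"
begin

abbreviation "TQ \<equiv> tangent_map (total_atlas PS) (total_atlas P) Q"
abbreviation "\<zeta> \<equiv> fiber_momentum G P Q \<P>"
abbreviation "\<gamma> \<equiv> connection_difference_form P PS \<A> \<A>S Q \<zeta>"

section \<open>The tangent map of an equivariant map\<close>

lemma smooth_map_Q: "smooth_map S.TP P.TP Q"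
  and Q_act: "p \<in> points S.TP \<Longrightarrow> g \<in> carrier G \<Longrightarrow> Q (act PS p g) = act P (Q p) g"
  and smooth_map_base: "smooth_map S.MP P.MP (base_map P PS Q)"
  using Q_KK by (auto simp: Q_KK_def embedding_def)

lemma smooth_near_Q: "p \<in> points S.TP \<Longrightarrow> smooth_near S.TP P.TP Q p"
  by (rule smooth_map_imp_smooth_near[OF smooth_map_Q])

lemma Q_points: "p \<in> points S.TP \<Longrightarrow> Q p \<in> points P.TP"
  using smooth_near_points(2)[OF smooth_near_Q] .

lemma \<P>_covector_field: "covector_field_along S.TP P.TP Q \<P>"
  and \<P>_act: "p \<in> points S.TP \<Longrightarrow> g \<in> carrier G \<Longrightarrow> v \<in> tangent_space P.TP (Q p) \<Longrightarrow>
    \<P> (act PS p g) (act_tangent P g (Q p) v) = \<P> p v"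
  using \<P>_cotangent by (auto simp: cotangent_Q_KK_def)

lemma \<P>_linear: "p \<in> points S.TP \<Longrightarrow> tangent_linear P.TP (Q p) (\<P> p)"
  by (rule covector_field_along_linear[OF \<P>_covector_field])

lemma base_map_proj: "p \<in> points S.TP \<Longrightarrow> base_map P PS Q (proj PS p) = proj P (Q p)"
  unfolding base_map_def
  by (rule S.descend_eq) (simp_all add: Q_act P.proj_act Q_points)

lemma TQ_tangent_space:
  "p \<in> points S.TP \<Longrightarrow> u \<in> tangent_space S.TP p \<Longrightarrow> TQ p u \<in> tangent_space P.TP (Q p)"
  by (rule tangent_map_tangent_space[OF S.manifold_total P.manifold_total smooth_near_Q])

text \<open>Differentiate Q(x g) = Q(x) g with respect to x.\<close>

lemma TQ_act:
  assumes p: "p \<in> points S.TP" and g: "g \<in> carrier G" and u: "u \<in> tangent_space S.TP p"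
  shows "TQ (act PS p g) (act_tangent PS g p u) = act_tangent P g (Q p) (TQ p u)"
proof -
  note a = S.smooth_near_act[OF p g] and Qa = smooth_near_Q[OF S.act_points[OF p g]]
    and aQ = P.smooth_near_act[OF Q_points[OF p] g]
  have "TQ (act PS p g) (act_tangent PS g p u) = tangent_map S.TP P.TP (\<lambda>x. Q (act PS x g)) p u"
    using tangent_map_compose[OF S.manifold_total S.manifold_total a Qa u] by (simp add: act_tangent_def)
  also have "\<dots> = tangent_map S.TP P.TP (\<lambda>x. act P (Q x) g) p u"
    by (rule tangent_map_cong[OF S.manifold_total smooth_near_compose[OF S.charts_total S.charts_total a Qa] _ u],
        rule eventually_mono[OF S.eventually_near_total]) (simp add: Q_act g)
  also have "\<dots> = act_tangent P g (Q p) (TQ p u)"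
    using tangent_map_compose[OF S.manifold_total P.manifold_total smooth_near_Q[OF p] aQ u] by (simp add: act_tangent_def)
  finally show ?thesis .
qed

text \<open>Differentiate Q(p g) = Q(p) g with respect to g at the identity. This makes the
  pulled-back connection agree with the one on P_S on vertical vectors.\<close>

lemma TQ_fundamental_field:
  assumes p: "p \<in> points S.TP" and \<xi>: "\<xi> \<in> lie_algebra G"
  shows "TQ p (fundamental_field G PS \<xi> p) = fundamental_field G P \<xi> (Q p)"
proof -
  have \<xi>': "\<xi> \<in> tangent_space S.GA \<one>\<^bsub>G\<^esub>" using \<xi> by (simp add: lie_algebra_def)
  note o = S.smooth_near_orbit[OF p S.one_carrier]
  have Q1: "smooth_near S.TP P.TP Q (act PS p \<one>\<^bsub>G\<^esub>)"
    using smooth_near_Q[OF p] by (simp add: S.act_one p)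
  have "TQ p (fundamental_field G PS \<xi> p) = tangent_map S.GA P.TP (\<lambda>g. Q (act PS p g)) \<one>\<^bsub>G\<^esub> \<xi>"
    using tangent_map_compose[OF S.manifold_group S.manifold_total o Q1 \<xi>']
    by (simp add: fundamental_field_def S.act_one p)
  also have "\<dots> = fundamental_field G P \<xi> (Q p)"
    unfolding fundamental_field_def
    by (rule tangent_map_cong[OF S.manifold_group smooth_near_compose[OF S.charts_group S.charts_total o Q1] _ \<xi>'],
        rule eventually_mono[OF S.eventually_near_group]) (simp add: Q_act p)
  finally show ?thesis .
qed

text \<open>Both sides are derivatives of the one map from P_S to M, factored through S and through
  P.\<close>

lemma proj_TQ:
  assumes p: "p \<in> points S.TP" and u: "u \<in> tangent_space S.TP p"
  shows "tangent_map S.MP P.MP (base_map P PS Q) (proj PS p) (proj_tangent PS p u) = proj_tangent P (Q p) (TQ p u)"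
proof -
  note pr = S.smooth_near_proj[OF p] and prQ = P.smooth_near_proj[OF Q_points[OF p]]
    and b = smooth_map_imp_smooth_near[OF smooth_map_base S.proj_points[OF p]]
  have "tangent_map S.MP P.MP (base_map P PS Q) (proj PS p) (proj_tangent PS p u) =
      tangent_map S.TP P.MP (\<lambda>x. base_map P PS Q (proj PS x)) p u"
    using tangent_map_compose[OF S.manifold_total S.manifold_base pr b u] by (simp add: proj_tangent_def)
  also have "\<dots> = tangent_map S.TP P.MP (\<lambda>x. proj P (Q x)) p u"
    by (rule tangent_map_cong[OF S.manifold_total smooth_near_compose[OF S.charts_total S.charts_base pr b] _ u],
        rule eventually_mono[OF S.eventually_near_total]) (simp add: base_map_proj)
  also have "\<dots> = proj_tangent P (Q p) (TQ p u)"
    using tangent_map_compose[OF S.manifold_total P.manifold_total smooth_near_Q[OF p] prQ u]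
    by (simp add: proj_tangent_def)
  finally show ?thesis .
qed

section \<open>The fibre momentum \<zeta>\<close>

lemma \<zeta>_eq: "\<zeta> p \<xi> = \<P> p (fundamental_field G P \<xi> (Q p))"
  by (simp add: fiber_momentum_def fiber_momentum_map_def cotangent_momentum_map_def)

text \<open>Right translation by g carries the generator of Ad_g \<xi> at Q(p) to the generator of
  \<xi> at Q(p g), and \<P> is invariant under it.\<close>

lemma \<zeta>_act:
  assumes p: "p \<in> points S.TP" and g: "g \<in> carrier G" and \<xi>: "\<xi> \<in> lie_algebra G"
  shows "\<zeta> (act PS p g) \<xi> = \<zeta> p (Ad G g \<xi>)"
  using P.fundamental_field_act[OF Q_points[OF p] g \<xi>]
    \<P>_act[OF p g P.fundamental_field_tangent_space[OF Q_points[OF p] P.Ad_lie_algebra[OF g \<xi>]]]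
  by (simp add: \<zeta>_eq Q_act p g)

lemma \<zeta>_linear:
  assumes p: "p \<in> points S.TP"
  shows "tangent_linear S.GA \<one>\<^bsub>G\<^esub> (\<zeta> p)"
  unfolding tangent_linear_def
proof (intro ballI allI)
  fix v w a b assume "v \<in> tangent_space S.GA \<one>\<^bsub>G\<^esub>" "w \<in> tangent_space S.GA \<one>\<^bsub>G\<^esub>"
  then have vw: "v \<in> lie_algebra G" "w \<in> lie_algebra G" by (simp_all add: lie_algebra_def)
  show "\<zeta> p (\<lambda>c. a *\<^sub>R v c + b *\<^sub>R w c) = a *\<^sub>R \<zeta> p v + b *\<^sub>R \<zeta> p w"
    unfolding \<zeta>_eq P.fundamental_field_lincomb[OF Q_points[OF p] vw]
    by (rule tangent_linear_lincomb[OF \<P>_linear[OF p]])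
       (intro P.fundamental_field_tangent_space Q_points p vw)+
qed

lemma \<zeta>_diff:
  "p \<in> points S.TP \<Longrightarrow> \<xi> \<in> lie_algebra G \<Longrightarrow> \<eta> \<in> lie_algebra G \<Longrightarrow>
    \<zeta> p (\<lambda>d. \<xi> d - \<eta> d) = \<zeta> p \<xi> - \<zeta> p \<eta>"
  by (rule tangent_linear_diff[OF \<zeta>_linear]) (simp_all add: lie_algebra_def)

text \<open>At a fixed \<xi> this is \<P> paired with the fundamental field along Q. Fixed \<xi>
  suffice for the dual functions, since coordinate vectors at the identity do not move with the
  point of P_S.\<close>

lemma smooth_near_\<zeta>:
  assumes p: "p \<in> points S.TP" and \<xi>: "\<xi> \<in> lie_algebra G"
  shows "smooth_near S.TP vector_atlas (\<lambda>x. \<zeta> x \<xi>) p"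
proof -
  obtain a where a: "a \<in> P.TP" "Q p \<in> fst a" using Q_points[OF p] by (rule pointsE)
  show ?thesis
    unfolding \<zeta>_eq
  proof (rule smooth_near_pairing[OF P.manifold_total S.manifold_total smooth_near_Q[OF p] a])
    show "\<forall>\<^sub>F x in near S.TP p. tangent_linear P.TP (Q x) (\<P> x)"
      using S.eventually_near_total by (rule eventually_mono) (rule \<P>_linear)
    show "\<forall>\<^sub>F x in near S.TP p. fundamental_field G P \<xi> (Q x) \<in> tangent_space P.TP (Q x)"
      using S.eventually_near_total
      by (rule eventually_mono) (intro P.fundamental_field_tangent_space Q_points \<xi>)
    show "smooth_near S.TP vector_atlas (\<lambda>x. fundamental_field G P \<xi> (Q x) a) p"
      by (rule smooth_near_compose[OF S.charts_total P.charts_total smooth_near_Q[OF p]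
            P.smooth_near_fundamental_field[OF Q_points[OF p] a \<xi>]])
    show "smooth_near S.TP vector_atlas (\<lambda>x. \<P> x (coord_vector P.TP a (Q x) e)) p" for e
      by (rule covector_field_along_smooth_near[OF S.manifold_total smooth_map_Q \<P>_covector_field p a])
  qed
qed

lemma \<zeta>_equivariant_dual: "\<zeta> \<in> equivariant_dual_functions G PS"
  unfolding equivariant_dual_functions_def
proof (intro CollectI conjI ballI)
  show "covector_field_along S.TP S.GA (\<lambda>_. \<one>\<^bsub>G\<^esub>) \<zeta>"
  proof (rule covector_field_alongI[OF S.manifold_total \<zeta>_linear])
    fix x a e assume x: "x \<in> points S.TP" and a: "a \<in> S.GA" "\<one>\<^bsub>G\<^esub> \<in> fst a"
    show "smooth_near S.TP vector_atlas (\<lambda>x. \<zeta> x (coord_vector S.GA a \<one>\<^bsub>G\<^esub> e)) x"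
      using coord_vector_tangent_space[OF S.manifold_group a]
      by (intro smooth_near_\<zeta> x) (simp add: lie_algebra_def)
  qed
qed (rule \<zeta>_act)

text \<open>Translation by g carries horizontal lifts to horizontal lifts, so invariance of \<P>
  makes the contraction constant along the fibre.\<close>

lemma horizontal_momentum_proj:
  assumes p: "p \<in> points S.TP" and v: "v \<in> tangent_space P.MP (proj P (Q p))"
  shows "horizontal_momentum P PS \<A> Q \<P> (proj PS p) v = \<P> p (Hor P \<A> (Q p) v)"
  unfolding horizontal_momentum_def
proof (rule S.descend_eq[OF p])
  fix g assume g: "g \<in> carrier G"
  show "\<P> (act PS p g) (Hor P \<A> (Q (act PS p g)) v) = \<P> p (Hor P \<A> (Q p) v)"
    using P.Hor_act[OF Q_points[OF p] g v] \<P>_act[OF p g] by (simp add: Q_act p g)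
qed

section \<open>The difference of the connections descends to S\<close>

lemma \<gamma>_eq:
  assumes p: "p \<in> points S.TP" and u: "u \<in> tangent_space S.TP p"
  shows "\<gamma> p u = \<zeta> p (\<A> (Q p) (TQ p u)) - \<zeta> p (\<A>S p u)"
  unfolding connection_difference_form_def
  by (rule \<zeta>_diff[OF p P.connection_lie_algebra[OF Q_points[OF p] TQ_tangent_space[OF p u]] S.connection_lie_algebra[OF p u]])

text \<open>The functions \<zeta> and the values of a connection transform in opposite ways, so
  their contraction is invariant. This serves both the difference form and the fibre
  integrand.\<close>

lemma \<zeta>_Ad_inv:
  assumes "p \<in> points S.TP" "g \<in> carrier G" "\<xi> \<in> lie_algebra G"
  shows "\<zeta> (act PS p g) (Ad G (inv\<^bsub>G\<^esub> g) \<xi>) = \<zeta> p \<xi>"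
  using assms \<zeta>_act[of p g "Ad G (inv\<^bsub>G\<^esub> g) \<xi>"] S.Ad_lie_algebra[of "inv\<^bsub>G\<^esub> g" \<xi>]
  by (simp add: S.inv_carrier S.Ad_Ad_inv)

lemma \<gamma>_act:
  assumes p: "p \<in> points S.TP" and g: "g \<in> carrier G" and u: "u \<in> tangent_space S.TP p"
  shows "\<gamma> (act PS p g) (act_tangent PS g p u) = \<gamma> p u"
  using p g u
  by (simp add: \<gamma>_eq S.act_points S.act_tangent_space TQ_act Q_act P.connection_act Q_points
      TQ_tangent_space S.connection_act \<zeta>_Ad_inv P.connection_lie_algebra S.connection_lie_algebra)

lemma \<gamma>_diff:
  assumes p: "p \<in> points S.TP" and u: "u \<in> tangent_space S.TP p" and w: "w \<in> tangent_space S.TP p"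
  shows "\<gamma> p (\<lambda>c. u c - w c) = \<gamma> p u - \<gamma> p w"
proof -
  have "TQ p (\<lambda>c. u c - w c) = (\<lambda>c. TQ p u c - TQ p w c)"
    by (rule tangent_map_diff[OF S.manifold_total smooth_near_Q[OF p] u w])
  then show ?thesis
    using assms tangent_space_diff[OF S.manifold_total u w]
    by (simp add: \<gamma>_eq P.connection_diff S.connection_diff Q_points TQ_tangent_space \<zeta>_diff
        P.connection_lie_algebra S.connection_lie_algebra)
qed

text \<open>TQ preserves fundamental vectors, and both connections return the generator
  \<xi>.\<close>

lemma \<gamma>_vertical:
  assumes "p \<in> points S.TP" "\<xi> \<in> lie_algebra G"
  shows "\<gamma> p (fundamental_field G PS \<xi> p) = 0"
  using assms by (simp add: \<gamma>_eq S.fundamental_field_tangent_space TQ_fundamental_field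
      P.connection_fundamental S.connection_fundamental Q_points)

text \<open>A competing vector at another point of the fibre is compared with the translate of u to
  that point. Their difference has zero projection, hence is fundamental, and \<gamma> vanishes on
  it.\<close>

lemma reduce_form_\<gamma>:
  assumes p: "p \<in> points S.TP" and u: "u \<in> tangent_space S.TP p"
  shows "reduce_form PS \<gamma> (proj PS p) (proj_tangent PS p u) = \<gamma> p u"
  unfolding reduce_form_def
proof (rule the_equality)
  show "\<forall>x\<in>points S.TP. \<forall>w\<in>tangent_space S.TP x.
      proj PS x = proj PS p \<and> proj_tangent PS x w = proj_tangent PS p u \<longrightarrow> \<gamma> x w = \<gamma> p u"
  proof (intro ballI impI, elim conjE)
    fix x w assume x: "x \<in> points S.TP" and w: "w \<in> tangent_space S.TP x"
      and px: "proj PS x = proj PS p" and pw: "proj_tangent PS x w = proj_tangent PS p u"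
    obtain g where g: "g \<in> carrier G" "x = act PS p g" using S.fibre_transitive[OF p x px] by metis
    let ?u = "act_tangent PS g p u"
    have u': "?u \<in> tangent_space S.TP x" using S.act_tangent_space[OF p g(1) u] g(2) by simp
    have "proj_tangent PS x (\<lambda>c. w c - ?u c) = (\<lambda>_. 0)"
      using S.proj_tangent_diff[OF x w u'] S.proj_act_tangent[OF p g(1) u] pw g(2) by simp
    then obtain \<xi> where \<xi>: "\<xi> \<in> lie_algebra G" "(\<lambda>c. w c - ?u c) = fundamental_field G PS \<xi> x"
      using S.vertical_is_fundamental[OF x tangent_space_diff[OF S.manifold_total w u']] by metis
    have "\<gamma> x w - \<gamma> x ?u = 0"
      using \<gamma>_vertical[OF x \<xi>(1)] \<gamma>_diff[OF x w u'] \<xi>(2) by simp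
    then show "\<gamma> x w = \<gamma> p u" using \<gamma>_act[OF p g(1) u] g(2) by simp
  qed
qed (use p u in blast)

section \<open>The one-form on S\<close>

definition momentum_form :: "'s \<Rightarrow> ('s, 'es) tvec \<Rightarrow> real" where
  "momentum_form s v = horizontal_momentum P PS \<A> Q \<P> s (tangent_map S.MP P.MP (base_map P PS Q) s v) +
    reduce_form PS \<gamma> s v"

text \<open>The connection on \<open>P\<close> cancels. Since every tangent vector of the base is a projection, this
  determines the one-form.\<close>

lemma momentum_form_proj:
  assumes p: "p \<in> points S.TP" and u: "u \<in> tangent_space S.TP p"
  shows "momentum_form (proj PS p) (proj_tangent PS p u) = \<P> p (TQ p u) - \<zeta> p (\<A>S p u)"
proof -
  note Qp = Q_points[OF p] and w = TQ_tangent_space[OF p u]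
  have f: "fundamental_field G P (\<A> (Q p) (TQ p u)) (Q p) \<in> tangent_space P.TP (Q p)"
    by (rule P.fundamental_field_tangent_space[OF Qp P.connection_lie_algebra[OF Qp w]])
  have "horizontal_momentum P PS \<A> Q \<P> (proj PS p) (proj_tangent P (Q p) (TQ p u)) =
      \<P> p (TQ p u) - \<zeta> p (\<A> (Q p) (TQ p u))"
    using horizontal_momentum_proj[OF p P.proj_tangent_space[OF Qp w]] P.Hor_tangent(1)[OF Qp w]
      tangent_linear_diff[OF \<P>_linear[OF p] w f]
    by (simp add: \<zeta>_eq)
  then show ?thesis
    by (simp add: momentum_form_def proj_TQ[OF p u] reduce_form_\<gamma>[OF p u] \<gamma>_eq[OF p u])
qed

text \<open>Both vectors are lifted to the same point p of P_S, because the formula for the form on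
  projected vectors is linear at fixed p.\<close>

lemma momentum_form_linear:
  assumes s: "s \<in> points S.MP"
  shows "tangent_linear S.MP s (momentum_form s)"
  unfolding tangent_linear_def
proof (intro ballI allI)
  fix v w a b assume v: "v \<in> tangent_space S.MP s" and w: "w \<in> tangent_space S.MP s"
  obtain p where p: "p \<in> points S.TP" "proj PS p = s" using S.points_base_obtain[OF s] by metis
  obtain v' where v': "v' \<in> tangent_space S.TP p" "proj_tangent PS p v' = v"
    using S.proj_tangent_surj[OF p(1)] v p(2) by metis
  obtain w' where w': "w' \<in> tangent_space S.TP p" "proj_tangent PS p w' = w"
    using S.proj_tangent_surj[OF p(1)] w p(2) by metis
  let ?u = "\<lambda>c. a *\<^sub>R v' c + b *\<^sub>R w' c"
  have u: "?u \<in> tangent_space S.TP p" by (rule tangent_space_lincomb[OF S.manifold_total v'(1) w'(1)])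
  have "momentum_form s (\<lambda>c. a *\<^sub>R v c + b *\<^sub>R w c) = \<P> p (TQ p ?u) - \<zeta> p (\<A>S p ?u)"
    using momentum_form_proj[OF p(1) u] S.proj_tangent_lincomb[OF p(1) v'(1) w'(1)] p(2) v'(2) w'(2) by simp
  also have "TQ p ?u = (\<lambda>c. a *\<^sub>R TQ p v' c + b *\<^sub>R TQ p w' c)"
    by (rule tangent_map_lincomb[OF S.manifold_total smooth_near_Q[OF p(1)] v'(1) w'(1)])
  also have "\<P> p \<dots> = a *\<^sub>R \<P> p (TQ p v') + b *\<^sub>R \<P> p (TQ p w')"
    by (rule tangent_linear_lincomb[OF \<P>_linear[OF p(1)] TQ_tangent_space[OF p(1) v'(1)] TQ_tangent_space[OF p(1) w'(1)]])
  also have "\<A>S p ?u = (\<lambda>d. a *\<^sub>R \<A>S p v' d + b *\<^sub>R \<A>S p w' d)"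
    by (rule S.connection_lincomb[OF p(1) v'(1) w'(1)])
  also have "\<zeta> p \<dots> = a *\<^sub>R \<zeta> p (\<A>S p v') + b *\<^sub>R \<zeta> p (\<A>S p w')"
    using S.connection_lie_algebra[OF p(1) v'(1)] S.connection_lie_algebra[OF p(1) w'(1)]
    by (intro tangent_linear_lincomb[OF \<zeta>_linear[OF p(1)]]) (simp_all add: lie_algebra_def)
  finally have "momentum_form s (\<lambda>c. a *\<^sub>R v c + b *\<^sub>R w c) =
      a *\<^sub>R (\<P> p (TQ p v') - \<zeta> p (\<A>S p v')) + b *\<^sub>R (\<P> p (TQ p w') - \<zeta> p (\<A>S p w'))"
    by (simp add: algebra_simps)
  then show "momentum_form s (\<lambda>c. a *\<^sub>R v c + b *\<^sub>R w c) = a *\<^sub>R momentum_form s v + b *\<^sub>R momentum_form s w"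
    using momentum_form_proj[OF p(1) v'(1)] momentum_form_proj[OF p(1) w'(1)] p(2) v'(2) w'(2) by simp
qed

text \<open>The section turns the formula on projected vectors into one on S, to be applied to a
  lift of the coordinate field V. Each of its two terms is then a pairing of smooth fields along a
  map from S.\<close>

lemma smooth_near_momentum_form:
  assumes s0: "s0 \<in> points S.MP" and a: "a \<in> S.MP" "s0 \<in> fst a"
  shows "smooth_near S.MP vector_atlas (\<lambda>s. momentum_form s (coord_vector S.MP a s e)) s0"
proof -
  obtain p where p: "p \<in> points S.TP" "proj PS p = s0" using S.points_base_obtain[OF s0] by metis
  obtain W \<sigma> where W: "openin (manifold_topology S.MP) W" "s0 \<in> W" and \<sigma>0: "\<sigma> s0 = p"
    and \<sigma>: "\<And>n. n \<in> W \<Longrightarrow> smooth_near S.MP S.TP \<sigma> n" and pr\<sigma>: "\<And>n. n \<in> W \<Longrightarrow> proj PS (\<sigma> n) = n"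
    using S.local_section[OF p(1)] p(2) by metis
  have evW: "\<forall>\<^sub>F s in near S.MP s0. s \<in> W" by (rule eventually_near_openin[OF W])
  have eva: "\<forall>\<^sub>F s in near S.MP s0. s \<in> fst a"
    using eventually_near_smooth[OF S.manifold_base smooth_near_id[OF S.manifold_base s0] a(1)] a(2) by simp
  have \<sigma>_points: "\<sigma> s \<in> points S.TP" if "s \<in> W" for s using smooth_near_points(2)[OF \<sigma>[OF that]] .
  note \<sigma>s0 = \<sigma>[OF W(2)]
  obtain q where q: "q \<in> S.TP" "\<sigma> s0 \<in> fst q" using \<sigma>_points[OF W(2)] by (rule pointsE)
  note Q\<sigma> = smooth_near_Q[OF \<sigma>_points]
  have Q\<sigma>s0: "smooth_near S.MP P.TP (\<lambda>s. Q (\<sigma> s)) s0"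
    by (rule smooth_near_compose[OF S.charts_base S.charts_total \<sigma>s0 Q\<sigma>[OF W(2)]])
  obtain r where r: "r \<in> P.TP" "Q (\<sigma> s0) \<in> fst r" using smooth_near_points(2)[OF Q\<sigma>s0] by (rule pointsE)
  \<comment> \<open>The identity does not vary with s, so one chart around it is enough to express
    the connection values.\<close>
  obtain g where g: "g \<in> S.GA" "\<one>\<^bsub>G\<^esub> \<in> fst g" using S.one_points by (rule pointsE)
  define V where "V s = coord_vector S.MP a s e" for s
  \<comment> \<open>The section pushes V forward to vectors along \<sigma> whose projections are V
    again.\<close>
  define Y where "Y s = tangent_map S.MP S.TP \<sigma> s (V s)" for s
  have V: "\<forall>\<^sub>F s in near S.MP s0. V s \<in> tangent_space S.MP s"
    using eva by (rule eventually_mono) (simp add: V_def coord_vector_tangent_space[OF S.manifold_base a(1)])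
  have Y: "\<forall>\<^sub>F s in near S.MP s0. Y s \<in> tangent_space S.TP (\<sigma> s)"
    using V evW
    by eventually_elim (simp add: Y_def tangent_map_tangent_space[OF S.manifold_base S.manifold_total \<sigma>])
  have sY: "smooth_near S.MP vector_atlas (\<lambda>s. Y s q) s0"
    unfolding Y_def
    using smooth_near_tangent_map[OF S.manifold_base S.manifold_base smooth_near_id[OF S.manifold_base s0] a(1) _ q(1),
        of \<sigma> V] a(2) q(2) V smooth_near_coord_vector[OF S.manifold_base a a]
      eventually_mono[OF evW \<sigma>]
    by (simp add: V_def)
  have t1: "smooth_near S.MP vector_atlas (\<lambda>s. \<P> (\<sigma> s) (TQ (\<sigma> s) (Y s))) s0"
  proof (rule smooth_near_pairing[OF P.manifold_total S.manifold_base Q\<sigma>s0 r])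
    show "\<forall>\<^sub>F s in near S.MP s0. tangent_linear P.TP (Q (\<sigma> s)) (\<P> (\<sigma> s))"
      using evW by (rule eventually_mono) (rule \<P>_linear[OF \<sigma>_points])
    show "\<forall>\<^sub>F s in near S.MP s0. TQ (\<sigma> s) (Y s) \<in> tangent_space P.TP (Q (\<sigma> s))"
      using evW Y by eventually_elim (rule TQ_tangent_space[OF \<sigma>_points])
    show "smooth_near S.MP vector_atlas (\<lambda>s. TQ (\<sigma> s) (Y s) r) s0"
      by (rule smooth_near_tangent_map[where H = Q, OF S.manifold_total S.manifold_base \<sigma>s0 q r _ Y sY])
         (rule eventually_mono[OF evW Q\<sigma>])
    show "smooth_near S.MP vector_atlas (\<lambda>s. \<P> (\<sigma> s) (coord_vector P.TP r (Q (\<sigma> s)) e)) s0" for e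
      by (rule smooth_near_compose[OF S.charts_base S.charts_total \<sigma>s0
            covector_field_along_smooth_near[OF S.manifold_total smooth_map_Q \<P>_covector_field \<sigma>_points[OF W(2)] r]])
  qed
  have sA: "smooth_near S.MP vector_atlas (\<lambda>s. \<A>S (\<sigma> s) (Y s) g) s0"
  proof (rule smooth_near_pairing[OF S.manifold_total S.manifold_base \<sigma>s0 q _ Y sY])
    note cf = S.connection_covector_field[OF g(1)]
    have idm: "smooth_map S.TP S.TP id"
      using S.manifold_total by (auto simp: smooth_map_def smooth_manifold_def)
    show "\<forall>\<^sub>F s in near S.MP s0. tangent_linear S.TP (\<sigma> s) (\<lambda>v. \<A>S (\<sigma> s) v g)"
      using evW by (rule eventually_mono) (use covector_field_along_linear[OF cf \<sigma>_points] in simp)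
    have "smooth_near S.TP vector_atlas (\<lambda>x. \<A>S x (coord_vector S.TP q x e) g) (\<sigma> s0)" for e
      using covector_field_along_smooth_near[OF S.manifold_total idm cf \<sigma>_points[OF W(2)] q(1)] q(2) by simp
    then show "smooth_near S.MP vector_atlas (\<lambda>s. \<A>S (\<sigma> s) (coord_vector S.TP q (\<sigma> s) e) g) s0" for e
      by (rule smooth_near_compose[OF S.charts_base S.charts_total \<sigma>s0])
  qed
  \<comment> \<open>Here \<zeta> \<circ> \<sigma> is treated as a covector field along the constant
    map to the identity of the group.\<close>
  have t2: "smooth_near S.MP vector_atlas (\<lambda>s. \<zeta> (\<sigma> s) (\<A>S (\<sigma> s) (Y s))) s0"
  proof (rule smooth_near_pairing[where V = "\<lambda>s. \<A>S (\<sigma> s) (Y s)", OF S.manifold_group S.manifold_base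
        smooth_near_const[OF S.charts_base s0 S.one_points] g _ _ sA])
    show "\<forall>\<^sub>F s in near S.MP s0. tangent_linear S.GA \<one>\<^bsub>G\<^esub> (\<zeta> (\<sigma> s))"
      using evW by (rule eventually_mono) (rule \<zeta>_linear[OF \<sigma>_points])
    show "\<forall>\<^sub>F s in near S.MP s0. \<A>S (\<sigma> s) (Y s) \<in> tangent_space S.GA \<one>\<^bsub>G\<^esub>"
      using evW Y by eventually_elim (use S.connection_lie_algebra[OF \<sigma>_points] in \<open>simp add: lie_algebra_def\<close>)
    show "smooth_near S.MP vector_atlas (\<lambda>s. \<zeta> (\<sigma> s) (coord_vector S.GA g \<one>\<^bsub>G\<^esub> e)) s0" for e
      using coord_vector_tangent_space[OF S.manifold_group g]
      by (intro smooth_near_compose[OF S.charts_base S.charts_total \<sigma>s0] smooth_near_\<zeta> \<sigma>_points W)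
         (simp add: lie_algebra_def)
  qed
  \<comment> \<open>Since \<pi> \<circ> \<sigma> is the identity over W, the lift Y projects to V
    there, and the formula on projected vectors applies at each s near \<open>s0\<close>.\<close>
  have "\<forall>\<^sub>F s in near S.MP s0. \<P> (\<sigma> s) (TQ (\<sigma> s) (Y s)) - \<zeta> (\<sigma> s) (\<A>S (\<sigma> s) (Y s)) = momentum_form s (V s)"
    using evW V Y
  proof eventually_elim
    case (elim s)
    have pr: "smooth_near S.TP S.MP (proj PS) (\<sigma> s)" by (rule S.smooth_near_proj[OF \<sigma>_points[OF elim(1)]])
    have "proj_tangent PS (\<sigma> s) (Y s) = tangent_map S.MP S.MP (\<lambda>n. proj PS (\<sigma> n)) s (V s)"
      using tangent_map_compose[OF S.manifold_base S.manifold_total \<sigma>[OF elim(1)] pr elim(2)]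
      by (simp add: proj_tangent_def Y_def)
    also have "\<dots> = tangent_map S.MP S.MP id s (V s)"
      by (rule tangent_map_cong[OF S.manifold_base smooth_near_compose[OF S.charts_base S.charts_total \<sigma>[OF elim(1)] pr] _ elim(2)],
          rule eventually_mono[OF eventually_near_openin[OF W(1) elim(1)]]) (simp add: pr\<sigma>)
    also have "\<dots> = V s"
      by (rule tangent_map_id[OF S.manifold_base smooth_near_points(1)[OF \<sigma>[OF elim(1)]] elim(2)])
    finally show ?case
      using momentum_form_proj[OF \<sigma>_points[OF elim(1)] elim(3)] pr\<sigma>[OF elim(1)] by simp
  qed
  from smooth_near_cong[OF S.manifold_base smooth_near_diff[OF t1 t2] this]
  show ?thesis by (simp add: V_def)
qed

lemma momentum_form_one_form: "momentum_form \<in> one_forms S.MP"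
  unfolding one_forms_def
proof (rule CollectI, rule covector_field_alongI[OF S.manifold_base])
  show "tangent_linear S.MP (id s) (momentum_form s)" if "s \<in> points S.MP" for s
    using momentum_form_linear[OF that] by simp
  show "smooth_near S.MP vector_atlas (\<lambda>s. momentum_form s (coord_vector S.MP a (id s) e)) s"
    if "s \<in> points S.MP" "a \<in> S.MP" "id s \<in> fst a" for s a e
    using smooth_near_momentum_form[OF that(1,2)] that(3) by simp
qed

section \<open>Comparison of the integrands and the momentum map\<close>

lemma contraction_split:
  assumes U: "U \<in> aut_algebra G PS" and s: "s \<in> points S.MP"
  shows "Q_KK_contraction PS \<P> (composition_generator P PS U Q) s =
    base_contraction PS momentum_form U s + fiber_contraction PS \<A>S \<zeta> U s"
proof -
  obtain p where p: "p \<in> points S.TP" "proj PS p = s" using S.points_base_obtain[OF s] by metis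
  have Up: "U p \<in> tangent_space S.TP p"
    using U p(1) by (simp add: aut_algebra_def vector_fields_def vector_field_along_def)
  have U_act: "U (act PS p g) = act_tangent PS g p (U p)" if "g \<in> carrier G" for g
    using U p(1) that by (simp add: aut_algebra_def)
  \<comment> \<open>All three contractions are descents of invariant functions, so they can be
    evaluated at the same point p of the fibre and compared there.\<close>
  have "base_field PS U (proj PS p) = proj_tangent PS p (U p)"
    unfolding base_field_def
    by (rule S.descend_eq[OF p(1)]) (simp add: U_act S.proj_act_tangent p(1) Up)
  moreover have "fiber_contraction PS \<A>S \<zeta> U (proj PS p) = \<zeta> p (\<A>S p (U p))"
    unfolding fiber_contraction_def
    by (rule S.descend_eq[OF p(1)])
       (simp add: U_act S.connection_act p(1) Up \<zeta>_Ad_inv S.connection_lie_algebra)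
  moreover have "Q_KK_contraction PS \<P> (composition_generator P PS U Q) (proj PS p) = \<P> p (TQ p (U p))"
    unfolding Q_KK_contraction_def composition_generator_def
    by (rule S.descend_eq[OF p(1)])
       (simp add: U_act TQ_act p(1) Up \<P>_act TQ_tangent_space)
  ultimately show ?thesis
    using momentum_form_proj[OF p(1) Up] p(2) by (simp add: base_contraction_def)
qed

lemma momentum_map_eq:
  assumes U: "U \<in> aut_algebra G PS"
    and base: "integrable_over S.MP \<omega> (base_contraction PS momentum_form U)"
    and fiber: "integrable_over S.MP \<omega> (fiber_contraction PS \<A>S \<zeta> U)"
  shows "integrable_over S.MP \<omega> (Q_KK_contraction PS \<P> (composition_generator P PS U Q))"
    and "J_R P PS \<omega> Q \<P> U = aut_dual_of_pair PS \<omega> \<A>S (momentum_form, \<zeta>) U"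
proof -
  let ?f = "Q_KK_contraction PS \<P> (composition_generator P PS U Q)"
  let ?g = "\<lambda>s. base_contraction PS momentum_form U s + fiber_contraction PS \<A>S \<zeta> U s"
  \<comment> \<open>The integrands are compared at points of S; elsewhere \<open>descend\<close> has
    no controlled value, and the indicator removes those arguments.\<close>
  have eq: "(\<lambda>s. indicator (points S.MP) s *\<^sub>R ?f s) = (\<lambda>s. indicator (points S.MP) s *\<^sub>R ?g s)"
    using contraction_split[OF U] by (auto simp: fun_eq_iff indicator_def)
  have "integrable_over S.MP \<omega> ?g"
    using set_integral_add(1) base fiber unfolding integrable_over_def by blast
  then show "integrable_over S.MP \<omega> ?f"
    unfolding integrable_over_def set_integrable_def eq .
  have "integral_over S.MP \<omega> ?f = integral_over S.MP \<omega> ?g"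
    unfolding integral_over_def set_lebesgue_integral_def eq ..
  also have "\<dots> = integral_over S.MP \<omega> (base_contraction PS momentum_form U) + integral_over S.MP \<omega> (fiber_contraction PS \<A>S \<zeta> U)"
    using set_integral_add(2) base fiber unfolding integrable_over_def integral_over_def by blast
  finally show "J_R P PS \<omega> Q \<P> U = aut_dual_of_pair PS \<omega> \<A>S (momentum_form, \<zeta>) U"
    by (simp add: J_R_def cotangent_momentum_map_def Q_KK_pairing_def aut_dual_of_pair_def)
qed

end

theorem proposition3p9:
  fixes G :: "('g, 'eg::real_normed_vector) lie_group_data"
    and P :: "('p, 'ep::real_normed_vector, 'm, 'em::real_normed_vector, 'g) pbundle"
    and PS :: "('q, 'eq::real_normed_vector, 'm, 'es::real_normed_vector, 'g) pbundle"
    and \<omega> :: "'m \<Rightarrow> ('m, 'es) tvec list \<Rightarrow> real"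
    and \<A> :: "'p \<Rightarrow> ('p, 'ep) tvec \<Rightarrow> ('g, 'eg) tvec"
    and \<A>S :: "'q \<Rightarrow> ('q, 'eq) tvec \<Rightarrow> ('g, 'eg) tvec"
    and Q :: "'q \<Rightarrow> 'p"
    and \<P> :: "'q \<Rightarrow> ('p, 'ep) tvec \<Rightarrow> real"
    and PA :: "'m \<Rightarrow> ('m, 'em) tvec \<Rightarrow> real"
    and \<zeta> :: "'q \<Rightarrow> ('g, 'eg) tvec \<Rightarrow> real"
    and \<beta> :: "'m \<Rightarrow> ('m, 'es) tvec \<Rightarrow> real"
  assumes "lie_group G"
    and "principal_bundle G P"
    and "principal_bundle G PS"
    and "submanifold (base_atlas PS) (base_atlas P)"
    and "volume_form (base_atlas PS) \<omega>"
    and "principal_connection G P \<A>"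
    and "principal_connection G PS \<A>S"
    and "Q \<in> Q_KK G P PS"
    and "\<P> \<in> cotangent_Q_KK G P PS Q"
    and PA_def: "PA = horizontal_momentum P PS \<A> Q \<P>"
    and \<zeta>_def: "\<zeta> = fiber_momentum G P Q \<P>"
    and \<beta>_def: "\<beta> = (\<lambda>s v.
           PA s (tangent_map (base_atlas PS) (base_atlas P) (base_map P PS Q) s v) +
           reduce_form PS (connection_difference_form P PS \<A> \<A>S Q \<zeta>) s v)"
  shows "(\<beta>, \<zeta>) \<in> one_forms (base_atlas PS) \<times> equivariant_dual_functions G PS \<and>
    (\<forall>U\<in>aut_algebra G PS.
       integrable_over (base_atlas PS) \<omega> (base_contraction PS \<beta> U) \<longrightarrow>
       integrable_over (base_atlas PS) \<omega> (fiber_contraction PS \<A>S \<zeta> U) \<longrightarrow>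
       integrable_over (base_atlas PS) \<omega> (Q_KK_contraction PS \<P> (composition_generator P PS U Q)) \<and>
       J_R P PS \<omega> Q \<P> U = aut_dual_of_pair PS \<omega> \<A>S (\<beta>, \<zeta>) U)"
proof -
  interpret kaluza_klein G P \<A> PS \<A>S Q \<P>
    using assms by unfold_locales
  have "\<beta> = momentum_form"
    by (simp add: fun_eq_iff \<beta>_def PA_def \<zeta>_def momentum_form_def)
  then show ?thesis
    using momentum_form_one_form \<zeta>_equivariant_dual momentum_map_eq by (simp add: \<zeta>_def)
qed

end
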